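(* Let $\{Z_n(dy)\}_{n\ge0}$ be the LF-process defined by a triplet $\{K(x,dy),\gamma(dy),m\}$, and put $Z_n=Z_n(E)$. Assume $f(R_* )\ge 1/m$, let $R\in(0,\infty)$ be the unique solution of $mf(R)=1$, and assume $x\in E_R$ and $f'(R)<\infty$. Put $\rho=R^{-1}$, $\beta=mRf'(R)$, and let $\rho=1$. Then as $n\to\infty$, $$\mathrm{P}_x(Z_n>0)\sim \beta\, n^{-1}(1+m)^{-1}u(x).$$ Moreover, for any measurable probe function $w$ on $E$ with $\int w(y)\nu(dy)\in(0,\infty)$, and for any $t\ge0$, $$\mathrm{P}_x\Big(\frac{\int w(y)Z_n(dy)}{\int w(y)\nu(dy)}>nt\,\Big|\,Z_n>0\Big)\to e^{-t\beta/(1+m)},\qquad n\to\infty.$$ In other words, conditionally on non-extinction the scaled random measure $n^{-1}Z_n(dy)$ weakly converges to $X\nu(dy)$, where $X$ is exponentially distributed with mean $1+m$.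
   Context: $(E,\mathcal E)$ is a measurable space (of types); all integrals are over $E$. A triplet $\{K(x,dy),\gamma(dy),m\}$ consists of a sub-stochastic kernel $K$ on $(E,\mathcal E)$ (so $K(x,E)\le 1$), a probability measure $\gamma$ on $(E,\mathcal E)$, and a number $m\in(0,\infty)$. LF-process: the discrete-time multi-type Bienaymé-Galton-Watson process with type space $E$, in which particles of the same generation reproduce independently of each other, each according to a law determined by its type, as follows. A particle of type $x$ has no offspring with probability $1-K(x,E)$; with probability $K(x,E)$ it has $k\ge1$ offspring, where, given that there is at least one offspring, $k$ has probability $m^{k-1}/(1+m)^k$, $k\ge 1$. Given that there are $k\ge1$ offspring, their types are independent, one of them (the marked one) having type distribution $K(x,dy)/K(x,E)$ and the remaining $k-1$ having type distribution $\gamma$. $Z_n(A)$ denotes the number of $n$-th generation particles with types in $A\in\mathcal E$. $\mathrm{P}_x$ denotes probability given that the process starts from a single particle of type $x$. Kernel powers: $K^0(x,A)=1_{\{x\in A\}}$, $K^n(x,A)=\int K^{n-1}(y,A)K(x,dy)$, $n\ge1$. For $s\ge0$, $$K^{(s)}(x,A)=\sum_{n=0}^\infty s^nK^n(x,A),\qquad E_s=\{x\in E:K^{(s)}(x,E)<\infty\},$$ $$f(s)=\sum_{n\ge1}d_ns^n,\qquad d_n=\int K^n(x,E)\gamma(dx),$$ $R_*=\inf\{s>0:f(s)=\infty\}$ is the radius of convergence of $f$ (if $R_*=\infty$, $f(R_* )$ is the limit of $f(s)$ as $s\to\infty$), and $f'(R)=\sum_{n\ge1}nd_nR^{n-1}$.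 The function $u$ and the probability measure $\nu$ are $$u(x)=(1+m)\big(K^{(R)}(x,E)-1\big)1_{\{x\in E_R\}},\qquad \nu(A)=\frac{m}{1+m}\int K^{(R)}(y,A)\gamma(dy).$$
   Formalization: The survival asymptotic is proved without the factor β, and X has mean (1+m)/β instead of 1+m; as printed both fail for one type, m=1, K=1/2. The conditional claims assume P_x(Z_n>0)>0 for all large n, so that the conditioning is defined. *)

theory Defs
  imports "HOL-Probability.Probability" "HOL-Library.Landau_Symbols"
begin

definition lf_triplet :: "'a measure \<Rightarrow> ('a \<Rightarrow> 'a measure) \<Rightarrow> 'a measure \<Rightarrow> real \<Rightarrow> bool" where
  "lf_triplet E K \<gamma> m \<longleftrightarrow>
     K \<in> E \<rightarrow>\<^sub>M subprob_algebra E \<and> prob_space \<gamma> \<and> sets \<gamma> = sets E \<and> 0 < m"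

text \<open>
  A generation is stored as the finite list of the types of its particles; the order of the list
  carries no meaning. The \<sigma>-algebra makes the space of lists the disjoint union of the
  product spaces \<open>E\<^sup>k\<close>.
\<close>

definition list_space :: "'a measure \<Rightarrow> 'a list measure" where
  "list_space E = sigma (lists (space E)) {listset As | As. set As \<subseteq> sets E}"

text \<open>The measure \<open>Z(dy)\<close> of a generation: it gives \<open>A\<close> the number of particles with type in \<open>A\<close>.\<close>

definition pop_measure :: "'a measure \<Rightarrow> 'a list \<Rightarrow> 'a measure" where
  "pop_measure E zs = distr (count_space {..<length zs}) E (\<lambda>i. zs ! i)"

primrec iid_types :: "'a measure \<Rightarrow> 'a measure \<Rightarrow> nat \<Rightarrow> 'a list measure" where
  "iid_types E \<gamma> 0 = return (list_space E) []"
| "iid_types E \<gamma> (Suc n) =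
     Giry_Monad.bind \<gamma> (\<lambda>y. Giry_Monad.bind (iid_types E \<gamma> n) (\<lambda>ys. return (list_space E) (y # ys)))"

text \<open>
  With \<open>k \<ge> 1\<close> children, \<open>geometric_pmf (1 / (1 + m))\<close> is the law of \<open>k - 1\<close>: it gives \<open>k - 1\<close>
  the weight \<open>m\<^sup>k\<^sup>-\<^sup>1 / (1 + m)\<^sup>k\<close>. The marked child is the head of the list; its type has law
  \<open>uniform_measure (K x) (space E)\<close>, that is, \<open>K x\<close> divided by its total mass.
\<close>

definition lf_offspring ::
  "'a measure \<Rightarrow> ('a \<Rightarrow> 'a measure) \<Rightarrow> 'a measure \<Rightarrow> real \<Rightarrow> 'a \<Rightarrow> 'a list measure" where
  "lf_offspring E K \<gamma> m x =
     Giry_Monad.bind (measure_pmf (bernoulli_pmf (measure (K x) (space E)))) (\<lambda>alive.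
       if alive then
         Giry_Monad.bind (measure_pmf (geometric_pmf (1 / (1 + m)))) (\<lambda>j.
         Giry_Monad.bind (uniform_measure (K x) (space E)) (\<lambda>y.
         Giry_Monad.bind (iid_types E \<gamma> j) (\<lambda>ys.
           return (list_space E) (y # ys))))
       else return (list_space E) [])"

text \<open>Law of the next generation, the particles of the present one reproducing independently.\<close>

primrec lf_next ::
  "'a measure \<Rightarrow> ('a \<Rightarrow> 'a measure) \<Rightarrow> 'a measure \<Rightarrow> real \<Rightarrow> 'a list \<Rightarrow> 'a list measure" where
  "lf_next E K \<gamma> m [] = return (list_space E) []"
| "lf_next E K \<gamma> m (x # xs) =
     Giry_Monad.bind (lf_offspring E K \<gamma> m x) (\<lambda>ys.
     Giry_Monad.bind (lf_next E K \<gamma> m xs) (\<lambda>zs. return (list_space E) (ys @ zs)))"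

text \<open>
  \<open>Z\<close> is a realisation, on the probability space \<open>P\<close>, of the LF-process started from one particle
  of type \<open>x\<close>. The last clause says that \<open>lf_next E K \<gamma> m (Z n)\<close> is the conditional law of
  \<open>Z (Suc n)\<close> given the generations \<open>0, \<dots>, n\<close>.
\<close>

definition lf_process ::
  "'a measure \<Rightarrow> ('a \<Rightarrow> 'a measure) \<Rightarrow> 'a measure \<Rightarrow> real \<Rightarrow> 'a \<Rightarrow>
   'w measure \<Rightarrow> (nat \<Rightarrow> 'w \<Rightarrow> 'a list) \<Rightarrow> bool" where
  "lf_process E K \<gamma> m x P Z \<longleftrightarrow>
     prob_space P \<and>
     (\<forall>n. Z n \<in> P \<rightarrow>\<^sub>M list_space E) \<and>
     distr P (list_space E) (Z 0) = return (list_space E) [x] \<and>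
     (\<forall>n. \<forall>A \<in> sets (list_space E). \<forall>B \<in> sets (PiM {..n} (\<lambda>_. list_space E)).
        emeasure P {\<omega> \<in> space P. (\<lambda>i\<in>{..n}. Z i \<omega>) \<in> B \<and> Z (Suc n) \<omega> \<in> A} =
        (\<integral>\<^sup>+\<omega>. indicator B (\<lambda>i\<in>{..n}. Z i \<omega>) * emeasure (lf_next E K \<gamma> m (Z n \<omega>)) A \<partial>P))"

primrec kernel_pow :: "('a \<Rightarrow> 'a measure) \<Rightarrow> nat \<Rightarrow> 'a \<Rightarrow> 'a set \<Rightarrow> ennreal" where
  "kernel_pow K 0 x A = indicator A x"
| "kernel_pow K (Suc n) x A = (\<integral>\<^sup>+y. kernel_pow K n y A \<partial>K x)"

definition kernel_gen :: "('a \<Rightarrow> 'a measure) \<Rightarrow> ennreal \<Rightarrow> 'a \<Rightarrow> 'a set \<Rightarrow> ennreal" where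
  "kernel_gen K s x A = (\<Sum>n. s ^ n * kernel_pow K n x A)"

definition kernel_fin :: "'a measure \<Rightarrow> ('a \<Rightarrow> 'a measure) \<Rightarrow> ennreal \<Rightarrow> 'a set" where
  "kernel_fin E K s = {x \<in> space E. kernel_gen K s x (space E) < \<infinity>}"

definition lf_d :: "'a measure \<Rightarrow> ('a \<Rightarrow> 'a measure) \<Rightarrow> 'a measure \<Rightarrow> nat \<Rightarrow> ennreal" where
  "lf_d E K \<gamma> n = (\<integral>\<^sup>+x. kernel_pow K n x (space E) \<partial>\<gamma>)"

text \<open>
  The argument ranges over \<open>[0, \<infinity>]\<close>. At \<open>s = \<infinity>\<close> the series, with \<open>\<infinity> * 0 = 0\<close>, is the limit
  of \<open>lf_f E K \<gamma> s\<close> as \<open>s\<close> increases to \<open>\<infinity>\<close>.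
\<close>

definition lf_f :: "'a measure \<Rightarrow> ('a \<Rightarrow> 'a measure) \<Rightarrow> 'a measure \<Rightarrow> ennreal \<Rightarrow> ennreal" where
  "lf_f E K \<gamma> s = (\<Sum>n. lf_d E K \<gamma> (Suc n) * s ^ Suc n)"

definition lf_f' :: "'a measure \<Rightarrow> ('a \<Rightarrow> 'a measure) \<Rightarrow> 'a measure \<Rightarrow> ennreal \<Rightarrow> ennreal" where
  "lf_f' E K \<gamma> s = (\<Sum>n. of_nat (Suc n) * lf_d E K \<gamma> (Suc n) * s ^ n)"

definition lf_Rstar :: "'a measure \<Rightarrow> ('a \<Rightarrow> 'a measure) \<Rightarrow> 'a measure \<Rightarrow> ennreal" where
  "lf_Rstar E K \<gamma> = Inf {s. 0 < s \<and> lf_f E K \<gamma> s = \<infinity>}"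

text \<open>
  Not normalised: \<open>\<integral> u d\<nu> = m * R * f' R\<close>. Dividing \<open>u\<close> by this number makes the integral \<open>1\<close>.
\<close>

definition lf_u :: "'a measure \<Rightarrow> ('a \<Rightarrow> 'a measure) \<Rightarrow> real \<Rightarrow> real \<Rightarrow> 'a \<Rightarrow> real" where
  "lf_u E K m R x =
     (1 + m) * (enn2real (kernel_gen K (ennreal R) x (space E)) - 1)
       * indicator (kernel_fin E K (ennreal R)) x"

definition lf_nu ::
  "'a measure \<Rightarrow> ('a \<Rightarrow> 'a measure) \<Rightarrow> 'a measure \<Rightarrow> real \<Rightarrow> real \<Rightarrow> 'a measure" where
  "lf_nu E K \<gamma> m R = measure_of (space E) (sets E)
     (\<lambda>A. ennreal (m / (1 + m)) * (\<integral>\<^sup>+y. kernel_gen K (ennreal R) y A \<partial>\<gamma>))"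

end

theory Submission
  imports Defs
begin

text \<open>
  For measurable \<open>h\<close> with \<open>\<bar>h\<bar> \<le> 1\<close>, complex-valued, the offspring generating functional is
  linear-fractional in \<open>h\<close>, so its \<open>n\<close>-th iterate can be solved explicitly: with \<open>g = 1 - h\<close>,
  \<open>1 - E\<^sub>x \<Prod>h(z) = a\<^sub>n(x) / b\<^sub>n\<close>, the product running over the \<open>n\<close>-th generation, where
  \<open>a\<^sub>n = K\<^sup>n g + m \<Sum>\<^sub>j c\<^sub>j K\<^sup>n\<^sup>-\<^sup>j 1\<close>, \<open>b\<^sub>n = 1 + m \<Sum>\<^sub>j c\<^sub>j\<close> (both sums over \<open>j < n\<close>), and
  \<open>c\<close> solves the renewal equation with forcing \<open>\<integral>K\<^sup>n g d\<gamma>\<close> and weights \<open>m d\<^sub>k\<close>. For \<open>R = 1\<close> the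
  weights sum to \<open>1\<close> and have mean \<open>\<beta>\<close>. They are nonincreasing in \<open>k\<close>, so the first one is positive
  and the renewal theorem applies without an aperiodicity assumption. The choice \<open>h = 0\<close> gives the
  survival probability, and \<open>h = exp (i \<theta> w / n)\<close> the conditional characteristic function of
  \<open>\<integral>w dZ\<^sub>n / n\<close>, which converges to that of the exponential limit; Levy's continuity theorem
  concludes.
\<close>

section \<open>The renewal theorem\<close>

text \<open>Complex exponentials are the test functions because \<open>w\<close> may change sign: it
  is only \<nu>-integrable, yet exp(i \<theta> w / n) has norm at most 1. Their scale differs from
  that of h = 0. There b_n grows like n while a_n converges, so survival is of order 1/n; for the
  exponentials g itself is of order 1/n, so b_n converges and a_n is of order 1/n. One limit theorem
  with a scale factor covers both. The domination comes from \<nu>: it is m/(1+m) times the sum of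
  the measures \<gamma>K^n, and the forcing is the integral of g against \<gamma>K^n, so
  \<nu>-integrability of \<open>w\<close> makes the bounds |\<theta>| \<integral>|w| d(\<gamma>K^n)
  summable. In the survival quotient the factor (1+m)/\<beta> occurs above and below and cancels;
  for the exponentials it survives as the mean of the limit. An averaged renewal theorem would serve
  b_n only: a_n is a convolution of c with the masses K^k 1(x), which calls for pointwise
  convergence.\<close>

lemma convolution_tendsto:
  fixes \<alpha> X :: "nat \<Rightarrow> 'a :: {real_normed_field, banach}"
  assumes \<alpha>: "summable (\<lambda>k. norm (\<alpha> k))" and B: "\<And>n. norm (X n) \<le> B"
    and s: "filterlim s at_top F" and F: "F \<noteq> bot"
    and lim: "\<And>k. ((\<lambda>i. X (s i - k)) \<longlongrightarrow> L) F"
  shows "((\<lambda>i. \<Sum>k\<le>s i. \<alpha> k * X (s i - k)) \<longlongrightarrow> suminf \<alpha> * L) F"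
proof -
  \<comment> \<open>Extension by 0 beyond \<open>s i\<close> turns the finite convolution into a
    series over a fixed index set, to which Tannery's theorem applies with dominating terms
    \<open>norm (\<alpha> k) * B\<close>.\<close>
  define a where "a k i = (if k \<le> s i then \<alpha> k * X (s i - k) else 0)" for k i
  have B0: "0 \<le> B" using B[of 0] norm_ge_zero order_trans by blast
  have *: "((\<lambda>i. suminf (\<lambda>k. a k i)) \<longlongrightarrow> (\<Sum>k. \<alpha> k * L)) F"
  proof (rule tannerys_theorem[THEN conjunct2, THEN conjunct2])
    fix k
    have "eventually (\<lambda>i. k \<le> s i) F"
      using s by (simp add: filterlim_at_top)
    then have "eventually (\<lambda>i. a k i = \<alpha> k * X (s i - k)) F"
      by eventually_elim (simp add: a_def)
    moreover have "((\<lambda>i. \<alpha> k * X (s i - k)) \<longlongrightarrow> \<alpha> k * L) F"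
      by (intro tendsto_intros lim)
    ultimately show "((\<lambda>i. a k i) \<longlongrightarrow> \<alpha> k * L) F"
      by (simp add: tendsto_cong)
  next
    show "eventually (\<lambda>(k, i). norm (a k i) \<le> norm (\<alpha> k) * B) (at_top \<times>\<^sub>F F)"
      by (intro always_eventually)
         (auto simp: a_def norm_mult B0 intro!: mult_left_mono B)
    show "summable (\<lambda>k. norm (\<alpha> k) * B)" using \<alpha> by (rule summable_mult2)
  qed (rule F)
  have "suminf (\<lambda>k. a k i) = (\<Sum>k\<le>s i. \<alpha> k * X (s i - k))" for i
    by (subst suminf_finite[of "{..s i}"]) (auto simp: a_def intro!: sum.cong)
  moreover have "(\<Sum>k. \<alpha> k * L) = suminf \<alpha> * L"
    using \<alpha> by (simp add: suminf_mult2 summable_norm_cancel)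
  ultimately show ?thesis using * by simp
qed

text \<open>The weight of \<open>n + 1\<close> is \<open>q n\<close>.\<close>

fun renewal :: "(nat \<Rightarrow> real) \<Rightarrow> nat \<Rightarrow> real" where
  "renewal q 0 = 1"
| "renewal q (Suc n) = (\<Sum>k\<le>n. q k * renewal q (n - k))"

locale renewal_weights =
  fixes q :: "nat \<Rightarrow> real" and \<beta> :: real
  assumes q_nonneg: "0 \<le> q n" and q_sums: "q sums 1" and q_0: "0 < q 0"
    and mean: "(\<lambda>n. real (Suc n) * q n) sums \<beta>"
begin

lemma sum_q_le: "(\<Sum>k\<le>n. q k) \<le> 1"
proof -
  have "(\<Sum>k<Suc n. q k) \<le> suminf q"
    using q_sums by (intro sum_le_suminf) (auto simp: q_nonneg sums_iff)
  then show ?thesis using q_sums by (simp add: sums_iff lessThan_Suc_atMost)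
qed

lemma renewal_bounds: "0 \<le> renewal q n \<and> renewal q n \<le> 1"
proof (induction n rule: less_induct)
  case (less n)
  show ?case
  proof (cases n)
    case (Suc l)
    have "(\<Sum>k\<le>l. q k * renewal q (l - k)) \<le> (\<Sum>k\<le>l. q k * 1)"
      using less Suc by (intro sum_mono mult_left_mono) (auto simp: q_nonneg)
    with sum_q_le[of l] have "renewal q n \<le> 1" by (simp add: Suc)
    moreover have "0 \<le> renewal q n"
      unfolding Suc renewal.simps using less Suc by (intro sum_nonneg mult_nonneg_nonneg) (auto simp: q_nonneg)
    ultimately show ?thesis by simp
  qed simp
qed

text \<open>Since \<open>q k\<close> belongs to the lifetime \<open>k + 1\<close>, this is the
  weight of the lifetimes greater than \<open>n\<close>.\<close>

definition tail :: "nat \<Rightarrow> real" where "tail n = (\<Sum>k. q (k + n))"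

lemma summable_q: "summable q" using q_sums by (simp add: sums_iff)

lemma summable_q_shift: "summable (\<lambda>k. q (k + n))"
  by (rule summable_ignore_initial_segment[OF summable_q])

lemma tail_0: "tail 0 = 1" using q_sums by (simp add: tail_def sums_iff)

lemma tail_Suc: "tail (Suc n) = tail n - q n"
  unfolding tail_def using suminf_split_head[of "\<lambda>k. q (k + n)"] summable_q
  by (simp add: summable_iff_shift)

lemma tail_nonneg: "0 \<le> tail n"
  unfolding tail_def by (intro suminf_nonneg summable_q_shift q_nonneg)

text \<open>Summation by parts. The boundary term vanishes in the limit when the mean is finite, so
  that the tails sum to the mean.\<close>

lemma sum_tail: "(\<Sum>k<n. tail k) = (\<Sum>k<n. real (Suc k) * q k) + real n * tail n"
  by (induction n) (simp_all add: tail_Suc algebra_simps)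

lemma n_tail_tendsto: "(\<lambda>n. real n * tail n) \<longlonglongrightarrow> 0"
proof -
  let ?g = "\<lambda>k. real (Suc k) * q k"
  have sg: "summable ?g" using mean by (simp add: sums_iff)
  have "real n * tail n \<le> (\<Sum>k. ?g (k + n))" for n
  proof -
    have "real n * tail n = (\<Sum>k. real n * q (k + n))"
      unfolding tail_def by (intro suminf_mult[symmetric] summable_q_shift)
    also have "\<dots> \<le> (\<Sum>k. ?g (k + n))"
      by (intro suminf_le mult_right_mono q_nonneg summable_mult summable_q_shift
          summable_ignore_initial_segment[OF sg]) auto
    finally show ?thesis .
  qed
  moreover have "(\<lambda>n. \<Sum>k. ?g (k + n)) \<longlonglongrightarrow> 0" using suminf_exist_split2[OF sg] .
  ultimately show ?thesis
    using tendsto_sandwich[of "\<lambda>_. 0" "\<lambda>n. real n * tail n" sequentially "\<lambda>n. \<Sum>k. ?g (k + n)" 0]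
    by (simp add: tail_nonneg)
qed

lemma tail_sums: "tail sums \<beta>"
  using tendsto_add[OF mean[unfolded sums_def] n_tail_tendsto]
  by (simp add: sums_def sum_tail)

lemma mean_pos: "0 < \<beta>"
proof -
  have "tail 0 \<le> suminf tail"
    using sum_le_suminf[of tail "{0}"] tail_sums by (auto simp: sums_iff tail_nonneg)
  then show ?thesis using tail_sums by (simp add: sums_iff tail_0)
qed

text \<open>For the renewal sequence this says that the age at time \<open>n\<close> has total
  weight 1. The identity persists in \<open>n\<close> because consecutive tails differ by
  \<open>q\<close>, which is exactly what the recursion feeds into \<open>W (Suc n)\<close>. It is
  the invariant from which the limit is read off; \<open>W\<close> is arbitrary because the negated
  sequence is treated as well.\<close>

lemma sum_tail_conv:
  assumes W: "\<And>n. W (Suc n) = (\<Sum>k\<le>n. q k * W (n - k))"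
  shows "(\<Sum>k\<le>n. tail k * W (n - k)) = (W 0 :: real)"
proof (induction n)
  case (Suc n)
  have "(\<Sum>k\<le>Suc n. tail k * W (Suc n - k)) = W (Suc n) + (\<Sum>k\<le>n. tail (Suc k) * W (n - k))"
    by (subst sum.atMost_Suc_shift) (simp add: tail_0)
  also have "(\<Sum>k\<le>n. tail (Suc k) * W (n - k)) = (\<Sum>k\<le>n. tail k * W (n - k)) - W (Suc n)"
    by (simp add: tail_Suc W algebra_simps sum_subtractf)
  finally show ?case using Suc by simp
qed (simp add: tail_0)

text \<open>
  Along indices at which \<open>W\<close> approaches its upper limit \<open>L\<close>, the recursion and \<open>q 0 > 0\<close> force every
  shifted sequence to approach \<open>L\<close> too, so that the identity of lemma \<open>sum_tail_conv\<close> passes to the limit.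
\<close>

lemma renewal_upper_limit:
  assumes W: "\<And>n. W (Suc n) = (\<Sum>k\<le>n. q k * W (n - k))" and B: "\<And>n. \<bar>W n\<bar> \<le> (B :: real)"
  shows "(\<lambda>n. SUP i\<in>{n..}. W i) \<longlonglongrightarrow> W 0 / \<beta>"
proof -
  define M where "M n = (SUP i\<in>{n..}. W i)" for n
  have bdd: "bdd_above (W ` {n..})" for n
    using B by (intro bdd_aboveI[of _ B]) (auto simp: abs_le_iff)
  have W_le_M: "W n \<le> M k" if "k \<le> n" for n k
    unfolding M_def by (rule cSUP_upper[OF _ bdd]) (use that in auto)
  have M_le: "M n \<le> B" for n
    unfolding M_def using B by (intro cSUP_least) (auto simp: abs_le_iff)
  have absM: "\<bar>M n\<bar> \<le> B" for n
    using W_le_M[of n n] B[of n] M_le[of n] by (auto simp: abs_le_iff)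
  have "decseq M"
    unfolding M_def by (intro decseq_SucI cSUP_subset_mono bdd) auto
  then obtain L where L: "M \<longlonglongrightarrow> L"
    using decseq_convergent[of M "-B"] absM by (metis abs_le_iff minus_le_iff)
  \<comment> \<open>The supremum need not be attained, so \<open>r\<close> selects indices within a
    vanishing slack of it.\<close>
  have "\<exists>i\<ge>n. M n - 1 / real (Suc n) < W i" for n
  proof -
    have "M n - 1 / real (Suc n) < M n" by simp
    then show ?thesis
      unfolding M_def by (subst (asm) less_cSUP_iff[OF _ bdd]) auto
  qed
  then obtain r where r: "\<And>n. n \<le> r n" "\<And>n. M n - 1 / real (Suc n) < W (r n)" by metis
  have r_top: "filterlim r at_top sequentially"
    by (rule filterlim_at_top_mono[OF filterlim_ident]) (auto simp: r)
  have rk_top: "filterlim (\<lambda>j. r j - k) at_top sequentially" for k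
    by (rule filterlim_compose[OF _ r_top]) (rule filterlim_minus_const_nat_at_top)
  have r_lim: "(\<lambda>j. W (r j - k)) \<longlonglongrightarrow> L" for k
  proof (induction k)
    case 0
    have "(\<lambda>n. M n - 1 / real (Suc n)) \<longlonglongrightarrow> L - 0"
      by (intro tendsto_intros L LIMSEQ_Suc[OF lim_1_over_n])
    moreover have "M n - 1 / real (Suc n) \<le> W (r n)" for n
      using r(2)[of n] by simp
    moreover have "W (r n) \<le> M n" for n by (rule W_le_M) (rule r)
    ultimately show ?case
      using tendsto_sandwich[of "\<lambda>n. M n - 1 / real (Suc n)" "\<lambda>n. W (r n)" sequentially M L] L by simp
  next
    case (Suc k)
    define s where "s j = r j - Suc k" for j
    have s_top: "filterlim s at_top sequentially" unfolding s_def by (rule rk_top)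
    have Suc_s: "eventually (\<lambda>j. r j - k = Suc (s j)) sequentially"
      using eventually_ge_at_top[of "Suc k"]
    proof eventually_elim
      case (elim j)
      with r(1)[of j] show ?case by (simp add: s_def)
    qed
    have lim1: "(\<lambda>j. W (Suc (s j))) \<longlonglongrightarrow> L"
      using Suc.IH by (rule Lim_transform_eventually) (use Suc_s in \<open>auto elim: eventually_mono\<close>)
    have M_lim: "(\<lambda>j. M (s j - i)) \<longlonglongrightarrow> L" for i
      by (rule filterlim_compose[OF L filterlim_compose[OF filterlim_minus_const_nat_at_top s_top]])
    have "(\<lambda>j. \<Sum>i\<le>s j. q i * M (s j - i)) \<longlonglongrightarrow> suminf q * L"
      using summable_q absM M_lim
      by (intro convolution_tendsto[OF _ _ s_top]) (auto simp: q_nonneg)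
    then have lim2: "(\<lambda>j. \<Sum>i\<le>s j. q i * M (s j - i)) \<longlonglongrightarrow> L"
      using q_sums by (simp add: sums_iff)
    \<comment> \<open>The defects \<open>M - W\<close> are nonnegative, so the one with weight
      \<open>q 0\<close> is at most their full weighted sum. That sum is the difference of two
      quantities tending to \<open>L\<close>; division by \<open>q 0\<close> forces the defect at
      \<open>s j\<close> to 0.\<close>
    have "q 0 * M (s j) - ((\<Sum>i\<le>s j. q i * M (s j - i)) - W (Suc (s j))) \<le> q 0 * W (s j)" for j
    proof -
      have "(\<Sum>i\<le>s j. q i * (M (s j - i) - W (s j - i))) \<ge> (\<Sum>i\<in>{0}. q i * (M (s j - i) - W (s j - i)))"
        by (intro sum_mono2 mult_nonneg_nonneg q_nonneg) (auto simp: W_le_M)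
      then show ?thesis by (simp add: W algebra_simps sum_subtractf)
    qed
    then have "M (s j) - ((\<Sum>i\<le>s j. q i * M (s j - i)) - W (Suc (s j))) / q 0 \<le> W (s j)" for j
      using q_0 by (simp add: field_simps)
    moreover have "(\<lambda>j. M (s j) - ((\<Sum>i\<le>s j. q i * M (s j - i)) - W (Suc (s j))) / q 0) \<longlonglongrightarrow> L - (L - L) / q 0"
      using q_0 by (intro tendsto_intros lim1 lim2 filterlim_compose[OF L s_top]) auto
    ultimately have "(\<lambda>j. W (s j)) \<longlonglongrightarrow> L"
      using tendsto_sandwich[of "\<lambda>j. M (s j) - ((\<Sum>i\<le>s j. q i * M (s j - i)) - W (Suc (s j))) / q 0"
          "\<lambda>j. W (s j)" sequentially "\<lambda>j. M (s j)" L] filterlim_compose[OF L s_top] W_le_M by simp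
    then show ?case by (simp add: s_def)
  qed
  have "(\<lambda>j. \<Sum>k\<le>r j. tail k * W (r j - k)) \<longlonglongrightarrow> suminf tail * L"
    using tail_sums B r_lim
    by (intro convolution_tendsto[OF _ _ r_top]) (auto simp: tail_nonneg sums_iff)
  then have "(\<lambda>j. W 0) \<longlonglongrightarrow> \<beta> * L"
    using tail_sums by (simp add: sum_tail_conv[OF W] sums_iff)
  then have "W 0 = \<beta> * L" by (simp add: LIMSEQ_const_iff)
  then have "L = W 0 / \<beta>" using mean_pos by simp
  with L show ?thesis by (simp add: M_def[abs_def])
qed

text \<open>The upper limit was computed from the linear recursion and boundedness alone, so the
  same lemma applies to the negated sequence and yields the lower limit, with the same
  value.\<close>

theorem renewal_tendsto: "renewal q \<longlonglongrightarrow> 1 / \<beta>"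
proof -
  have B: "\<bar>renewal q n\<bar> \<le> 1" for n using renewal_bounds[of n] by simp
  have 1: "(\<lambda>n. SUP i\<in>{n..}. renewal q i) \<longlonglongrightarrow> 1 / \<beta>"
    using renewal_upper_limit[of "renewal q", OF _ B] by simp
  have "(\<lambda>n. SUP i\<in>{n..}. - renewal q i) \<longlonglongrightarrow> - 1 / \<beta>"
    using renewal_upper_limit[of "\<lambda>n. - renewal q n" 1] B by (simp add: sum_negf)
  then have 2: "(\<lambda>n. - (SUP i\<in>{n..}. - renewal q i)) \<longlonglongrightarrow> 1 / \<beta>"
    by (drule_tac tendsto_minus) simp
  have "renewal q n \<le> (SUP i\<in>{n..}. renewal q i)" for n
    by (rule cSUP_upper) (use B in \<open>auto intro!: bdd_aboveI[of _ 1] simp: abs_le_iff\<close>)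
  moreover have "- renewal q n \<le> (SUP i\<in>{n..}. - renewal q i)" for n
    by (rule cSUP_upper) (use B in \<open>auto intro!: bdd_aboveI[of _ 1] simp: abs_le_iff minus_le_iff\<close>)
  then have "- (SUP i\<in>{n..}. - renewal q i) \<le> renewal q n" for n
    by (simp add: minus_le_iff)
  ultimately show ?thesis
    by (intro tendsto_sandwich[OF _ _ 2 1] always_eventually allI)
qed

end

section \<open>Averages and convolutions of the renewal sequence\<close>

lemma cesaro_tendsto:
  fixes X :: "nat \<Rightarrow> real"
  assumes X: "X \<longlonglongrightarrow> L"
  shows "(\<lambda>n. (\<Sum>k<n. X k) / real n) \<longlonglongrightarrow> L"
proof (rule LIMSEQ_I)
  fix e :: real assume e: "0 < e"
  obtain N where N: "\<And>k. k \<ge> N \<Longrightarrow> \<bar>X k - L\<bar> < e / 2"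
    using LIMSEQ_D[OF X, of "e / 2"] e by auto
  define S where "S = (\<Sum>k<N. \<bar>X k - L\<bar>)"
  obtain M :: nat where M: "2 * S / e < real M" using reals_Archimedean2 by blast
  show "\<exists>no. \<forall>n\<ge>no. norm ((\<Sum>k<n. X k) / real n - L) < e"
  proof (intro exI allI impI)
    fix n assume "n \<ge> max (max N M) 1"
    then have n: "N \<le> n" "M \<le> n" "1 \<le> n" by auto
    have "2 * S / e < real n" using M n(2) by linarith
    then have S: "S < real n * (e / 2)" using e by (simp add: field_simps)
    have "(\<Sum>k<n. X k) / real n - L = (\<Sum>k<n. X k - L) / real n"
      using n by (simp add: sum_subtractf field_simps)
    also have "\<bar>\<dots>\<bar> \<le> (\<Sum>k<n. \<bar>X k - L\<bar>) / real n"
      by (simp add: divide_right_mono)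
    also have "(\<Sum>k<n. \<bar>X k - L\<bar>) = S + (\<Sum>k\<in>{N..<n}. \<bar>X k - L\<bar>)"
      unfolding S_def using n(1) by (subst sum.union_disjoint[symmetric]) (auto intro!: sum.cong)
    also have "(\<Sum>k\<in>{N..<n}. \<bar>X k - L\<bar>) \<le> (\<Sum>k\<in>{N..<n}. e / 2)"
      using N by (intro sum_mono less_imp_le) auto
    also have "\<dots> \<le> real n * (e / 2)" using e by (simp add: mult_right_mono)
    finally have "\<bar>(\<Sum>k<n. X k) / real n - L\<bar> \<le> (S + real n * (e / 2)) / real n"
      using n by (simp add: divide_right_mono)
    also have "\<dots> < e" using S n by (simp add: field_simps)
    finally show "norm ((\<Sum>k<n. X k) / real n - L) < e" by simp
  qed
qed

context renewal_weights
begin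

lemma abs_renewal_le_1: "\<bar>renewal q n\<bar> \<le> 1"
  using renewal_bounds[of n] by simp

text \<open>The shift by \<open>i\<close> removes the last \<open>i\<close> terms, each at most 1,
  and so costs at most \<open>i / n\<close>.\<close>

lemma renewal_average_tendsto:
  "(\<lambda>n. (\<Sum>j\<in>{i..<n}. renewal q (j - i)) / real n) \<longlonglongrightarrow> 1 / \<beta>"
proof -
  let ?A = "\<lambda>n. (\<Sum>k<n. renewal q k) / real n"
  have A: "?A \<longlonglongrightarrow> 1 / \<beta>" by (rule cesaro_tendsto[OF renewal_tendsto])
  have eq: "(\<Sum>j\<in>{i..<n}. renewal q (j - i)) = (\<Sum>k<n - i. renewal q k)" for n
    by (rule sum.reindex_bij_witness[of _ "\<lambda>k. k + i" "\<lambda>j. j - i"]) auto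
  have upper: "(\<Sum>k<n - i. renewal q k) \<le> (\<Sum>k<n. renewal q k)" for n
    by (rule sum_mono2) (use renewal_bounds in auto)
  have lower: "(\<Sum>k<n. renewal q k) - real i \<le> (\<Sum>k<n - i. renewal q k)" for n
  proof -
    have "(\<Sum>k<n. renewal q k) - (\<Sum>k<n - i. renewal q k) = (\<Sum>k\<in>{n - i..<n}. renewal q k)"
      using sum_diff_nat_ivl[of 0 "n - i" n "renewal q"] by (simp add: lessThan_atLeast0)
    also have "\<dots> \<le> (\<Sum>k\<in>{n - i..<n}. 1)"
      by (rule sum_mono) (use renewal_bounds in auto)
    finally show ?thesis by simp
  qed
  have "(\<lambda>n. ?A n - real i * (1 / real n)) \<longlonglongrightarrow> 1 / \<beta> - real i * 0"
    by (intro tendsto_intros A lim_1_over_n)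
  then have B: "(\<lambda>n. ?A n - real i * (1 / real n)) \<longlonglongrightarrow> 1 / \<beta>" by simp
  show ?thesis
    unfolding eq
  proof (rule tendsto_sandwich[OF _ _ B A]; intro always_eventually allI)
    fix n
    have "((\<Sum>k<n. renewal q k) - real i) / real n \<le> (\<Sum>k<n - i. renewal q k) / real n"
      by (intro divide_right_mono lower) simp
    then show "?A n - real i * (1 / real n) \<le> (\<Sum>k<n - i. renewal q k) / real n"
      by (simp add: diff_divide_distrib)
    show "(\<Sum>k<n - i. renewal q k) / real n \<le> ?A n"
      by (intro divide_right_mono upper) simp
  qed
qed

lemma renewal_weighted_tendsto:
  assumes \<kappa>: "summable \<kappa>" "\<And>k. 0 \<le> \<kappa> k"
  shows "(\<lambda>n. \<Sum>j\<in>{i..<n}. renewal q (j - i) * \<kappa> (n - 1 - j)) \<longlonglongrightarrow> suminf \<kappa> / \<beta>"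
proof -
  \<comment> \<open>Substituting k = n - 1 - j turns the range from \<open>i\<close> to
    \<open>n - 1\<close> into k \<le> n - 1 - i. The reindexing is valid once \<open>n\<close>
    exceeds \<open>i\<close>.\<close>
  define s where "s n = n - Suc i" for n
  have s: "filterlim s at_top sequentially"
    unfolding s_def by (rule filterlim_minus_const_nat_at_top)
  have "(\<lambda>n. \<Sum>k\<le>s n. \<kappa> k * renewal q (s n - k)) \<longlonglongrightarrow> suminf \<kappa> * (1 / \<beta>)"
    using \<kappa> abs_renewal_le_1
    by (intro convolution_tendsto[OF _ _ s] filterlim_compose[OF renewal_tendsto]
        filterlim_compose[OF filterlim_minus_const_nat_at_top s]) auto
  moreover have "eventually (\<lambda>n. (\<Sum>k\<le>s n. \<kappa> k * renewal q (s n - k)) =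
      (\<Sum>j\<in>{i..<n}. renewal q (j - i) * \<kappa> (n - 1 - j))) sequentially"
    using eventually_gt_at_top[of i]
  proof eventually_elim
    case (elim n)
    then show ?case
      by (intro sum.reindex_bij_witness[of _ "\<lambda>j. n - 1 - j" "\<lambda>k. n - 1 - k"])
         (auto simp: s_def intro!: arg_cong2[where f = "(*)"] arg_cong[where f = "renewal q"])
  qed
  ultimately show ?thesis
    using Lim_transform_eventually by fastforce
qed

text \<open>
  The array \<open>t\<close> is either constant in \<open>j\<close> (averages) or a convolution kernel. Since the double sum
  is a sum over \<open>i\<close> of \<open>e n i\<close> times a partial sum of \<open>t n\<close> against the renewal sequence shifted by
  \<open>i\<close>, dominated convergence in \<open>i\<close> suffices.
\<close>

lemma renewal_array_tendsto:
  fixes e :: "nat \<Rightarrow> nat \<Rightarrow> complex" and t :: "nat \<Rightarrow> nat \<Rightarrow> real"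
  assumes e_lim: "\<And>i. (\<lambda>n. e n i) \<longlonglongrightarrow> L i" and e_le: "\<And>n i. norm (e n i) \<le> D i" and D: "summable D"
    and t_lim: "\<And>i. (\<lambda>n. \<Sum>j\<in>{i..<n}. renewal q (j - i) * t n j) \<longlonglongrightarrow> \<sigma>"
    and t_nonneg: "\<And>n j. 0 \<le> t n j" and t_le: "\<And>n. (\<Sum>j<n. t n j) \<le> B"
  shows "(\<lambda>n. \<Sum>j<n. (\<Sum>i\<le>j. e n i * of_real (renewal q (j - i))) * of_real (t n j)) \<longlonglongrightarrow> suminf L * of_real \<sigma>"
    and "summable L"
proof -
  have D0: "0 \<le> D i" for i using e_le[of 0 i] norm_ge_zero order_trans by blast
  have L_le: "norm (L i) \<le> D i" for i
    by (rule Lim_bounded[OF tendsto_norm[OF e_lim]]) (use e_le in auto)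
  show L: "summable L" by (rule summable_comparison_test'[OF D L_le])
  define S where "S n i = (\<Sum>j\<in>{i..<n}. renewal q (j - i) * t n j)" for n i
  have S_le: "norm (of_real (S n i) :: complex) \<le> B" for n i
  proof -
    have "0 \<le> S n i"
      unfolding S_def using renewal_bounds t_nonneg by (intro sum_nonneg mult_nonneg_nonneg) auto
    moreover have "S n i \<le> (\<Sum>j\<in>{i..<n}. t n j)"
      unfolding S_def using renewal_bounds t_nonneg by (intro sum_mono mult_left_le_one_le) auto
    moreover have "\<dots> \<le> (\<Sum>j<n. t n j)"
      by (rule sum_mono2) (use t_nonneg in auto)
    ultimately show ?thesis using t_le[of n] by simp
  qed
  have *: "(\<lambda>n. \<Sum>i. e n i * of_real (S n i)) \<longlonglongrightarrow> (\<Sum>i. L i * of_real \<sigma>)"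
  proof (rule tannerys_theorem[THEN conjunct2, THEN conjunct2])
    show "(\<lambda>n. e n i * of_real (S n i)) \<longlonglongrightarrow> L i * of_real \<sigma>" for i
      unfolding S_def by (intro tendsto_intros e_lim t_lim)
    show "\<forall>\<^sub>F (i, n) in sequentially \<times>\<^sub>F sequentially. norm (e n i * of_real (S n i)) \<le> D i * B"
      using e_le S_le D0 by (intro always_eventually) (auto simp: norm_mult intro!: mult_mono)
    show "summable (\<lambda>i. D i * B)" by (rule summable_mult2[OF D])
  qed simp
  \<comment> \<open>Indices i \<ge> n contribute empty sums, so the series is finite, and exchanging
    the two sums over the triangle i \<le> j < n restores the original form.\<close>
  have "(\<Sum>i. e n i * of_real (S n i)) =
      (\<Sum>j<n. (\<Sum>i\<le>j. e n i * of_real (renewal q (j - i))) * of_real (t n j))" for n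
  proof -
    have "(\<Sum>i. e n i * of_real (S n i)) = (\<Sum>i<n. e n i * of_real (S n i))"
      by (rule suminf_finite) (auto simp: S_def)
    also have "\<dots> = (\<Sum>i<n. \<Sum>j<n. if i \<le> j then e n i * of_real (renewal q (j - i) * t n j) else 0)"
      unfolding S_def of_real_sum sum_distrib_left
      by (rule sum.cong[OF refl], rule sum.mono_neutral_cong_left) auto
    also have "\<dots> = (\<Sum>j<n. \<Sum>i<n. if i \<le> j then e n i * of_real (renewal q (j - i) * t n j) else 0)"
      by (rule sum.swap)
    also have "\<dots> = (\<Sum>j<n. \<Sum>i\<le>j. e n i * of_real (renewal q (j - i) * t n j))"
      by (rule sum.cong[OF refl], rule sum.mono_neutral_cong_right) auto
    finally show ?thesis by (simp add: sum_distrib_right mult.assoc)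
  qed
  with * show "(\<lambda>n. \<Sum>j<n. (\<Sum>i\<le>j. e n i * of_real (renewal q (j - i))) * of_real (t n j)) \<longlonglongrightarrow> suminf L * of_real \<sigma>"
    using suminf_mult2[OF L, of "of_real \<sigma>"] by simp
qed

end

section \<open>The space of lists\<close>

lemma in_listset_iff: "xs \<in> listset As \<longleftrightarrow> list_all2 (\<in>) xs As"
proof (induction As arbitrary: xs)
  case (Cons A As)
  then show ?case by (cases xs) (auto simp: set_Cons_def)
qed simp

lemma listset_subset_lists: "set As \<subseteq> Pow S \<Longrightarrow> listset As \<subseteq> lists S"
  by (auto simp: in_listset_iff in_lists_conv_set list_all2_conv_all_nth in_set_conv_nth subset_iff)
     (metis nth_mem)

lemma space_list_space: "space (list_space E) = lists (space E)"
  and sets_list_space: "sets (list_space E) =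
    sigma_sets (lists (space E)) {listset As | As. set As \<subseteq> sets E}"
proof -
  have "{listset As | As. set As \<subseteq> sets E} \<subseteq> Pow (lists (space E))"
    using listset_subset_lists[of _ "space E"] sets.space_closed[of E] by blast
  then show "space (list_space E) = lists (space E)"
    "sets (list_space E) = sigma_sets (lists (space E)) {listset As | As. set As \<subseteq> sets E}"
    by (simp_all add: list_space_def space_measure_of sets_measure_of)
qed

lemma listset_in_sets: "set As \<subseteq> sets E \<Longrightarrow> listset As \<in> sets (list_space E)"
  unfolding sets_list_space by (intro sigma_sets.Basic) auto

lemma measurable_list_spaceI:
  assumes "\<And>x. x \<in> space M \<Longrightarrow> f x \<in> lists (space E)"
    and "\<And>As. set As \<subseteq> sets E \<Longrightarrow> f -` listset As \<inter> space M \<in> sets M"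
  shows "f \<in> M \<rightarrow>\<^sub>M list_space E"
  using assms
  by (intro measurable_sigma_sets[OF sets_list_space])
     (use listset_subset_lists[of _ "space E"] sets.space_closed[of E] in blast)+

lemma measurable_Cons:
  "(\<lambda>p. fst p # snd p) \<in> E \<Otimes>\<^sub>M list_space E \<rightarrow>\<^sub>M list_space E"
proof (rule measurable_list_spaceI)
  fix As assume As: "set As \<subseteq> sets E"
  show "(\<lambda>p. fst p # snd p) -` listset As \<inter> space (E \<Otimes>\<^sub>M list_space E) \<in> sets (E \<Otimes>\<^sub>M list_space E)"
  proof (cases As)
    case (Cons A As')
    have "(\<lambda>p. fst p # snd p) -` listset As \<inter> space (E \<Otimes>\<^sub>M list_space E) = A \<times> listset As'"
      using As Cons sets.sets_into_space[of A E] sets.sets_into_space[OF listset_in_sets[of As' E]]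
      by (auto simp: set_Cons_def space_pair_measure)
    also have "\<dots> \<in> sets (E \<Otimes>\<^sub>M list_space E)"
      using As Cons by (intro pair_measureI listset_in_sets) auto
    finally show ?thesis .
  qed (auto simp: vimage_def)
qed (auto simp: space_pair_measure space_list_space)

lemma measurable_Cons' [measurable (raw)]:
  "f \<in> M \<rightarrow>\<^sub>M E \<Longrightarrow> g \<in> M \<rightarrow>\<^sub>M list_space E \<Longrightarrow> (\<lambda>x. f x # g x) \<in> M \<rightarrow>\<^sub>M list_space E"
  using measurable_compose[OF measurable_Pair measurable_Cons, of f M E g] by simp

text \<open>A concatenation lies in a cylinder exactly when the cylinder can be cut at the joint.
  There are only finitely many cut positions, each giving a measurable rectangle.\<close>

lemma measurable_append:
  "(\<lambda>p. fst p @ snd p) \<in> list_space E \<Otimes>\<^sub>M list_space E \<rightarrow>\<^sub>M list_space E"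
proof (rule measurable_list_spaceI)
  fix As assume As: "set As \<subseteq> sets E"
  have *: "set (take k As) \<subseteq> sets E" "set (drop k As) \<subseteq> sets E" for k
    using As set_take_subset[of k As] set_drop_subset[of k As] by auto
  have "(\<lambda>p. fst p @ snd p) -` listset As \<inter> space (list_space E \<Otimes>\<^sub>M list_space E) =
    (\<Union>k\<le>length As. listset (take k As) \<times> listset (drop k As))" (is "?L = ?R")
  proof (intro equalityI subsetI)
    fix p assume p: "p \<in> ?L"
    then obtain us vs where "As = us @ vs" "list_all2 (\<in>) (fst p) us" "list_all2 (\<in>) (snd p) vs"
      by (auto simp: in_listset_iff list_all2_append1)
    then show "p \<in> ?R"
      by (cases p) (auto simp: in_listset_iff intro!: bexI[of _ "length us"])
  next
    fix p assume "p \<in> ?R"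
    then obtain k where k: "fst p \<in> listset (take k As)" "snd p \<in> listset (drop k As)"
      by auto
    then have "fst p @ snd p \<in> listset (take k As @ drop k As)"
      unfolding in_listset_iff by (rule list_all2_appendI)
    moreover have "fst p \<in> lists (space E)" "snd p \<in> lists (space E)"
      using k sets.sets_into_space[OF listset_in_sets[OF *(1)[of k]]]
        sets.sets_into_space[OF listset_in_sets[OF *(2)[of k]]] unfolding space_list_space by blast+
    ultimately show "p \<in> ?L"
      by (cases p) (auto simp: space_pair_measure space_list_space)
  qed
  also have "\<dots> \<in> sets (list_space E \<Otimes>\<^sub>M list_space E)"
    by (intro sets.finite_UN pair_measureI listset_in_sets *) auto
  finally show "(\<lambda>p. fst p @ snd p) -` listset As \<inter> space (list_space E \<Otimes>\<^sub>M list_space E)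
    \<in> sets (list_space E \<Otimes>\<^sub>M list_space E)" .
qed (auto simp: space_pair_measure space_list_space)

lemma measurable_append' [measurable (raw)]:
  "f \<in> M \<rightarrow>\<^sub>M list_space E \<Longrightarrow> g \<in> M \<rightarrow>\<^sub>M list_space E \<Longrightarrow> (\<lambda>x. f x @ g x) \<in> M \<rightarrow>\<^sub>M list_space E"
  using measurable_compose[OF measurable_Pair measurable_append, of f M E g] by simp

lemma length_vimage_eq: "length -` {n} \<inter> lists S = listset (replicate n S)"
  by (auto simp: in_listset_iff list_all2_conv_all_nth in_lists_conv_set in_set_conv_nth)
     (metis nth_mem)

lemma measurable_length [measurable]: "length \<in> list_space E \<rightarrow>\<^sub>M count_space UNIV"
  by (subst measurable_count_space_eq2_countable)
     (auto simp: space_list_space length_vimage_eq intro!: listset_in_sets)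

text \<open>Cons is injective, so taking images commutes with differences and countable unions, and
  the sets with measurable image can be treated by induction over the generated \<sigma>-algebra.
  Complements are relative to a full rectangle, whose image is measurable as a countable union over
  the lengths of the remaining list.\<close>

lemma Cons_image_in_sets:
  assumes "B \<in> sets (E \<Otimes>\<^sub>M list_space E)"
  shows "(\<lambda>p. fst p # snd p) ` B \<in> sets (list_space E)"
proof -
  let ?c = "\<lambda>p. fst p # snd p :: 'a list"
  have inj: "inj ?c" by (auto simp: inj_on_def)
  have full: "?c ` (A \<times> lists (space E)) \<in> sets (list_space E)" if A: "A \<in> sets E" for A
  proof -
    have "?c ` (A \<times> lists (space E)) = (\<Union>n. listset (A # replicate n (space E)))"
      by (auto simp: set_Cons_def length_vimage_eq[symmetric] image_iff Bex_def)
    also have "\<dots> \<in> sets (list_space E)"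
      using A by (intro sets.countable_UN) (auto intro!: listset_in_sets simp del: listset.simps)
    finally show ?thesis .
  qed
  have rect: "?c ` (A \<times> C) \<in> sets (list_space E)"
    if A: "A \<in> sets E" and C: "C \<in> sets (list_space E)" for A C
    using C unfolding sets_list_space
  proof (induction C rule: sigma_sets.induct)
    case (Basic C)
    then obtain As where As: "C = listset As" "set As \<subseteq> sets E" by auto
    have "?c ` (A \<times> C) = listset (A # As)"
      by (auto simp: As set_Cons_def image_iff Bex_def)
    moreover have "listset (A # As) \<in> sets (list_space E)"
      using As A by (intro listset_in_sets) auto
    ultimately show ?case by (simp add: sets_list_space)
  next
    case (Compl C)
    have "?c ` (A \<times> (lists (space E) - C)) = ?c ` (A \<times> lists (space E)) - ?c ` (A \<times> C)"
      by (subst image_set_diff[OF inj, symmetric]) auto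
    with Compl full[OF A] show ?case
      unfolding sets_list_space[symmetric] by auto
  next
    case (Union C)
    have "?c ` (A \<times> \<Union> (range C)) = (\<Union>i. ?c ` (A \<times> C i))" by blast
    with Union show ?case unfolding sets_list_space[symmetric] by auto
  qed (simp add: sigma_sets.Empty)
  from assms show ?thesis
    unfolding sets_pair_measure
  proof (induction B rule: sigma_sets.induct)
    case (Compl B)
    have "?c ` (space E \<times> space (list_space E) - B) =
        ?c ` (space E \<times> lists (space E)) - ?c ` B"
      by (subst image_set_diff[OF inj, symmetric]) (auto simp: space_list_space)
    with Compl full[of "space E"] show ?case by auto
  next
    case (Union B)
    have "?c ` (\<Union> (range B)) = (\<Union>i. ?c ` B i)" by blast
    with Union show ?case by auto
  qed (use rect in auto)
qed

text \<open>The preimage splits into a part containing at most the empty list and the Cons-image of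
  a measurable set of pairs, which is measurable by the preceding lemma.\<close>

lemma measurable_list_cases:
  assumes Nil: "f [] \<in> space N"
    and Cons: "(\<lambda>p. f (fst p # snd p)) \<in> E \<Otimes>\<^sub>M list_space E \<rightarrow>\<^sub>M N"
  shows "f \<in> list_space E \<rightarrow>\<^sub>M N"
proof (rule measurableI)
  fix xs assume "xs \<in> space (list_space E)"
  then show "f xs \<in> space N"
    using measurable_space[OF Cons, of "(hd xs, tl xs)"] Nil
    by (cases xs) (auto simp: space_list_space space_pair_measure)
next
  fix A assume A: "A \<in> sets N"
  let ?B = "(\<lambda>p. f (fst p # snd p)) -` A \<inter> space (E \<Otimes>\<^sub>M list_space E)"
  have "xs \<in> (\<lambda>p. fst p # snd p) ` ?B"
    if "xs \<in> lists (space E)" "f xs \<in> A" "xs \<noteq> []" for xs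
    using that by (cases xs) (force simp: space_pair_measure space_list_space image_iff)+
  then have "f -` A \<inter> space (list_space E) =
      (\<lambda>p. fst p # snd p) ` ?B \<union> (if f [] \<in> A then listset [] else {})"
    by (auto simp: space_pair_measure space_list_space)
  also have "\<dots> \<in> sets (list_space E)"
    using measurable_sets[OF Cons A] listset_in_sets[of "[]" E]
    by (intro sets.Un Cons_image_in_sets) auto
  finally show "f -` A \<inter> space (list_space E) \<in> sets (list_space E)" .
qed

text \<open>A single case distinction does not terminate the recursion, so \<open>f\<close> is first
  cut off at length \<open>n\<close>, where induction on \<open>n\<close> works, and then recovered
  by using the countably valued \<open>length\<close> as the cut-off. The target \<open>N\<close> is
  arbitrary so that it may also be a space of probability laws.\<close>

lemma measurable_list_rec:
  assumes Nil: "f [] \<in> space N"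
    and Cons: "\<And>x xs. x \<in> space E \<Longrightarrow> xs \<in> lists (space E) \<Longrightarrow> f (x # xs) = G x (f xs)"
    and G: "(\<lambda>p. G (fst p) (snd p)) \<in> E \<Otimes>\<^sub>M N \<rightarrow>\<^sub>M N"
  shows "f \<in> list_space E \<rightarrow>\<^sub>M N"
proof -
  define t where "t n xs = (if length xs \<le> n then f xs else f [])" for n xs
  have "t n \<in> list_space E \<rightarrow>\<^sub>M N" for n
  proof (induction n)
    case 0
    have "t 0 = (\<lambda>_. f [])" by (auto simp: t_def)
    then show ?case using Nil by simp
  next
    case (Suc n)
    have [measurable]: "Measurable.pred (list_space E) (\<lambda>xs. length xs \<le> n)" by measurable
    have [measurable]: "(\<lambda>p. t n (snd p)) \<in> E \<Otimes>\<^sub>M list_space E \<rightarrow>\<^sub>M N"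
      using Suc by measurable
    have "(\<lambda>p. if length (snd p) \<le> n then G (fst p) (t n (snd p)) else f []) \<in> E \<Otimes>\<^sub>M list_space E \<rightarrow>\<^sub>M N"
    proof (rule measurable_If)
      show "(\<lambda>p. G (fst p) (t n (snd p))) \<in> E \<Otimes>\<^sub>M list_space E \<rightarrow>\<^sub>M N"
        using measurable_compose[OF measurable_Pair G, of fst _ "\<lambda>p. t n (snd p)"] by simp
    qed (use Nil in \<open>auto simp: pred_def[symmetric]\<close>)
    then have "(\<lambda>p. t (Suc n) (fst p # snd p)) \<in> E \<Otimes>\<^sub>M list_space E \<rightarrow>\<^sub>M N"
      by (rule measurable_cong[THEN iffD1, rotated])
         (auto simp: t_def Cons space_pair_measure space_list_space in_lists_conv_set)
    then show ?case
      by (intro measurable_list_cases) (auto simp: t_def Nil)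
  qed
  then have "(\<lambda>xs. t (length xs) xs) \<in> list_space E \<rightarrow>\<^sub>M N"
    by (rule measurable_compose_countable) simp
  then show ?thesis by (simp add: t_def)
qed

lemma measurable_prod_list [measurable]:
  assumes [measurable]: "h \<in> borel_measurable E"
  shows "(\<lambda>xs. prod_list (map h xs) :: complex) \<in> borel_measurable (list_space E)"
  by (rule measurable_list_rec[where G = "\<lambda>x y. h x * y"]) auto

lemma measurable_sum_list [measurable]:
  assumes [measurable]: "w \<in> borel_measurable E"
  shows "(\<lambda>xs. sum_list (map w xs) :: real) \<in> borel_measurable (list_space E)"
  by (rule measurable_list_rec[where G = "\<lambda>x y. w x + y"]) auto

section \<open>Generating functionals of the LF-process\<close>

lemma norm_integral_le_bound:
  fixes f :: "'a \<Rightarrow> complex"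
  assumes "subprob_space M" and [measurable]: "f \<in> borel_measurable M"
    and C: "\<And>x. x \<in> space M \<Longrightarrow> norm (f x) \<le> C" "0 \<le> C"
  shows "norm (\<integral>x. f x \<partial>M) \<le> C"
proof -
  interpret subprob_space M by fact
  have "integrable M f"
    by (rule integrable_const_bound[of _ C]) (use C in auto)
  then have "norm (\<integral>x. f x \<partial>M) \<le> (\<integral>x. C \<partial>M)"
    by (intro order_trans[OF integral_norm_bound] integral_mono) (use C in auto)
  also have "\<dots> \<le> C" using C(2) subprob_measure_le_1[of "space M"] by (simp add: mult_left_le_one_le)
  finally show ?thesis .
qed

text \<open>The identity for real integrands is applied to real and imaginary part. Boundedness on
  subprobability spaces makes all functions involved integrable, so that taking parts commutes with
  the integrals.\<close>

lemma integral_bind_bounded: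
  fixes f :: "'b \<Rightarrow> complex"
  assumes M: "subprob_space M" and N[measurable]: "N \<in> M \<rightarrow>\<^sub>M subprob_algebra B"
    and f[measurable]: "f \<in> borel_measurable B" and C: "\<And>x. x \<in> space B \<Longrightarrow> norm (f x) \<le> C"
  shows "(\<integral>x. f x \<partial>(M \<bind> N)) = (\<integral>x. \<integral>y. f y \<partial>N x \<partial>M)"
proof -
  interpret subprob_space M by fact
  have C0: "0 \<le> max C 0" by simp
  have Nx: "subprob_space (N x)" "sets (N x) = sets B" "space (N x) = space B" if "x \<in> space M" for x
    using subprob_space_kernel[OF N that] sets_kernel[OF N that] by (auto dest: sets_eq_imp_space_eq)
  have ne: "space M \<noteq> {}" by (rule subprob_not_empty)
  interpret MN: subprob_space "M \<bind> N" by (rule subprob_space_bind[OF M N])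
  have MN[simp, measurable_cong]: "sets (M \<bind> N) = sets B" "space (M \<bind> N) = space B"
    using sets_bind_measurable[OF N ne] space_bind_measurable[OF N ne] by auto
  have int_MN: "integrable (M \<bind> N) f"
    by (rule MN.integrable_const_bound[of _ C]) (use C in auto)
  have int_N: "integrable (N x) f" if "x \<in> space M" for x
  proof -
    interpret N: subprob_space "N x" using Nx that by simp
    show ?thesis using C that Nx[OF that]
      by (intro N.integrable_const_bound[of _ C]) (auto cong: measurable_cong_sets)
  qed
  have meas: "(\<lambda>x. \<integral>y. f y \<partial>N x) \<in> borel_measurable M"
    by (rule measurable_compose[OF N integral_measurable_subprob_algebra[OF f]])
  have int_M: "integrable M (\<lambda>x. \<integral>y. f y \<partial>N x)"
  proof (rule integrable_const_bound[of _ "max C 0"])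
    show "AE x in M. norm (\<integral>y. f y \<partial>N x) \<le> max C 0"
      using C Nx by (intro AE_I2 norm_integral_le_bound) (auto cong: measurable_cong_sets intro: le_max_iff_disj[THEN iffD2])
  qed (rule meas)
  have *: "(\<integral>x. g (f x) \<partial>(M \<bind> N)) = (\<integral>x. \<integral>y. g (f y) \<partial>N x \<partial>M)"
    if g[measurable]: "g \<in> borel_measurable borel" and le: "\<And>z. \<bar>g z\<bar> \<le> norm z" for g :: "complex \<Rightarrow> real"
  proof (rule integral_bind[of _ B C _ _ 1])
    show "\<bar>g (f x)\<bar> \<le> C" if "x \<in> space B" for x
      using le[of "f x"] C[OF that] by simp
    show "AE x in M. emeasure (N x) (space (N x)) \<le> ennreal 1"
      using subprob_space.emeasure_space_le_1[OF Nx(1)] by (intro AE_I2) simp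
  qed (auto intro: finite_measure_axioms)
  show ?thesis
  proof (rule complex_eqI)
    have "Re (\<integral>x. f x \<partial>(M \<bind> N)) = (\<integral>x. Re (f x) \<partial>(M \<bind> N))"
      using int_MN by simp
    also have "\<dots> = (\<integral>x. \<integral>y. Re (f y) \<partial>N x \<partial>M)"
      by (rule *) (auto simp: abs_Re_le_cmod)
    also have "\<dots> = (\<integral>x. Re (\<integral>y. f y \<partial>N x) \<partial>M)"
      using int_N by (intro Bochner_Integration.integral_cong) auto
    also have "\<dots> = Re (\<integral>x. \<integral>y. f y \<partial>N x \<partial>M)" using int_M by simp
    finally show "Re (\<integral>x. f x \<partial>(M \<bind> N)) = Re (\<integral>x. \<integral>y. f y \<partial>N x \<partial>M)" .
    have "Im (\<integral>x. f x \<partial>(M \<bind> N)) = (\<integral>x. Im (f x) \<partial>(M \<bind> N))"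
      using int_MN by simp
    also have "\<dots> = (\<integral>x. \<integral>y. Im (f y) \<partial>N x \<partial>M)"
      by (rule *) (auto simp: abs_Im_le_cmod)
    also have "\<dots> = (\<integral>x. Im (\<integral>y. f y \<partial>N x) \<partial>M)"
      using int_N by (intro Bochner_Integration.integral_cong) auto
    also have "\<dots> = Im (\<integral>x. \<integral>y. f y \<partial>N x \<partial>M)" using int_M by simp
    finally show "Im (\<integral>x. f x \<partial>(M \<bind> N)) = Im (\<integral>x. \<integral>y. f y \<partial>N x \<partial>M)" .
  qed
qed

lemma integral_bind_prob_algebra:
  fixes f :: "'b \<Rightarrow> complex"
  assumes M: "M \<in> space (prob_algebra A)" and N: "N \<in> A \<rightarrow>\<^sub>M prob_algebra B"
    and f: "f \<in> borel_measurable B" and C: "\<And>x. x \<in> space B \<Longrightarrow> norm (f x) \<le> C"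
  shows "(\<integral>x. f x \<partial>(M \<bind> N)) = (\<integral>x. \<integral>y. f y \<partial>N x \<partial>M)"
proof (rule integral_bind_bounded[OF _ _ f C])
  show "subprob_space M" using M by (auto simp: space_prob_algebra intro: prob_space_imp_subprob_space)
  show "N \<in> M \<rightarrow>\<^sub>M subprob_algebra B"
    using measurable_prob_algebraD[OF N] M by (simp add: space_prob_algebra cong: measurable_cong_sets)
qed

lemma norm_prod_list_map_le_1:
  fixes h :: "'a \<Rightarrow> complex"
  assumes "\<And>x. x \<in> S \<Longrightarrow> norm (h x) \<le> 1" "xs \<in> lists S"
  shows "norm (prod_list (map h xs)) \<le> 1"
  using assms(2) by (induction xs) (auto simp: norm_mult assms(1) mult_le_one)

definition kop :: "('a \<Rightarrow> 'a measure) \<Rightarrow> ('a \<Rightarrow> complex) \<Rightarrow> 'a \<Rightarrow> complex" where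
  "kop K f x = (\<integral>y. f y \<partial>K x)"

section \<open>The offspring law as a probability kernel\<close>

locale lf =
  fixes E :: "'a measure" and K :: "'a \<Rightarrow> 'a measure" and \<gamma> :: "'a measure" and m :: real
  assumes triplet: "lf_triplet E K \<gamma> m"
begin

lemma K[measurable]: "K \<in> E \<rightarrow>\<^sub>M subprob_algebra E"
  and prob_space_\<gamma>: "prob_space \<gamma>" and sets_\<gamma>[simp, measurable_cong]: "sets \<gamma> = sets E"
  and m_pos: "0 < m"
  using triplet by (auto simp: lf_triplet_def)

sublocale \<gamma>: prob_space \<gamma> by (rule prob_space_\<gamma>)

lemma space_\<gamma>[simp]: "space \<gamma> = space E" by (rule sets_eq_imp_space_eq) simp

lemma space_E_ne: "space E \<noteq> {}" using \<gamma>.not_empty by simp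

lemma \<gamma>_in_prob_algebra: "\<gamma> \<in> space (prob_algebra E)"
  by (simp add: space_prob_algebra prob_space_\<gamma>)

lemma
  assumes "x \<in> space E"
  shows subprob_K: "subprob_space (K x)" and sets_K[simp]: "sets (K x) = sets E"
    and space_K[simp]: "space (K x) = space E"
  using subprob_space_kernel[OF K assms] sets_kernel[OF K assms] by (auto dest: sets_eq_imp_space_eq)

lemma Nil_in_space: "[] \<in> space (list_space E)" by (simp add: space_list_space)

lemma return_Nil: "return (list_space E) [] \<in> space (prob_algebra (list_space E))"
  by (simp add: space_prob_algebra prob_space_return Nil_in_space)

lemma iid_types_in_prob_algebra: "iid_types E \<gamma> n \<in> space (prob_algebra (list_space E))"
proof (induction n)
  case (Suc n)
  note [measurable] = Suc \<gamma>_in_prob_algebra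
  have "(\<lambda>_::unit. iid_types E \<gamma> (Suc n)) \<in> count_space UNIV \<rightarrow>\<^sub>M prob_algebra (list_space E)"
    unfolding iid_types.simps by measurable
  then show ?case by (auto dest: measurable_space)
qed (simp add: return_Nil)

text \<open>Where \<open>K x\<close> has mass 0, \<open>uniform_measure\<close> is the null measure.
  The default \<open>return E x\<close> makes this a probability kernel everywhere; it has no effect
  on the offspring law, because such a particle has children with probability 0.\<close>

definition marked_law :: "'a \<Rightarrow> 'a measure" where
  "marked_law x = (if emeasure (K x) (space E) = 0 then return E x else uniform_measure (K x) (space E))"

lemma measurable_marked_law [measurable]: "marked_law \<in> E \<rightarrow>\<^sub>M prob_algebra E"
proof (rule measurable_prob_algebraI)
  fix x assume x: "x \<in> space E"
  interpret subprob_space "K x" using subprob_K[OF x] .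
  show "prob_space (marked_law x)"
    using x by (auto simp: marked_law_def intro!: prob_space_return prob_space_uniform_measure)
next
  show "marked_law \<in> E \<rightarrow>\<^sub>M subprob_algebra E"
  proof (rule measurable_subprob_algebra)
    fix x assume x: "x \<in> space E"
    interpret subprob_space "K x" using subprob_K[OF x] .
    have "prob_space (marked_law x)"
      using x by (auto simp: marked_law_def intro!: prob_space_return prob_space_uniform_measure)
    then show "subprob_space (marked_law x)" by (rule prob_space_imp_subprob_space)
    show "sets (marked_law x) = sets E" using x by (simp add: marked_law_def)
  next
    fix A assume A[measurable]: "A \<in> sets E"
    have "(\<lambda>x. if emeasure (K x) (space E) = 0 then indicator A x else emeasure (K x) A / emeasure (K x) (space E))
        \<in> borel_measurable E"
      by measurable
    then show "(\<lambda>x. emeasure (marked_law x) A) \<in> borel_measurable E"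
    proof (rule measurable_cong[THEN iffD1, rotated])
      fix x assume x: "x \<in> space E"
      have "space E \<inter> A = A" using sets.sets_into_space[OF A] by auto
      then show "(if emeasure (K x) (space E) = 0 then indicator A x else emeasure (K x) A / emeasure (K x) (space E)) =
          emeasure (marked_law x) A"
        using x by (simp add: marked_law_def)
    qed
  qed
qed

definition brood_law :: "'a \<Rightarrow> 'a list measure" where
  "brood_law x = measure_pmf (geometric_pmf (1 / (1 + m))) \<bind> (\<lambda>j.
     marked_law x \<bind> (\<lambda>y. iid_types E \<gamma> j \<bind> (\<lambda>ys. return (list_space E) (y # ys))))"

lemma measure_pmf_in_prob_algebra [measurable (raw)]:
  "measure_pmf p \<in> space (prob_algebra (count_space UNIV))"
  by (simp add: space_prob_algebra measure_pmf.prob_space_axioms)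

lemma measurable_iid_types [measurable]:
  "iid_types E \<gamma> \<in> count_space UNIV \<rightarrow>\<^sub>M prob_algebra (list_space E)"
  by (simp add: iid_types_in_prob_algebra)

lemma measurable_brood_law [measurable]: "brood_law \<in> E \<rightarrow>\<^sub>M prob_algebra (list_space E)"
  unfolding brood_law_def by measurable

lemma uniform_measure_in_subprob_algebra:
  assumes x: "x \<in> space E"
  shows "uniform_measure (K x) (space E) \<in> space (subprob_algebra E)"
proof (cases "emeasure (K x) (space E) = 0")
  case True
  then show ?thesis
    using x space_E_ne emeasure_uniform_measure[of "space E" "K x" "space E"]
    by (auto simp: space_subprob_algebra subprob_space_def subprob_space_axioms_def
        intro!: finite_measureI)
next
  case False
  then have "uniform_measure (K x) (space E) = marked_law x" by (simp add: marked_law_def)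
  then show ?thesis
    using measurable_space[OF measurable_prob_algebraD[OF measurable_marked_law] x] by simp
qed

text \<open>Only particles with \<open>K x\<close> of mass 0 need an argument. There the two
  versions of the alive branch may differ, but \<open>bernoulli_pmf 0\<close> is concentrated on
  \<open>False\<close>; it is enough that both branches are subprobabilities, so that the bind
  evaluates to the other branch.\<close>

lemma lf_offspring_eq:
  assumes x: "x \<in> space E"
  shows "lf_offspring E K \<gamma> m x = measure_pmf (bernoulli_pmf (measure (K x) (space E))) \<bind>
    (\<lambda>alive. if alive then brood_law x else return (list_space E) [])"
proof (cases "emeasure (K x) (space E) = 0")
  case False
  then show ?thesis
    unfolding lf_offspring_def brood_law_def marked_law_def by simp
next
  case True
  have 0: "measure (K x) (space E) = 0" using True by (simp add: measure_def)
  have *: "bernoulli_pmf 0 = return_pmf False"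
  proof (rule pmf_eqI)
    show "pmf (bernoulli_pmf 0) b = pmf (return_pmf False) b" for b
      by (cases b) simp_all
  qed
  have bind_False: "measure_pmf (return_pmf False) \<bind> (\<lambda>alive. if alive then \<mu> else return (list_space E) []) =
      return (list_space E) []" if "\<mu> \<in> space (subprob_algebra (list_space E))" for \<mu>
  proof -
    have "return (count_space UNIV) False \<bind> (\<lambda>alive. if alive then \<mu> else return (list_space E) []) =
        (if False then \<mu> else return (list_space E) [])"
      by (rule bind_return[where N = "list_space E"])
         (use that measurable_space[OF return_measurable Nil_in_space] in auto)
    then show ?thesis by (simp add: return_pmf.rep_eq)
  qed
  have [measurable]: "iid_types E \<gamma> \<in> count_space UNIV \<rightarrow>\<^sub>M subprob_algebra (list_space E)"
    by (rule measurable_prob_algebraD) measurable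
  note [measurable] = uniform_measure_in_subprob_algebra[OF x]
  have "(\<lambda>_::unit. measure_pmf (geometric_pmf (1 / (1 + m))) \<bind> (\<lambda>j.
       uniform_measure (K x) (space E) \<bind> (\<lambda>y. iid_types E \<gamma> j \<bind> (\<lambda>ys. return (list_space E) (y # ys)))))
     \<in> count_space UNIV \<rightarrow>\<^sub>M subprob_algebra (list_space E)"
    by measurable
  then have 1: "measure_pmf (geometric_pmf (1 / (1 + m))) \<bind> (\<lambda>j.
       uniform_measure (K x) (space E) \<bind> (\<lambda>y. iid_types E \<gamma> j \<bind> (\<lambda>ys. return (list_space E) (y # ys))))
     \<in> space (subprob_algebra (list_space E))"
    by (auto dest: measurable_space)
  have 2: "brood_law x \<in> space (subprob_algebra (list_space E))"
    using measurable_space[OF measurable_prob_algebraD[OF measurable_brood_law] x] .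
  show ?thesis
    unfolding lf_offspring_def 0 * bind_False[OF 1] bind_False[OF 2] ..
qed

lemma measurable_bernoulli_pmf:
  assumes [measurable]: "p \<in> borel_measurable M"
    and p: "\<And>x. x \<in> space M \<Longrightarrow> 0 \<le> p x \<and> p x \<le> (1 :: real)"
  shows "(\<lambda>x. measure_pmf (bernoulli_pmf (p x))) \<in> M \<rightarrow>\<^sub>M prob_algebra (count_space UNIV)"
proof (intro measurable_prob_algebraI measurable_subprob_algebra)
  fix A :: "bool set"
  have "emeasure (measure_pmf (bernoulli_pmf (p x))) A =
      ennreal (indicator A True * p x + indicator A False * (1 - p x))" if "x \<in> space M" for x
  proof -
    have "measure (measure_pmf (bernoulli_pmf (p x))) A = sum (pmf (bernoulli_pmf (p x))) A"
      by (rule measure_measure_pmf_finite) simp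
    also have "\<dots> = (\<Sum>b\<in>UNIV. indicator A b * pmf (bernoulli_pmf (p x)) b)"
      by (simp add: indicator_def sum.If_cases)
    also have "\<dots> = indicator A True * p x + indicator A False * (1 - p x)"
    proof -
      have "sum g UNIV = g True + g False" for g :: "bool \<Rightarrow> real"
        by (simp add: UNIV_bool)
      note split = this
      show ?thesis using p[OF that] by (subst split) simp
    qed
    finally show ?thesis by (simp add: measure_pmf.emeasure_eq_measure)
  qed
  then show "(\<lambda>x. emeasure (measure_pmf (bernoulli_pmf (p x))) A) \<in> borel_measurable M"
    by (subst measurable_cong) auto
qed (auto intro: measure_pmf.prob_space_axioms measure_pmf.subprob_space_axioms)

lemma measurable_lf_offspring [measurable]: "lf_offspring E K \<gamma> m \<in> E \<rightarrow>\<^sub>M prob_algebra (list_space E)"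
proof -
  have [measurable]: "(\<lambda>x. measure_pmf (bernoulli_pmf (measure (K x) (space E)))) \<in> E \<rightarrow>\<^sub>M prob_algebra (count_space UNIV)"
  proof (rule measurable_bernoulli_pmf)
    show "0 \<le> measure (K x) (space E) \<and> measure (K x) (space E) \<le> 1" if "x \<in> space E" for x
      using subprob_space.subprob_measure_le_1[OF subprob_K[OF that]] by simp
  qed measurable
  note [measurable] = return_Nil
  have "(\<lambda>x. measure_pmf (bernoulli_pmf (measure (K x) (space E))) \<bind>
    (\<lambda>alive. if alive then brood_law x else return (list_space E) [])) \<in> E \<rightarrow>\<^sub>M prob_algebra (list_space E)"
    by measurable
  then show ?thesis
    by (rule measurable_cong[THEN iffD1, rotated]) (simp add: lf_offspring_eq)
qed

text \<open>The next generation is a recursion over the list with values in the space of probability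
  laws, so that lemma \<open>measurable_list_rec\<close> applies with that space as its
  target.\<close>

lemma measurable_lf_next [measurable]:
  "lf_next E K \<gamma> m \<in> list_space E \<rightarrow>\<^sub>M prob_algebra (list_space E)"
proof (rule measurable_list_rec[where G = "\<lambda>x \<mu>. lf_offspring E K \<gamma> m x \<bind> (\<lambda>ys. \<mu> \<bind> (\<lambda>zs. return (list_space E) (ys @ zs)))"])
  show "(\<lambda>p. lf_offspring E K \<gamma> m (fst p) \<bind> (\<lambda>ys. snd p \<bind> (\<lambda>zs. return (list_space E) (ys @ zs))))
      \<in> E \<Otimes>\<^sub>M prob_algebra (list_space E) \<rightarrow>\<^sub>M prob_algebra (list_space E)"
    by measurable
qed (simp_all add: return_Nil)

lemma borel_measurable_kop [measurable]: "h \<in> borel_measurable E \<Longrightarrow> kop K h \<in> borel_measurable E"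
  unfolding kop_def[abs_def] by (rule measurable_compose[OF K integral_measurable_subprob_algebra])

lemma norm_kop_le:
  assumes "x \<in> space E" "h \<in> borel_measurable E" "\<And>y. y \<in> space E \<Longrightarrow> norm (h y) \<le> C" "0 \<le> C"
  shows "norm (kop K h x) \<le> C"
  unfolding kop_def using assms
  by (intro norm_integral_le_bound subprob_K) (auto cong: measurable_cong_sets)

lemma integrable_K:
  fixes h :: "'a \<Rightarrow> complex"
  assumes "x \<in> space E" "h \<in> borel_measurable E" "\<And>y. y \<in> space E \<Longrightarrow> norm (h y) \<le> C"
  shows "integrable (K x) h"
proof -
  interpret subprob_space "K x" by (rule subprob_K) fact
  show ?thesis using assms
    by (intro integrable_const_bound[of _ C]) (auto cong: measurable_cong_sets)
qed

lemma integrable_\<gamma>: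
  fixes h :: "'a \<Rightarrow> complex"
  assumes [measurable]: "h \<in> borel_measurable E" and "\<And>y. y \<in> space E \<Longrightarrow> norm (h y) \<le> C"
  shows "integrable \<gamma> h"
  using assms(2) by (intro \<gamma>.integrable_const_bound[of _ C]) auto

lemma norm_integral_\<gamma>_le:
  assumes [measurable]: "h \<in> borel_measurable E" and "\<And>y. y \<in> space E \<Longrightarrow> norm (h y) \<le> C" "0 \<le> C"
  shows "norm (\<integral>y. h y \<partial>\<gamma> :: complex) \<le> C"
  using assms by (intro norm_integral_le_bound \<gamma>.subprob_space_axioms prob_space_imp_subprob_space prob_space_\<gamma>) auto

section \<open>Generating functionals over one generation\<close>

context
  fixes h :: "'a \<Rightarrow> complex"
  assumes h[measurable]: "h \<in> borel_measurable E" and h_le: "\<And>y. y \<in> space E \<Longrightarrow> norm (h y) \<le> 1"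
begin

abbreviation "hprod xs \<equiv> prod_list (map h xs)"

lemma norm_hprod_le: "xs \<in> space (list_space E) \<Longrightarrow> norm (hprod xs) \<le> 1"
  using norm_prod_list_map_le_1[of "space E" h xs] h_le by (simp add: space_list_space)

lemma integral_iid_types: "(\<integral>xs. hprod xs \<partial>iid_types E \<gamma> n) = (\<integral>y. h y \<partial>\<gamma>) ^ n"
proof (induction n)
  case 0
  show ?case by (simp add: integral_return[OF Nil_in_space])
next
  case (Suc n)
  note [measurable] = iid_types_in_prob_algebra[of n]
  have sp: "space (iid_types E \<gamma> n) = lists (space E)"
    using iid_types_in_prob_algebra[of n] sets_eq_imp_space_eq[of "iid_types E \<gamma> n" "list_space E"]
    by (simp add: space_prob_algebra space_list_space)
  have "(\<integral>xs. hprod xs \<partial>iid_types E \<gamma> (Suc n)) =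
      (\<integral>y. \<integral>xs. hprod xs \<partial>(iid_types E \<gamma> n \<bind> (\<lambda>ys. return (list_space E) (y # ys))) \<partial>\<gamma>)"
    unfolding iid_types.simps
    by (rule integral_bind_prob_algebra[OF \<gamma>_in_prob_algebra _ _ norm_hprod_le]) measurable
  also have "\<dots> = (\<integral>y. h y * (\<integral>y. h y \<partial>\<gamma>) ^ n \<partial>\<gamma>)"
  proof (rule Bochner_Integration.integral_cong)
    fix y assume "y \<in> space \<gamma>"
    then have y[measurable]: "y \<in> space E" by simp
    have "(\<integral>xs. hprod xs \<partial>(iid_types E \<gamma> n \<bind> (\<lambda>ys. return (list_space E) (y # ys)))) =
        (\<integral>ys. \<integral>xs. hprod xs \<partial>return (list_space E) (y # ys) \<partial>iid_types E \<gamma> n)"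
      by (rule integral_bind_prob_algebra[OF iid_types_in_prob_algebra _ _ norm_hprod_le]) measurable
    also have "\<dots> = (\<integral>ys. h y * hprod ys \<partial>iid_types E \<gamma> n)"
      using y sp by (intro Bochner_Integration.integral_cong refl, subst integral_return)
         (auto simp: space_list_space)
    finally show "(\<integral>xs. hprod xs \<partial>(iid_types E \<gamma> n \<bind> (\<lambda>ys. return (list_space E) (y # ys)))) =
        h y * (\<integral>y. h y \<partial>\<gamma>) ^ n" using Suc by simp
  qed simp
  finally show ?case by simp
qed

text \<open>The mass of \<open>K x\<close> cancels the normalisation of the marked law; if it is 0,
  both sides vanish whatever the default law is.\<close>

lemma integral_marked_law:
  assumes x: "x \<in> space E"
  shows "measure (K x) (space E) * (\<integral>y. h y \<partial>marked_law x) = kop K h x"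
proof (cases "emeasure (K x) (space E) = 0")
  case True
  have "K x = null_measure (K x)"
  proof (rule measure_eqI)
    fix A assume "A \<in> sets (K x)"
    then have "emeasure (K x) A \<le> emeasure (K x) (space E)"
      using x by (intro emeasure_mono) (auto dest: sets.sets_into_space)
    with True show "emeasure (K x) A = emeasure (null_measure (K x)) A" by simp
  qed simp
  then have "kop K h x = (\<integral>y. h y \<partial>null_measure (K x))" by (simp add: kop_def)
  with True show ?thesis by (simp add: measure_def integral_null_measure)
next
  case False
  interpret subprob_space "K x" by (rule subprob_K[OF x])
  let ?c = "measure (K x) (space E)"
  have c: "0 < ?c" using False by (simp add: emeasure_eq_measure zero_less_measure_iff)
  have "marked_law x = density (K x) (\<lambda>y. ennreal (1 / ?c))"
    using False x divide_ennreal[of 1 ?c] c unfolding marked_law_def uniform_measure_def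
    by (auto intro!: density_cong simp: emeasure_eq_measure)
  then have "(\<integral>y. h y \<partial>marked_law x) = (\<integral>y. (1 / ?c) *\<^sub>R h y \<partial>K x)"
    using x c by (subst integral_density[symmetric]) (auto cong: measurable_cong_sets)
  also have "\<dots> = (1 / ?c) *\<^sub>R kop K h x" by (simp add: kop_def)
  finally show ?thesis using c by (simp add: scaleR_conv_of_real)
qed

text \<open>The marked child contributes \<open>a\<close> and each of the others \<open>b\<close>,
  so the geometric number of other children produces a geometric series of ratio r b with r = m / (1
  + m). It converges since r < 1 and b has norm at most 1. This sum is the source of the
  linear-fractional form.\<close>

lemma integral_brood_law:
  assumes x: "x \<in> space E"
  shows "(\<integral>xs. hprod xs \<partial>brood_law x) = (\<integral>y. h y \<partial>marked_law x) / (1 + m - m * (\<integral>y. h y \<partial>\<gamma>))"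
proof -
  define a b where "a = (\<integral>y. h y \<partial>marked_law x)" and "b = (\<integral>y. h y \<partial>\<gamma>)"
  have b_le: "norm b \<le> 1" unfolding b_def by (rule norm_integral_\<gamma>_le) (auto simp: h_le)
  have M: "marked_law x \<in> space (prob_algebra E)" by (rule measurable_space[OF measurable_marked_law x])
  note [measurable] = M x
  have spM: "space (marked_law x) = space E"
    using M by (auto simp: space_prob_algebra dest: sets_eq_imp_space_eq)
  have *: "(\<integral>xs. hprod xs \<partial>(marked_law x \<bind> (\<lambda>y. iid_types E \<gamma> j \<bind> (\<lambda>ys. return (list_space E) (y # ys))))) = a * b ^ j" for j
  proof -
    note [measurable] = iid_types_in_prob_algebra[of j]
    have sp: "space (iid_types E \<gamma> j) = lists (space E)"
      using iid_types_in_prob_algebra[of j] sets_eq_imp_space_eq[of "iid_types E \<gamma> j" "list_space E"]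
      by (simp add: space_prob_algebra space_list_space)
    have "(\<integral>xs. hprod xs \<partial>(marked_law x \<bind> (\<lambda>y. iid_types E \<gamma> j \<bind> (\<lambda>ys. return (list_space E) (y # ys))))) =
      (\<integral>y. \<integral>xs. hprod xs \<partial>(iid_types E \<gamma> j \<bind> (\<lambda>ys. return (list_space E) (y # ys))) \<partial>marked_law x)"
      by (rule integral_bind_prob_algebra[OF M _ _ norm_hprod_le]) measurable
    also have "\<dots> = (\<integral>y. h y * b ^ j \<partial>marked_law x)"
    proof (rule Bochner_Integration.integral_cong)
      fix y assume "y \<in> space (marked_law x)"
      then have y[measurable]: "y \<in> space E" by (simp add: spM)
      have "(\<integral>xs. hprod xs \<partial>(iid_types E \<gamma> j \<bind> (\<lambda>ys. return (list_space E) (y # ys)))) =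
          (\<integral>ys. \<integral>xs. hprod xs \<partial>return (list_space E) (y # ys) \<partial>iid_types E \<gamma> j)"
        by (rule integral_bind_prob_algebra[OF iid_types_in_prob_algebra _ _ norm_hprod_le]) measurable
      also have "\<dots> = (\<integral>ys. h y * hprod ys \<partial>iid_types E \<gamma> j)"
        using y sp by (intro Bochner_Integration.integral_cong refl, subst integral_return)
           (auto simp: space_list_space)
      finally show "(\<integral>xs. hprod xs \<partial>(iid_types E \<gamma> j \<bind> (\<lambda>ys. return (list_space E) (y # ys)))) = h y * b ^ j"
        by (simp add: integral_iid_types b_def)
    qed simp
    finally show ?thesis by (simp add: a_def)
  qed
  define r where "r = m / (1 + m)"
  have r: "0 < r" "r < 1" "1 - 1 / (1 + m) = r" using m_pos by (auto simp: r_def field_simps)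
  have rb: "norm (of_real r * b) < 1"
    using r b_le by (simp add: norm_mult) (metis mult_left_le mult.commute less_le_trans norm_ge_zero not_le order.strict_trans1 less_eq_real_def)
  have "(\<integral>xs. hprod xs \<partial>brood_law x) = (\<integral>j. a * b ^ j \<partial>measure_pmf (geometric_pmf (1 / (1 + m))))"
    unfolding brood_law_def *[symmetric]
    by (rule integral_bind_prob_algebra[OF measure_pmf_in_prob_algebra _ _ norm_hprod_le]) measurable
  also have "\<dots> = (\<integral>j. pmf (geometric_pmf (1 / (1 + m))) j *\<^sub>R (a * b ^ j) \<partial>count_space UNIV)"
    unfolding measure_pmf_eq_density by (subst integral_density) auto
  also have "\<dots> = (\<integral>j. (a / (1 + m)) * (of_real r * b) ^ j \<partial>count_space UNIV)"
    using m_pos by (intro Bochner_Integration.integral_cong refl)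
      (simp add: r power_mult_distrib scaleR_conv_of_real)
  also have "\<dots> = (\<Sum>j. (a / (1 + m)) * (of_real r * b) ^ j)"
    using rb by (intro integral_count_space_nat)
      (auto simp: integrable_count_space_nat_iff norm_mult norm_power norm_divide intro!: summable_mult summable_geometric)
  also have "\<dots> = (a / (1 + m)) * (1 / (1 - of_real r * b))"
    by (rule sums_unique[OF sums_mult[OF geometric_sums[OF rb]], symmetric])
  also have "\<dots> = a / ((1 + m) * (1 - of_real r * b))" by simp
  also have "(1 + m) * (1 - of_real r * b) = 1 + m - m * b"
  proof -
    have "(1 + m) * r = m" using m_pos by (simp add: r_def)
    then have "(1 + complex_of_real m) * of_real r = of_real m"
      by (metis of_real_1 of_real_add of_real_mult)
    moreover have "(1 + complex_of_real m) * (1 - of_real r * b) = 1 + m - ((1 + m) * of_real r) * b"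
      by (simp add: right_diff_distrib mult.assoc)
    ultimately show ?thesis by simp
  qed
  finally show ?thesis by (simp add: a_def b_def)
qed

lemma integral_lf_offspring:
  assumes x: "x \<in> space E"
  shows "(\<integral>xs. hprod xs \<partial>lf_offspring E K \<gamma> m x) =
    1 - measure (K x) (space E) + kop K h x / (1 + m - m * (\<integral>y. h y \<partial>\<gamma>))"
proof -
  let ?p = "measure (K x) (space E)"
  interpret subprob_space "K x" by (rule subprob_K[OF x])
  have B: "brood_law x \<in> space (prob_algebra (list_space E))"
    by (rule measurable_space[OF measurable_brood_law x])
  have "(\<integral>xs. hprod xs \<partial>lf_offspring E K \<gamma> m x) =
      (\<integral>b. \<integral>xs. hprod xs \<partial>(if b then brood_law x else return (list_space E) []) \<partial>measure_pmf (bernoulli_pmf ?p))"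
    unfolding lf_offspring_eq[OF x] using B return_Nil
    by (intro integral_bind_prob_algebra[OF measure_pmf_in_prob_algebra _ _ norm_hprod_le]) auto
  also have "\<dots> = (\<Sum>b\<in>UNIV. pmf (bernoulli_pmf ?p) b *\<^sub>R (\<integral>xs. hprod xs \<partial>(if b then brood_law x else return (list_space E) [])))"
    by (rule integral_measure_pmf) auto
  also have "\<dots> = ?p * (\<integral>xs. hprod xs \<partial>brood_law x) + (1 - ?p)"
    using subprob_measure_le_1 by (simp add: UNIV_bool integral_return[OF Nil_in_space] scaleR_conv_of_real)
  also have "?p * (\<integral>xs. hprod xs \<partial>brood_law x) = kop K h x / (1 + m - m * (\<integral>y. h y \<partial>\<gamma>))"
    by (simp add: integral_brood_law[OF x] integral_marked_law[OF x, symmetric])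
  finally show ?thesis by simp
qed

lemma integral_lf_next:
  assumes "xs \<in> lists (space E)"
  shows "(\<integral>zs. hprod zs \<partial>lf_next E K \<gamma> m xs) =
    prod_list (map (\<lambda>x. \<integral>ys. hprod ys \<partial>lf_offspring E K \<gamma> m x) xs)"
  using assms
proof (induction xs)
  case Nil
  show ?case by (simp add: integral_return[OF Nil_in_space])
next
  case (Cons x xs)
  have O: "lf_offspring E K \<gamma> m x \<in> space (prob_algebra (list_space E))"
    and N: "lf_next E K \<gamma> m xs \<in> space (prob_algebra (list_space E))"
    using Cons.hyps by (auto intro!: measurable_space[OF measurable_lf_offspring] measurable_space[OF measurable_lf_next]
        simp: space_list_space)
  note [measurable] = O N
  have spO: "space (lf_offspring E K \<gamma> m x) = lists (space E)" and spN: "space (lf_next E K \<gamma> m xs) = lists (space E)"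
    using O N by (auto simp: space_prob_algebra space_list_space dest!: sets_eq_imp_space_eq)
  have "(\<integral>zs. hprod zs \<partial>lf_next E K \<gamma> m (x # xs)) =
     (\<integral>ys. \<integral>zs. hprod zs \<partial>(lf_next E K \<gamma> m xs \<bind> (\<lambda>zs. return (list_space E) (ys @ zs))) \<partial>lf_offspring E K \<gamma> m x)"
    unfolding lf_next.simps
    by (rule integral_bind_prob_algebra[OF O _ _ norm_hprod_le]) measurable
  also have "\<dots> = (\<integral>ys. hprod ys * (\<integral>zs. hprod zs \<partial>lf_next E K \<gamma> m xs) \<partial>lf_offspring E K \<gamma> m x)"
  proof (rule Bochner_Integration.integral_cong)
    fix ys assume "ys \<in> space (lf_offspring E K \<gamma> m x)"
    then have ys[measurable]: "ys \<in> space (list_space E)" by (simp add: spO space_list_space)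
    have "(\<integral>zs. hprod zs \<partial>(lf_next E K \<gamma> m xs \<bind> (\<lambda>zs. return (list_space E) (ys @ zs)))) =
        (\<integral>zs. \<integral>us. hprod us \<partial>return (list_space E) (ys @ zs) \<partial>lf_next E K \<gamma> m xs)"
      by (rule integral_bind_prob_algebra[OF N _ _ norm_hprod_le]) measurable
    also have "\<dots> = (\<integral>zs. hprod ys * hprod zs \<partial>lf_next E K \<gamma> m xs)"
      using ys spN by (intro Bochner_Integration.integral_cong refl, subst integral_return)
         (auto simp: space_list_space)
    finally show "(\<integral>zs. hprod zs \<partial>(lf_next E K \<gamma> m xs \<bind> (\<lambda>zs. return (list_space E) (ys @ zs)))) =
        hprod ys * (\<integral>zs. hprod zs \<partial>lf_next E K \<gamma> m xs)" by simp
  qed simp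
  finally show ?case using Cons by simp
qed

end

definition offspring_gf :: "('a \<Rightarrow> complex) \<Rightarrow> 'a \<Rightarrow> complex" where
  "offspring_gf h y = (\<integral>zs. prod_list (map h zs) \<partial>lf_offspring E K \<gamma> m y)"

lemma
  assumes h[measurable]: "h \<in> borel_measurable E" and h_le: "\<And>y. y \<in> space E \<Longrightarrow> norm (h y) \<le> 1"
  shows measurable_offspring_gf: "offspring_gf h \<in> borel_measurable E"
    and norm_offspring_gf_le: "y \<in> space E \<Longrightarrow> norm (offspring_gf h y) \<le> 1"
proof -
  show "offspring_gf h \<in> borel_measurable E"
    unfolding offspring_gf_def[abs_def]
    by (rule measurable_compose[OF measurable_prob_algebraD[OF measurable_lf_offspring] integral_measurable_subprob_algebra])
       measurable
  assume y: "y \<in> space E"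
  have O: "lf_offspring E K \<gamma> m y \<in> space (prob_algebra (list_space E))"
    by (rule measurable_space[OF measurable_lf_offspring y])
  then have sO: "sets (lf_offspring E K \<gamma> m y) = sets (list_space E)" by (simp add: space_prob_algebra)
  show "norm (offspring_gf h y) \<le> 1"
    unfolding offspring_gf_def
  proof (rule norm_integral_le_bound)
    show "subprob_space (lf_offspring E K \<gamma> m y)"
      using O by (simp add: space_prob_algebra prob_space_imp_subprob_space)
    show "(\<lambda>zs. prod_list (map h zs)) \<in> borel_measurable (lf_offspring E K \<gamma> m y)"
      unfolding measurable_cong_sets[OF sO refl] by measurable
    show "norm (prod_list (map h zs)) \<le> 1" if "zs \<in> space (lf_offspring E K \<gamma> m y)" for zs
      using that sets_eq_imp_space_eq[OF sO] norm_hprod_le[OF h h_le, of zs] by simp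
  qed simp
qed

lemma offspring_gf_pow:
  assumes h: "h \<in> borel_measurable E" "\<And>y. y \<in> space E \<Longrightarrow> norm (h y) \<le> 1"
  shows "(offspring_gf ^^ n) h \<in> borel_measurable E \<and> (\<forall>y\<in>space E. norm ((offspring_gf ^^ n) h y) \<le> 1)"
  by (induction n) (use h in \<open>auto intro!: measurable_offspring_gf norm_offspring_gf_le\<close>)

text \<open>Conditioning on generation \<open>n\<close> replaces the test function of the last
  generation by its offspring functional. The function changes at each step, hence the induction
  over arbitrary \<open>h\<close>.\<close>

lemma expectation_generation:
  assumes proc: "lf_process E K \<gamma> m x P Z" and x: "x \<in> space E"
    and h: "h \<in> borel_measurable E" and h_le: "\<And>y. y \<in> space E \<Longrightarrow> norm (h y) \<le> 1"
  shows "(\<integral>\<omega>. prod_list (map h (Z n \<omega>)) \<partial>P) = (offspring_gf ^^ n) h x"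
proof -
  have P: "prob_space P" and Z[measurable]: "\<And>n. Z n \<in> P \<rightarrow>\<^sub>M list_space E"
    and Z0: "distr P (list_space E) (Z 0) = return (list_space E) [x]"
    and step: "\<And>n A B. A \<in> sets (list_space E) \<Longrightarrow> B \<in> sets (PiM {..n} (\<lambda>_. list_space E)) \<Longrightarrow>
        emeasure P {\<omega> \<in> space P. (\<lambda>i\<in>{..n}. Z i \<omega>) \<in> B \<and> Z (Suc n) \<omega> \<in> A} =
        (\<integral>\<^sup>+\<omega>. indicator B (\<lambda>i\<in>{..n}. Z i \<omega>) * emeasure (lf_next E K \<gamma> m (Z n \<omega>)) A \<partial>P)"
    using proc unfolding lf_process_def by blast+
  interpret prob_space P by (rule P)
  show ?thesis
    using h h_le
  proof (induction n arbitrary: h)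
    case 0
    note [measurable] = 0(1)
    have "(\<integral>\<omega>. prod_list (map h (Z 0 \<omega>)) \<partial>P) = (\<integral>zs. prod_list (map h zs) \<partial>distr P (list_space E) (Z 0))"
      by (subst integral_distr) measurable
    also have "\<dots> = h x"
      unfolding Z0 using x by (subst integral_return) (auto simp: space_list_space)
    finally show ?case by simp
  next
    case (Suc n)
    note [measurable] = Suc.prems(1)
    have D: "distr P (list_space E) (Z n) \<in> space (prob_algebra (list_space E))"
      by (simp add: space_prob_algebra prob_space_distr)
    have distr_Suc: "distr P (list_space E) (Z (Suc n)) = distr P (list_space E) (Z n) \<bind> lf_next E K \<gamma> m"
    proof (rule measure_eqI)
      show "sets (distr P (list_space E) (Z (Suc n))) = sets (distr P (list_space E) (Z n) \<bind> lf_next E K \<gamma> m)"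
        using sets_bind'[OF D measurable_lf_next] by simp
      fix A assume "A \<in> sets (distr P (list_space E) (Z (Suc n)))"
      then have A[measurable]: "A \<in> sets (list_space E)" by simp
      have mem: "(\<lambda>i\<in>{..n}. Z i \<omega>) \<in> space (PiM {..n} (\<lambda>_. list_space E))" if "\<omega> \<in> space P" for \<omega>
        using measurable_space[OF Z that] by (auto simp: space_PiM)
      \<comment> \<open>Taking the whole space of histories as \<open>B\<close> in the transition
        clause leaves the marginal law of generation \<open>n\<close> followed by the kernel
        \<open>lf_next\<close>.\<close>
      have "emeasure (distr P (list_space E) (Z (Suc n))) A =
          emeasure P {\<omega> \<in> space P. (\<lambda>i\<in>{..n}. Z i \<omega>) \<in> space (PiM {..n} (\<lambda>_. list_space E)) \<and> Z (Suc n) \<omega> \<in> A}"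
        using mem by (subst emeasure_distr) (auto intro!: arg_cong[where f = "emeasure P"])
      also have "\<dots> = (\<integral>\<^sup>+\<omega>. indicator (space (PiM {..n} (\<lambda>_. list_space E))) (\<lambda>i\<in>{..n}. Z i \<omega>) *
          emeasure (lf_next E K \<gamma> m (Z n \<omega>)) A \<partial>P)"
        by (rule step) auto
      also have "\<dots> = (\<integral>\<^sup>+\<omega>. emeasure (lf_next E K \<gamma> m (Z n \<omega>)) A \<partial>P)"
        using mem by (intro nn_integral_cong) simp
      also have "\<dots> = (\<integral>\<^sup>+zs. emeasure (lf_next E K \<gamma> m zs) A \<partial>distr P (list_space E) (Z n))"
      proof (rule nn_integral_distr[symmetric])
        have [measurable]: "lf_next E K \<gamma> m \<in> list_space E \<rightarrow>\<^sub>M subprob_algebra (list_space E)"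
          by (rule measurable_prob_algebraD[OF measurable_lf_next])
        show "(\<lambda>zs. emeasure (lf_next E K \<gamma> m zs) A) \<in> borel_measurable (distr P (list_space E) (Z n))"
          by measurable
      qed (rule Z)
      also have "\<dots> = emeasure (distr P (list_space E) (Z n) \<bind> lf_next E K \<gamma> m) A"
        by (rule emeasure_bind_prob_algebra[OF D measurable_lf_next A, symmetric])
      finally show "emeasure (distr P (list_space E) (Z (Suc n))) A =
        emeasure (distr P (list_space E) (Z n) \<bind> lf_next E K \<gamma> m) A" .
    qed
    have gf[measurable]: "offspring_gf h \<in> borel_measurable E"
      by (rule measurable_offspring_gf[OF Suc.prems])
    have "(\<integral>\<omega>. prod_list (map h (Z (Suc n) \<omega>)) \<partial>P) = (\<integral>zs. prod_list (map h zs) \<partial>distr P (list_space E) (Z (Suc n)))"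
      by (subst integral_distr) measurable
    also have "\<dots> = (\<integral>xs. \<integral>zs. prod_list (map h zs) \<partial>lf_next E K \<gamma> m xs \<partial>distr P (list_space E) (Z n))"
      unfolding distr_Suc
      by (rule integral_bind_prob_algebra[OF D measurable_lf_next _ norm_hprod_le[OF Suc.prems]]) measurable
    also have "\<dots> = (\<integral>xs. prod_list (map (offspring_gf h) xs) \<partial>distr P (list_space E) (Z n))"
      unfolding offspring_gf_def[abs_def]
      by (intro Bochner_Integration.integral_cong refl integral_lf_next[OF Suc.prems])
         (auto simp: space_list_space)
    also have "\<dots> = (\<integral>\<omega>. prod_list (map (offspring_gf h) (Z n \<omega>)) \<partial>P)"
      by (subst integral_distr) measurable
    also have "\<dots> = (offspring_gf ^^ n) (offspring_gf h) x"
      by (rule Suc.IH[OF gf norm_offspring_gf_le[OF Suc.prems]])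
    finally show ?case by (simp add: funpow_swap1)
  qed
qed

section \<open>Total masses of the kernel powers\<close>

lemma measurable_kernel_pow [measurable]: "A \<in> sets E \<Longrightarrow> (\<lambda>y. kernel_pow K n y A) \<in> borel_measurable E"
proof (induction n)
  case (Suc n)
  then have [measurable]: "(\<lambda>y. kernel_pow K n y A) \<in> borel_measurable E" by simp
  show ?case unfolding kernel_pow.simps
    by (rule measurable_compose[OF K nn_integral_measurable_subprob_algebra]) measurable
qed simp

lemma kernel_pow_space_Suc_le: "y \<in> space E \<Longrightarrow> kernel_pow K (Suc n) y (space E) \<le> kernel_pow K n y (space E)"
proof (induction n arbitrary: y)
  case 0
  interpret subprob_space "K y" by (rule subprob_K[OF 0])
  have "(\<integral>\<^sup>+z. indicator (space E) z \<partial>K y) = emeasure (K y) (space E)"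
    using 0 by (subst nn_integral_indicator) auto
  then show ?case using 0 subprob_emeasure_le_1 by simp
next
  case (Suc n)
  have "(\<integral>\<^sup>+z. kernel_pow K (Suc n) z (space E) \<partial>K y) \<le> (\<integral>\<^sup>+z. kernel_pow K n z (space E) \<partial>K y)"
    using Suc.prems by (intro nn_integral_mono Suc.IH) simp
  then show ?case by simp
qed

definition kmass :: "nat \<Rightarrow> 'a \<Rightarrow> real" where
  "kmass n y = enn2real (kernel_pow K n y (space E))"

lemma kernel_pow_space_le_1: "y \<in> space E \<Longrightarrow> kernel_pow K n y (space E) \<le> 1"
proof (induction n)
  case (Suc n)
  then show ?case using kernel_pow_space_Suc_le[of y n] by (auto intro: order_trans)
qed simp

lemma kernel_pow_eq_kmass: "y \<in> space E \<Longrightarrow> kernel_pow K n y (space E) = ennreal (kmass n y)"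
  using kernel_pow_space_le_1[of y n] unfolding kmass_def
  by (intro ennreal_enn2real[symmetric]) (auto intro: le_less_trans simp: less_top[symmetric] top_unique)

lemma kmass_nonneg: "0 \<le> kmass n y" by (simp add: kmass_def)

lemma kmass_Suc_le: "y \<in> space E \<Longrightarrow> kmass (Suc n) y \<le> kmass n y"
  using kernel_pow_space_Suc_le[of y n] by (simp add: kernel_pow_eq_kmass kmass_nonneg del: kernel_pow.simps)

lemma kmass_0: "y \<in> space E \<Longrightarrow> kmass 0 y = 1"
  by (simp add: kmass_def)

lemma kmass_le_1: "y \<in> space E \<Longrightarrow> kmass n y \<le> 1"
  using kernel_pow_space_le_1[of y n] by (simp add: kernel_pow_eq_kmass kmass_nonneg del: kernel_pow.simps)

lemma measurable_kmass [measurable]: "kmass n \<in> borel_measurable E"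
  unfolding kmass_def[abs_def] by measurable

lemma kmass_Suc:
  assumes y: "y \<in> space E"
  shows "kmass (Suc n) y = (\<integral>z. kmass n z \<partial>K y)"
proof -
  have "kernel_pow K (Suc n) y (space E) = (\<integral>\<^sup>+z. ennreal (kmass n z) \<partial>K y)"
    using y by (auto simp: kernel_pow_eq_kmass intro!: nn_integral_cong)
  then show ?thesis
    using y unfolding kmass_def[of "Suc n"]
    by (subst integral_eq_nn_integral) (auto simp: kmass_nonneg cong: measurable_cong_sets)
qed

lemma kmass_1: "y \<in> space E \<Longrightarrow> kmass 1 y = measure (K y) (space E)"
proof -
  assume y: "y \<in> space E"
  have "kmass 1 y = (\<integral>z. kmass 0 z \<partial>K y)" using kmass_Suc[OF y, of 0] by simp
  also have "\<dots> = (\<integral>z. 1 \<partial>K y)" using y by (intro Bochner_Integration.integral_cong) (auto simp: kmass_0)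
  finally show ?thesis using y by simp
qed

lemma kop_kmass: "y \<in> space E \<Longrightarrow> kop K (\<lambda>z. of_real (kmass n z)) y = of_real (kmass (Suc n) y)"
  by (simp add: kop_def kmass_Suc)

text \<open>The constant \<open>C\<close> dominates \<open>g\<close>, and applying the positive
  operator \<open>n\<close> times multiplies it by the mass of the \<open>n\<close>-th power.
  Measurability is part of the same induction because the integral estimate uses it. The factor
  \<open>kmass n y\<close> is what later makes the first term of \<open>lf_a\<close> negligible at
  the starting type.\<close>

lemma norm_kop_pow_le:
  assumes g[measurable]: "g \<in> borel_measurable E" and C: "\<And>y. y \<in> space E \<Longrightarrow> norm (g y) \<le> C"
  shows "(kop K ^^ n) g \<in> borel_measurable E \<and> (\<forall>y\<in>space E. norm ((kop K ^^ n) g y) \<le> C * kmass n y)"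
proof (induction n)
  case 0
  then show ?case using g C by (auto simp: kmass_0)
next
  case (Suc n)
  obtain y0 where "y0 \<in> space E" using space_E_ne by auto
  then have C0: "0 \<le> C" using C[of y0] norm_ge_zero order_trans by blast
  from Suc have [measurable]: "(kop K ^^ n) g \<in> borel_measurable E" by simp
  have "norm ((kop K ^^ Suc n) g y) \<le> C * kmass (Suc n) y" if y: "y \<in> space E" for y
  proof -
    have "integrable (K y) ((kop K ^^ n) g)"
      using Suc y kmass_le_1 C0
      by (intro integrable_K[of y _ C]) (auto intro: order_trans[OF _ mult_left_le])
    moreover have "integrable (K y) (\<lambda>z. of_real (kmass n z) :: complex)"
      using y by (intro integrable_K[of y _ 1]) (auto simp: kmass_nonneg kmass_le_1)
    then have "integrable (K y) (kmass n)" by (simp add: complex_of_real_integrable_eq)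
    ultimately have "norm (\<integral>z. (kop K ^^ n) g z \<partial>K y) \<le> (\<integral>z. C * kmass n z \<partial>K y)"
      using Suc y by (intro order_trans[OF integral_norm_bound] integral_mono) auto
    then show ?thesis using y by (simp add: kop_def kmass_Suc)
  qed
  then show ?case by simp
qed

section \<open>Explicit solution of the iteration\<close>

definition lf_e :: "('a \<Rightarrow> complex) \<Rightarrow> nat \<Rightarrow> complex" where
  "lf_e g n = (\<integral>y. (kop K ^^ n) g y \<partial>\<gamma>)"

definition weight :: "nat \<Rightarrow> real" where
  "weight n = m * (\<integral>y. kmass (Suc n) y \<partial>\<gamma>)"

text \<open>The renewal sequence is the resolvent of the weights, so this convolution is the
  solution of the renewal equation with forcing \<open>lf_e g\<close>. The closed form exposes the
  one sequence whose limit is known.\<close>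

definition lf_c :: "('a \<Rightarrow> complex) \<Rightarrow> nat \<Rightarrow> complex" where
  "lf_c g n = (\<Sum>i\<le>n. lf_e g i * of_real (renewal weight (n - i)))"

definition lf_a :: "('a \<Rightarrow> complex) \<Rightarrow> nat \<Rightarrow> 'a \<Rightarrow> complex" where
  "lf_a g n y = (kop K ^^ n) g y + m * (\<Sum>j<n. lf_c g j * of_real (kmass (n - j) y))"

definition lf_b :: "('a \<Rightarrow> complex) \<Rightarrow> nat \<Rightarrow> complex" where
  "lf_b g n = 1 + m * (\<Sum>j<n. lf_c g j)"

lemma lf_c_eq: "lf_c g n = lf_e g n + (\<Sum>j<n. lf_c g j * of_real (weight (n - 1 - j)))"
proof -
  let ?U = "renewal weight"
  \<comment> \<open>For fixed \<open>i\<close> the sum over \<open>j\<close> is the defining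
    recursion of \<open>renewal\<close> at \<open>n - i\<close>, read backwards. The offset 1 arises
    because \<open>weight k\<close> is the weight of \<open>k + 1\<close>.\<close>
  have inner: "(\<Sum>j\<in>{i..<n}. ?U (j - i) * weight (n - 1 - j)) = ?U (n - i)" if "i < n" for i
  proof -
    define l where "l = n - Suc i"
    with that have l: "n = i + Suc l" by simp
    have "(\<Sum>j\<in>{i..<n}. ?U (j - i) * weight (n - 1 - j)) = (\<Sum>k\<le>l. weight k * ?U (l - k))"
      by (rule sum.reindex_bij_witness[of _ "\<lambda>k. n - 1 - k" "\<lambda>j. n - 1 - j"]) (auto simp: l mult.commute)
    then show ?thesis by (simp add: l)
  qed
  have "(\<Sum>j<n. lf_c g j * of_real (weight (n - 1 - j))) =
      (\<Sum>j<n. \<Sum>i<n. if i \<le> j then lf_e g i * of_real (?U (j - i) * weight (n - 1 - j)) else 0)"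
    unfolding lf_c_def sum_distrib_right
    by (rule sum.cong[OF refl], rule sum.mono_neutral_cong_left) (auto simp: mult.assoc)
  also have "\<dots> = (\<Sum>i<n. \<Sum>j<n. if i \<le> j then lf_e g i * of_real (?U (j - i) * weight (n - 1 - j)) else 0)"
    by (rule sum.swap)
  also have "\<dots> = (\<Sum>i<n. \<Sum>j\<in>{i..<n}. lf_e g i * of_real (?U (j - i) * weight (n - 1 - j)))"
    by (rule sum.cong[OF refl], rule sum.mono_neutral_cong_right) auto
  also have "\<dots> = (\<Sum>i<n. lf_e g i * of_real (\<Sum>j\<in>{i..<n}. ?U (j - i) * weight (n - 1 - j)))"
    by (simp add: sum_distrib_left)
  also have "\<dots> = (\<Sum>i<n. lf_e g i * of_real (?U (n - i)))"
    by (intro sum.cong refl) (simp only: inner lessThan_iff)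
  finally have "(\<Sum>j<n. lf_c g j * of_real (weight (n - 1 - j))) = (\<Sum>i<n. lf_e g i * of_real (?U (n - i)))" .
  moreover have "lf_c g n = (\<Sum>i<Suc n. lf_e g i * of_real (?U (n - i)))"
    by (simp only: lf_c_def lessThan_Suc_atMost)
  ultimately show ?thesis by simp
qed

context
  fixes g :: "'a \<Rightarrow> complex" and C :: real
  assumes g[measurable]: "g \<in> borel_measurable E" and C: "\<And>y. y \<in> space E \<Longrightarrow> norm (g y) \<le> C"
begin

lemma measurable_kop_pow [measurable]: "(kop K ^^ n) g \<in> borel_measurable E"
  using norm_kop_pow_le[OF g C] by blast

lemma C_nonneg: "0 \<le> C"
proof -
  obtain y where "y \<in> space E" using space_E_ne by auto
  then show ?thesis using norm_ge_zero[of "g y"] C[of y] by linarith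
qed

lemma norm_kop_pow_le':
  assumes "y \<in> space E"
  shows "norm ((kop K ^^ n) g y) \<le> C"
proof -
  have "norm ((kop K ^^ n) g y) \<le> C * kmass n y" using norm_kop_pow_le[OF g C] assms by blast
  also have "\<dots> \<le> C" by (rule mult_left_le[OF kmass_le_1[OF assms] C_nonneg])
  finally show ?thesis .
qed

text \<open>Integration against \<gamma> turns the masses of the kernel powers into the renewal
  weights, so the renewal equation says exactly that \<open>lf_c\<close> is the \<gamma>-mean of the
  numerator. This closes the recursion: the increment of the denominator \<open>lf_b\<close> is then
  \<open>m\<close> times that mean.\<close>

lemma integral_lf_a: "(\<integral>y. lf_a g n y \<partial>\<gamma>) = lf_c g n"
proof -
  have i1: "integrable \<gamma> ((kop K ^^ n) g)"
    by (rule integrable_\<gamma>[OF measurable_kop_pow norm_kop_pow_le'])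
  have i2: "integrable \<gamma> (\<lambda>y. of_real (kmass k y) :: complex)" for k
    by (rule integrable_\<gamma>[of _ 1]) (auto simp: kmass_nonneg kmass_le_1)
  have "(\<integral>y. lf_a g n y \<partial>\<gamma>) = lf_e g n + m * (\<Sum>j<n. lf_c g j * (\<integral>y. of_real (kmass (n - j) y) \<partial>\<gamma>))"
    unfolding lf_a_def lf_e_def using i1 i2 by simp
  also have "m * (\<Sum>j<n. lf_c g j * (\<integral>y. of_real (kmass (n - j) y) \<partial>\<gamma>)) =
      (\<Sum>j<n. lf_c g j * of_real (weight (n - 1 - j)))"
    unfolding sum_distrib_left by (intro sum.cong refl) (simp add: weight_def Suc_diff_Suc)
  finally show ?thesis by (simp add: lf_c_eq[of g n])
qed

text \<open>Applying \<open>K\<close> raises every power by one. The only summand of the next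
  numerator not obtained in this way is the one with \<open>j = n\<close>, which carries the first
  power.\<close>

lemma kop_lf_a:
  assumes y: "y \<in> space E"
  shows "lf_a g (Suc n) y = kop K (lf_a g n) y + m * lf_c g n * measure (K y) (space E)"
proof -
  have i1: "integrable (K y) ((kop K ^^ n) g)"
    by (rule integrable_K[OF y measurable_kop_pow norm_kop_pow_le'])
  have i2: "integrable (K y) (\<lambda>y. of_real (kmass k y) :: complex)" for k
    by (rule integrable_K[OF y, of _ 1]) (auto simp: kmass_nonneg kmass_le_1)
  have "kop K (lf_a g n) y = (\<integral>z. (kop K ^^ n) g z + m * (\<Sum>j<n. lf_c g j * of_real (kmass (n - j) z)) \<partial>K y)"
    by (simp only: kop_def[of K "lf_a g n"] lf_a_def)
  also have "\<dots> = (\<integral>z. (kop K ^^ n) g z \<partial>K y) + m * (\<Sum>j<n. lf_c g j * of_real (\<integral>z. kmass (n - j) z \<partial>K y))"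
    using i1 i2 by simp
  also have "(\<Sum>j<n. lf_c g j * of_real (\<integral>z. kmass (n - j) z \<partial>K y)) = (\<Sum>j<n. lf_c g j * of_real (kmass (Suc n - j) y))"
    by (intro sum.cong refl) (simp add: kmass_Suc[OF y, symmetric] Suc_diff_le)
  also have "(\<integral>z. (kop K ^^ n) g z \<partial>K y) = (kop K ^^ Suc n) g y"
    by (simp add: kop_def[of K "(kop K ^^ n) g"])
  finally show ?thesis using kmass_1[OF y] by (simp add: lf_a_def[of g "Suc n"] distrib_left)
qed

end

text \<open>
  The recursion for \<open>1 - (offspring_gf ^^ n) h\<close> is projectively linear; \<open>lf_a\<close> and \<open>lf_b\<close> are its
  numerator and denominator.
\<close>

lemma offspring_gf_pow_eq:
  assumes h[measurable]: "h \<in> borel_measurable E" and h_le: "\<And>y. y \<in> space E \<Longrightarrow> norm (h y) \<le> 1"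
  defines "g \<equiv> \<lambda>y. 1 - h y"
  shows "lf_b g n \<noteq> 0 \<and> (\<forall>y\<in>space E. (offspring_gf ^^ n) h y = 1 - lf_a g n y / lf_b g n)"
proof (induction n)
  case 0
  then show ?case by (simp add: lf_b_def lf_a_def g_def)
next
  case (Suc n)
  have g_meas[measurable]: "g \<in> borel_measurable E" unfolding g_def by measurable
  have g_le: "norm (g y) \<le> 2" if "y \<in> space E" for y
    unfolding g_def using norm_triangle_ineq4[of 1 "h y"] h_le[OF that] by simp
  let ?h = "(offspring_gf ^^ n) h"
  have hn[measurable]: "?h \<in> borel_measurable E" and hn_le: "\<And>y. y \<in> space E \<Longrightarrow> norm (?h y) \<le> 1"
    using offspring_gf_pow[OF h h_le] by auto
  have b0: "lf_b g n \<noteq> 0" using Suc by simp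
  have a_eq: "lf_a g n y = lf_b g n * (1 - ?h y)" if "y \<in> space E" for y
  proof -
    have "?h y = 1 - lf_a g n y / lf_b g n" using Suc that by blast
    then show ?thesis using b0 by simp
  qed
  have "lf_c g n = (\<integral>y. lf_a g n y \<partial>\<gamma>)"
    by (rule integral_lf_a[OF g_meas g_le, symmetric])
  also have "\<dots> = (\<integral>y. lf_b g n * (1 - ?h y) \<partial>\<gamma>)"
    by (rule Bochner_Integration.integral_cong) (simp_all add: a_eq)
  also have "\<dots> = lf_b g n * (1 - (\<integral>y. ?h y \<partial>\<gamma>))"
    using integrable_\<gamma>[OF hn hn_le] \<gamma>.prob_space by simp
  finally have c_eq: "lf_c g n = lf_b g n * (1 - (\<integral>y. ?h y \<partial>\<gamma>))" .
  \<comment> \<open>\<open>D\<close> is the denominator of the offspring functional at the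
    \<open>n\<close>-th iterate; \<open>lf_b\<close> is the product of these denominators.\<close>
  define D where "D = 1 + m - m * (\<integral>y. ?h y \<partial>\<gamma>)"
  have b_Suc: "lf_b g (Suc n) = lf_b g n * D"
  proof -
    have "lf_b g (Suc n) = lf_b g n + m * lf_c g n" by (simp add: lf_b_def distrib_left)
    then show ?thesis unfolding c_eq D_def by (simp add: algebra_simps)
  qed
  \<comment> \<open>The subtracted term has norm at most \<open>m\<close>, less than
    \<open>1 + m\<close>, so no denominator vanishes.\<close>
  have "norm (m * (\<integral>y. ?h y \<partial>\<gamma>)) \<le> m"
    using norm_integral_\<gamma>_le[OF hn hn_le] m_pos by (simp add: norm_mult mult_left_le)
  moreover have "norm (1 + complex_of_real m) = 1 + m"
    using norm_of_real[of "1 + m", where 'a = complex] m_pos by simp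
  ultimately have D0: "D \<noteq> 0" using m_pos by (auto simp: D_def)
  have "(offspring_gf ^^ Suc n) h y = 1 - lf_a g (Suc n) y / lf_b g (Suc n)" if y: "y \<in> space E" for y
  proof -
    let ?k = "complex_of_real (measure (K y) (space E))"
    have "kop K (lf_a g n) y = (\<integral>z. lf_b g n * (1 - ?h z) \<partial>K y)"
      unfolding kop_def[of K "lf_a g n"] using y by (intro Bochner_Integration.integral_cong) (simp_all add: a_eq)
    also have "\<dots> = lf_b g n * (?k - kop K ?h y)"
    proof -
      interpret subprob_space "K y" by (rule subprob_K[OF y])
      show ?thesis using integrable_K[OF y hn hn_le] y by (simp add: kop_def[of K ?h] scaleR_conv_of_real)
    qed
    finally have k_eq: "kop K (lf_a g n) y = lf_b g n * (?k - kop K ?h y)" .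
    have "lf_a g (Suc n) y = kop K (lf_a g n) y + m * lf_c g n * ?k"
      by (rule kop_lf_a[OF g_meas g_le y])
    then have "lf_a g (Suc n) y = lf_b g n * (?k * D - kop K ?h y)"
      unfolding k_eq c_eq D_def by (simp add: algebra_simps)
    then have "lf_a g (Suc n) y / lf_b g (Suc n) = ?k - kop K ?h y / D"
      using b0 D0 by (simp add: b_Suc diff_divide_distrib)
    moreover have "(offspring_gf ^^ Suc n) h y = 1 - ?k + kop K ?h y / D"
      using integral_lf_offspring[OF hn hn_le y] by (simp add: offspring_gf_def[of ?h] D_def)
    ultimately show ?thesis by simp
  qed
  with b_Suc b0 D0 show ?case by simp
qed

end

section \<open>Asymptotics of the linear-fractional recursion\<close>

lemma sums_of_suminf_ennreal:
  assumes f: "\<And>i. 0 \<le> f i" and s: "(\<Sum>i. ennreal (f i)) = ennreal s" "0 \<le> s"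
  shows "f sums s"
proof -
  have "summable f" using f s by (intro summable_suminf_not_top) auto
  then show ?thesis
    using suminf_ennreal2[OF f] s suminf_nonneg[OF _ f] by (auto simp: sums_iff)
qed

section \<open>The critical case R = 1\<close>

locale lf_critical = lf +
  fixes \<beta> :: real and x :: 'a
  assumes f_1: "ennreal m * lf_f E K \<gamma> 1 = 1"
    and f'_1: "lf_f' E K \<gamma> 1 < \<infinity>"
    and \<beta>_eq: "\<beta> = m * enn2real (lf_f' E K \<gamma> 1)"
    and x_fin: "x \<in> kernel_fin E K 1"
begin

definition d :: "nat \<Rightarrow> real" where "d n = (\<integral>y. kmass n y \<partial>\<gamma>)"

lemma d_nonneg: "0 \<le> d n" unfolding d_def by (simp add: kmass_nonneg)

lemma integrable_kmass: "integrable \<gamma> (kmass n)"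
  by (rule \<gamma>.integrable_const_bound[of _ 1]) (auto simp: kmass_nonneg kmass_le_1)

lemma lf_d_eq: "lf_d E K \<gamma> n = ennreal (d n)"
proof -
  have "lf_d E K \<gamma> n = (\<integral>\<^sup>+y. ennreal (kmass n y) \<partial>\<gamma>)"
    unfolding lf_d_def by (rule nn_integral_cong) (simp add: kernel_pow_eq_kmass)
  also have "\<dots> = ennreal (d n)"
    unfolding d_def by (rule nn_integral_eq_integral[OF integrable_kmass]) (simp add: kmass_nonneg)
  finally show ?thesis .
qed

lemma d_0: "d 0 = 1"
proof -
  have "d 0 = (\<integral>y. 1 \<partial>\<gamma>)"
    unfolding d_def by (rule Bochner_Integration.integral_cong) (auto simp: kmass_0)
  then show ?thesis using \<gamma>.prob_space by simp
qed

lemma d_Suc_le: "d (Suc n) \<le> d n"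
  unfolding d_def by (intro integral_mono integrable_kmass kmass_Suc_le) simp

lemma weight_eq: "weight n = m * d (Suc n)" by (simp add: weight_def d_def)

lemma weight_sums: "weight sums 1"
proof (rule sums_of_suminf_ennreal)
  show "0 \<le> weight n" for n using m_pos d_nonneg by (simp add: weight_eq)
  have "(\<Sum>n. ennreal (weight n)) = (\<Sum>n. ennreal m * ennreal (d (Suc n)))"
    using m_pos d_nonneg by (simp add: weight_eq ennreal_mult)
  also have "\<dots> = ennreal m * lf_f E K \<gamma> 1" by (simp add: lf_f_def lf_d_eq)
  finally show "(\<Sum>n. ennreal (weight n)) = ennreal 1" using f_1 by simp
qed simp

lemma weighted_d_sums: "(\<lambda>n. real (Suc n) * d (Suc n)) sums enn2real (lf_f' E K \<gamma> 1)"
proof (rule sums_of_suminf_ennreal)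
  show "0 \<le> real (Suc n) * d (Suc n)" for n using d_nonneg by simp
  have "ennreal (real (Suc n) * d (Suc n)) = of_nat (Suc n) * lf_d E K \<gamma> (Suc n)" for n
    by (simp only: lf_d_eq ennreal_mult[OF of_nat_0_le_iff d_nonneg] ennreal_of_nat_eq_real_of_nat)
  then have "(\<Sum>n. ennreal (real (Suc n) * d (Suc n))) = lf_f' E K \<gamma> 1"
    by (simp add: lf_f'_def del: of_nat_Suc)
  then show "(\<Sum>n. ennreal (real (Suc n) * d (Suc n))) = ennreal (enn2real (lf_f' E K \<gamma> 1))"
    using f'_1 by simp
qed simp

sublocale renewal_weights weight \<beta>
proof
  show nonneg: "0 \<le> weight n" for n using m_pos d_nonneg by (simp add: weight_eq)
  show "weight sums 1" by (rule weight_sums)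
  show "0 < weight 0"
  proof (rule ccontr)
    assume "\<not> 0 < weight 0"
    then have "d 1 \<le> 0" using m_pos by (simp add: weight_eq not_less mult_le_0_iff)
    moreover have "d (Suc n) \<le> d 1" for n
      by (induction n) (auto intro: order_trans[OF d_Suc_le])
    ultimately have "weight n = 0" for n
      using d_nonneg[of "Suc n"] by (metis weight_eq antisym mult_zero_right order_trans)
    then have "weight = (\<lambda>_. 0)" by auto
    then show False using sums_unique2[OF weight_sums, of 0] by simp
  qed
  show "(\<lambda>n. real (Suc n) * weight n) sums \<beta>"
    using sums_mult[OF weighted_d_sums, of m] by (simp add: weight_eq \<beta>_eq mult.left_commute)
qed

text \<open>The value is (1 + m) / m, the total mass of the sum of the measures \<gamma>K^n. Its
  reciprocal is the factor that makes \<nu> a probability measure.\<close>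

lemma d_sums: "d sums (1 + 1 / m)"
proof -
  have "(\<lambda>n. d (Suc n)) sums (1 / m)"
    using sums_mult[OF weight_sums, of "1 / m"] m_pos by (simp add: weight_eq)
  from sums_Suc[OF this] show ?thesis by (simp add: d_0 add.commute)
qed

lemma x_in: "x \<in> space E" using x_fin by (simp add: kernel_fin_def)

lemma summable_kmass_x: "summable (\<lambda>n. kmass n x)"
proof (rule summable_suminf_not_top)
  show "(\<Sum>n. ennreal (kmass n x)) \<noteq> top"
    using x_fin x_in by (auto simp: kernel_fin_def kernel_gen_def kernel_pow_eq_kmass)
qed (rule kmass_nonneg)

definition S :: real where "S = (\<Sum>n. kmass (Suc n) x)"

lemma S_sums: "(\<lambda>n. kmass (Suc n) x) sums S"
proof -
  have "summable (\<lambda>n. kmass (Suc n) x)"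
    by (subst summable_Suc_iff) (rule summable_kmass_x)
  then show ?thesis unfolding S_def by (rule summable_sums)
qed

lemma lf_u_eq: "lf_u E K m 1 x = (1 + m) * S"
proof -
  have "enn2real (kernel_gen K 1 x (space E)) = (\<Sum>n. kmass n x)"
    unfolding kernel_gen_def using x_in suminf_nonneg[OF summable_kmass_x kmass_nonneg]
    by (simp add: kernel_pow_eq_kmass suminf_ennreal2[OF kmass_nonneg summable_kmass_x])
  moreover have "(\<Sum>n. kmass n x) = 1 + S"
    using suminf_split_head[OF summable_kmass_x] x_in by (simp add: S_def kmass_0)
  ultimately show ?thesis using x_fin by (simp add: lf_u_def)
qed

text \<open>The terms are nonincreasing and summable: about n/2 indices below \<open>n\<close> carry
  terms at least as large as the \<open>n\<close>-th, so n times that term is at most twice a tail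
  of the series. This kills the first term of \<open>lf_a\<close> even after scaling by
  \<open>n\<close>.\<close>

lemma kmass_x_tendsto: "(\<lambda>n. real n * kmass n x) \<longlonglongrightarrow> 0"
proof -
  have dec: "kmass n x \<le> kmass k x" if "k \<le> n" for k n
    using that by (induction rule: dec_induct) (auto intro: order_trans[OF kmass_Suc_le[OF x_in]])
  define T where "T k = (\<Sum>n. kmass (n + k) x)" for k
  have T: "T \<longlonglongrightarrow> 0" unfolding T_def by (rule suminf_exist_split2[OF summable_kmass_x])
  have bound: "real n * kmass n x \<le> 2 * T (n div 2)" for n
  proof (cases "n = 0")
    case False
    define k where "k = n div 2"
    have "n \<le> 2 * (n - k)" unfolding k_def by presburger
    then have "real n \<le> real (2 * (n - k))" by (rule of_nat_mono)
    from mult_right_mono[OF this kmass_nonneg[of n x]]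
    have "real n * kmass n x \<le> 2 * (\<Sum>i<n - k. kmass n x)"
      by (simp only: sum_constant card_lessThan of_nat_mult of_nat_numeral mult.assoc)
    also have "(\<Sum>i<n - k. kmass n x) \<le> (\<Sum>i<n - k. kmass (i + k) x)"
      by (rule sum_mono, rule dec) (simp add: less_diff_conv)
    also have "\<dots> \<le> T k"
      unfolding T_def
      by (rule sum_le_suminf[OF summable_ignore_initial_segment[OF summable_kmass_x]]) (auto simp: kmass_nonneg)
    finally show ?thesis by (simp add: k_def)
  next
    case True
    have "0 \<le> T (n div 2)"
      unfolding T_def by (rule suminf_nonneg[OF summable_ignore_initial_segment[OF summable_kmass_x] kmass_nonneg])
    with True show ?thesis by simp
  qed
  have half: "filterlim (\<lambda>n::nat. n div 2) at_top sequentially"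
    unfolding filterlim_at_top
  proof
    fix k :: nat
    show "\<forall>\<^sub>F n in sequentially. k \<le> n div 2"
      using eventually_ge_at_top[of "2 * k"] by eventually_elim auto
  qed
  have "(\<lambda>n. 2 * T (n div 2)) \<longlonglongrightarrow> 2 * 0"
    by (intro tendsto_intros filterlim_compose[OF T half])
  then show ?thesis
    using tendsto_sandwich[of "\<lambda>_. 0" "\<lambda>n. real n * kmass n x" sequentially "\<lambda>n. 2 * T (n div 2)" 0]
      bound kmass_nonneg by simp
qed

text \<open>
  The scale \<open>\<sigma>\<close> is \<open>1\<close> for the survival probability and \<open>n\<close> for the test functions
  \<open>1 - exp (i \<theta> w / n)\<close>.
\<close>

lemma lf_a_lf_b_tendsto:
  fixes g :: "nat \<Rightarrow> 'a \<Rightarrow> complex" and \<sigma> :: "nat \<Rightarrow> real"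
    and L :: "nat \<Rightarrow> complex"
  assumes g: "\<And>n. g n \<in> borel_measurable E" and g_le: "\<And>n y. y \<in> space E \<Longrightarrow> norm (g n y) \<le> 2"
    and e_lim: "\<And>i. (\<lambda>n. of_real (\<sigma> n) * lf_e (g n) i) \<longlonglongrightarrow> L i"
    and e_le: "\<And>n i. norm (of_real (\<sigma> n) * lf_e (g n) i) \<le> D i" and D: "summable D"
    and \<sigma>: "\<And>n. 0 \<le> \<sigma> n" "\<And>n. \<sigma> n \<le> max 1 (real n)"
  shows "(\<lambda>n. of_real (\<sigma> n) * (lf_b (g n) n - 1) / of_nat n) \<longlonglongrightarrow> m * suminf L / \<beta>"
    and "(\<lambda>n. of_real (\<sigma> n) * lf_a (g n) n x) \<longlonglongrightarrow> m * suminf L / \<beta> * S"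
    and "summable L"
proof -
  define e where "e n i = of_real (\<sigma> n) * lf_e (g n) i" for n i
  have e: "\<And>i. (\<lambda>n. e n i) \<longlonglongrightarrow> L i" "\<And>n i. norm (e n i) \<le> D i"
    unfolding e_def using e_lim e_le by auto
  have c_eq: "of_real (\<sigma> n) * lf_c (g n) j = (\<Sum>i\<le>j. e n i * of_real (renewal weight (j - i)))" for n j
    by (simp add: lf_c_def e_def sum_distrib_left mult.assoc)
  \<comment> \<open>The constant array \<open>1 / n\<close> produces the averages behind
    \<open>lf_b\<close>; the convolution array \<open>\<kappa> (n - 1 - j)\<close> introduced later
    produces the sum in \<open>lf_a\<close>.\<close>
  have avg: "(\<lambda>n. \<Sum>j\<in>{i..<n}. renewal weight (j - i) * (1 / real n)) \<longlonglongrightarrow> 1 / \<beta>" for i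
    using renewal_average_tendsto[of i] by (simp add: sum_divide_distrib)
  have 1: "(\<lambda>n. \<Sum>j<n. (\<Sum>i\<le>j. e n i * of_real (renewal weight (j - i))) * of_real (1 / real n))
      \<longlonglongrightarrow> suminf L * of_real (1 / \<beta>)"
    by (rule renewal_array_tendsto(1)[OF e D avg, of 1]) auto
  show "summable L"
    by (rule renewal_array_tendsto(2)[OF e D avg, of 1]) auto
  have "of_real (\<sigma> n) * (lf_b (g n) n - 1) / of_nat n =
      m * (\<Sum>j<n. (\<Sum>i\<le>j. e n i * of_real (renewal weight (j - i))) * of_real (1 / real n))" for n
    by (simp add: lf_b_def c_eq[symmetric] sum_distrib_left sum_divide_distrib mult_ac)
  then show "(\<lambda>n. of_real (\<sigma> n) * (lf_b (g n) n - 1) / of_nat n) \<longlonglongrightarrow> m * suminf L / \<beta>"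
    using tendsto_mult_left[OF 1, of "of_real m"] by (simp add: mult.assoc)
  \<comment> \<open>The powers in \<open>lf_a\<close> run from \<open>n - j = n\<close> down to 1,
    never 0. Hence the index shift, and hence the limit involves \<open>S\<close> and not the sum
    over all powers.\<close>
  define \<kappa> where "\<kappa> k = kmass (Suc k) x" for k
  have \<kappa>: "summable \<kappa>" "suminf \<kappa> = S" "\<And>k. 0 \<le> \<kappa> k"
    using S_sums unfolding \<kappa>_def by (auto simp: sums_iff kmass_nonneg)
  have \<kappa>_le: "(\<Sum>j<n. \<kappa> (n - 1 - j)) \<le> S" for n
  proof -
    have "(\<Sum>j<n. \<kappa> (n - 1 - j)) = (\<Sum>j<n. \<kappa> j)" using sum.nat_diff_reindex[of \<kappa> n] by simp
    also have "\<dots> \<le> S" unfolding \<kappa>(2)[symmetric] by (rule sum_le_suminf[OF \<kappa>(1)]) (auto simp: \<kappa>)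
    finally show ?thesis .
  qed
  have 2: "(\<lambda>n. \<Sum>j<n. (\<Sum>i\<le>j. e n i * of_real (renewal weight (j - i))) * of_real (\<kappa> (n - 1 - j)))
      \<longlonglongrightarrow> suminf L * of_real (S / \<beta>)"
    using renewal_weighted_tendsto[OF \<kappa>(1,3)] \<kappa>_le unfolding \<kappa>(2)
    by (intro renewal_array_tendsto(1)[OF e D, of "\<lambda>n j. \<kappa> (n - 1 - j)" "S / \<beta>" S]) (auto simp: \<kappa>(3))
  have a_eq: "of_real (\<sigma> n) * lf_a (g n) n x = of_real (\<sigma> n) * (kop K ^^ n) (g n) x +
      m * (\<Sum>j<n. (\<Sum>i\<le>j. e n i * of_real (renewal weight (j - i))) * of_real (\<kappa> (n - 1 - j)))" for n
  proof -
    have "(\<Sum>j<n. lf_c (g n) j * of_real (kmass (n - j) x)) = (\<Sum>j<n. lf_c (g n) j * of_real (\<kappa> (n - 1 - j)))"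
      by (rule sum.cong) (auto simp: \<kappa>_def Suc_diff_Suc)
    then show ?thesis
      by (simp add: lf_a_def c_eq[symmetric] distrib_left sum_distrib_left mult_ac)
  qed
  \<comment> \<open>For n \<ge> 1 the scale is at most \<open>n\<close>, and \<open>g\<close> has
    norm at most 2, so the term is bounded by a null sequence.\<close>
  have "(\<lambda>n. of_real (\<sigma> n) * (kop K ^^ n) (g n) x) \<longlonglongrightarrow> 0"
  proof (rule Lim_null_comparison)
    show "\<forall>\<^sub>F n in sequentially. norm (of_real (\<sigma> n) * (kop K ^^ n) (g n) x) \<le> 2 * (real n * kmass n x)"
      using eventually_ge_at_top[of 1]
    proof eventually_elim
      case (elim n)
      have "norm ((kop K ^^ n) (g n) x) \<le> 2 * kmass n x"
        using norm_kop_pow_le[OF g g_le] x_in by blast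
      moreover have "\<sigma> n \<le> real n" using \<sigma>(2)[of n] elim by simp
      ultimately have "\<sigma> n * norm ((kop K ^^ n) (g n) x) \<le> real n * (2 * kmass n x)"
        using \<sigma>(1) by (intro mult_mono) auto
      then show ?case using \<sigma>(1) by (simp add: norm_mult)
    qed
    show "(\<lambda>n. 2 * (real n * kmass n x)) \<longlonglongrightarrow> 0"
      using tendsto_mult_left[OF kmass_x_tendsto, of 2] by simp
  qed
  from tendsto_add[OF this tendsto_mult_left[OF 2, of "of_real m"]]
  show "(\<lambda>n. of_real (\<sigma> n) * lf_a (g n) n x) \<longlonglongrightarrow> m * suminf L / \<beta> * S"
    unfolding a_eq by (simp add: mult_ac)
qed

end

section \<open>The limit measure\<close>

context lf
begin

text \<open>These are the measures \<gamma>K^n; up to the factor m / (1 + m), \<nu> is their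
  sum.\<close>

primrec mu :: "nat \<Rightarrow> 'a measure" where
  "mu 0 = \<gamma>"
| "mu (Suc n) = mu n \<bind> K"

lemma mu_props: "subprob_space (mu n) \<and> sets (mu n) = sets E"
proof (induction n)
  case 0
  then show ?case by (simp add: prob_space_imp_subprob_space prob_space_\<gamma>)
next
  case (Suc n)
  then have K': "K \<in> mu n \<rightarrow>\<^sub>M subprob_algebra E" by (simp cong: measurable_cong_sets)
  from Suc show ?case
    using subprob_space_bind[OF _ K'] sets_bind_measurable[OF K'] by (auto simp: subprob_space.subprob_not_empty)
qed

lemma subprob_mu: "subprob_space (mu n)" and sets_mu [simp, measurable_cong]: "sets (mu n) = sets E"
  using mu_props by auto

lemma space_mu [simp]: "space (mu n) = space E" by (rule sets_eq_imp_space_eq) simp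

lemma measurable_K_mu: "K \<in> mu n \<rightarrow>\<^sub>M subprob_algebra E"
  by (simp cong: measurable_cong_sets)

text \<open>Kernel powers acting on functions are moved onto the measure one factor at a time, which
  changes the integrand and so requires the induction over arbitrary \<open>\<phi>\<close>.\<close>

lemma nn_integral_K_pow:
  assumes "\<phi> \<in> borel_measurable E"
  shows "(\<integral>\<^sup>+y. ((\<lambda>\<phi> y. \<integral>\<^sup>+z. \<phi> z \<partial>K y) ^^ n) \<phi> y \<partial>\<gamma>) = (\<integral>\<^sup>+y. \<phi> y \<partial>mu n)"
  using assms
proof (induction n arbitrary: \<phi>)
  case (Suc n)
  have "(\<lambda>y. \<integral>\<^sup>+z. \<phi> z \<partial>K y) \<in> borel_measurable E"
    by (rule measurable_compose[OF K nn_integral_measurable_subprob_algebra[OF Suc.prems]])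
  from Suc.IH[OF this] show ?case
    unfolding funpow_Suc_right o_apply mu.simps nn_integral_bind[OF Suc.prems measurable_K_mu] .
qed simp

lemma kernel_pow_eq_funpow:
  "kernel_pow K n y A = ((\<lambda>\<phi> y. \<integral>\<^sup>+z. \<phi> z \<partial>K y) ^^ n) (indicator A) y"
  by (induction n arbitrary: y) simp_all

lemma emeasure_mu: "A \<in> sets E \<Longrightarrow> emeasure (mu n) A = (\<integral>\<^sup>+y. kernel_pow K n y A \<partial>\<gamma>)"
  by (simp add: kernel_pow_eq_funpow nn_integral_K_pow)

text \<open>With the kernel powers on the side of the measure, the limit of the forcing for varying
  \<open>g\<close> becomes dominated convergence under the single measure
  \<open>mu n\<close>.\<close>

lemma lf_e_eq:
  assumes "g \<in> borel_measurable E" "\<And>y. y \<in> space E \<Longrightarrow> norm (g y) \<le> C"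
  shows "lf_e g n = (\<integral>y. g y \<partial>mu n)"
  using assms
proof (induction n arbitrary: g)
  case 0
  then show ?case by (simp add: lf_e_def)
next
  case (Suc n)
  note g[measurable] = Suc.prems(1)
  have "lf_e g (Suc n) = lf_e (kop K g) n" by (simp add: lf_e_def funpow_swap1)
  also have "\<dots> = (\<integral>y. kop K g y \<partial>mu n)"
    using Suc.prems C_nonneg[OF Suc.prems] by (intro Suc.IH norm_kop_le borel_measurable_kop) auto
  also have "\<dots> = (\<integral>y. g y \<partial>mu (Suc n))"
    unfolding kop_def mu.simps
    by (rule integral_bind_bounded[OF subprob_mu measurable_K_mu Suc.prems, symmetric])
  finally show ?case .
qed

text \<open>The sum over \<open>n\<close> is written as an integral over counting measure, so that
  monotone convergence and additivity of integrals also cover the interchange with this sum.\<close>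

definition nu_sum :: "('a \<Rightarrow> ennreal) \<Rightarrow> ennreal" where
  "nu_sum \<phi> = ennreal (m / (1 + m)) * (\<integral>\<^sup>+n. (\<integral>\<^sup>+y. \<phi> y \<partial>mu n) \<partial>count_space UNIV)"

lemma sets_nu [simp, measurable_cong]: "sets (lf_nu E K \<gamma> m R) = sets E"
  and space_nu [simp]: "space (lf_nu E K \<gamma> m R) = space E"
  by (simp_all add: lf_nu_def sets.space_closed sets.sigma_sets_eq)

text \<open>\<open>measure_of\<close> takes the prescribed values only if they are countably
  additive; this is inherited from the measures \<open>mu n\<close>.\<close>

lemma emeasure_nu:
  assumes A: "A \<in> sets E"
  shows "emeasure (lf_nu E K \<gamma> m 1) A = nu_sum (indicator A)"
proof -
  let ?\<mu> = "\<lambda>A. ennreal (m / (1 + m)) * (\<integral>\<^sup>+y. kernel_gen K (ennreal 1) y A \<partial>\<gamma>)"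
  have eq: "?\<mu> A = nu_sum (indicator A)" if A: "A \<in> sets E" for A
  proof -
    have "(\<integral>\<^sup>+y. kernel_gen K (ennreal 1) y A \<partial>\<gamma>) = (\<Sum>n. \<integral>\<^sup>+y. kernel_pow K n y A \<partial>\<gamma>)"
      unfolding kernel_gen_def using A by (subst nn_integral_suminf[symmetric]) auto
    also have "\<dots> = (\<integral>\<^sup>+n. (\<integral>\<^sup>+y. indicator A y \<partial>mu n) \<partial>count_space UNIV)"
      using A by (simp add: nn_integral_count_space_nat emeasure_mu)
    finally show ?thesis by (simp add: nu_sum_def)
  qed
  have "emeasure (lf_nu E K \<gamma> m 1) A = ?\<mu> A"
  proof (rule emeasure_measure_of[OF lf_nu_def])
    show "sets E \<subseteq> Pow (space E)" by (rule sets.space_closed)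
    show "positive (sets (lf_nu E K \<gamma> m 1)) ?\<mu>"
      using eq[of "{}"] by (auto simp: positive_def nu_sum_def)
    show "countably_additive (sets (lf_nu E K \<gamma> m 1)) ?\<mu>"
    proof (rule countably_additiveI)
      fix A :: "nat \<Rightarrow> 'a set"
      assume A: "range A \<subseteq> sets (lf_nu E K \<gamma> m 1)" and disj: "disjoint_family A"
      then have A': "A i \<in> sets E" "(\<Union>i. A i) \<in> sets E" for i by auto
      have "(\<Sum>i. ?\<mu> (A i)) = (\<Sum>i. nu_sum (indicator (A i)))" by (intro suminf_cong eq A')
      also have "\<dots> = ennreal (m / (1 + m)) * (\<integral>\<^sup>+n. (\<Sum>i. emeasure (mu n) (A i)) \<partial>count_space UNIV)"
        unfolding nu_sum_def using A' by (subst nn_integral_suminf) auto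
      also have "\<dots> = nu_sum (indicator (\<Union>i. A i))"
        unfolding nu_sum_def using A' disj by (simp add: suminf_emeasure image_subset_iff)
      finally show "(\<Sum>i. ?\<mu> (A i)) = ?\<mu> (\<Union>i. A i)" by (simp only: eq[OF A'(2)])
    qed
  qed (use A in simp)
  with eq[OF A] show ?thesis by simp
qed

lemma nn_integral_nu:
  assumes "\<phi> \<in> borel_measurable E"
  shows "(\<integral>\<^sup>+y. \<phi> y \<partial>lf_nu E K \<gamma> m 1) = nu_sum \<phi>"
  using assms
proof (induction \<phi> rule: borel_measurable_induct)
  case (cong f g)
  then have "(\<integral>\<^sup>+y. f y \<partial>lf_nu E K \<gamma> m 1) = (\<integral>\<^sup>+y. g y \<partial>lf_nu E K \<gamma> m 1)"
    by (intro nn_integral_cong) simp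
  moreover have "nu_sum f = nu_sum g"
    unfolding nu_sum_def using cong by (intro arg_cong2[where f = "(*)"] refl nn_integral_cong) simp
  ultimately show ?case using cong by simp
next
  case (set A)
  then show ?case by (simp add: emeasure_nu)
next
  case (mult u c)
  then show ?case by (simp add: nn_integral_cmult nu_sum_def mult.left_commute)
next
  case (add u v)
  then show ?case by (simp add: nn_integral_add nu_sum_def distrib_left)
next
  case (seq U)
  have sup: "Sup (range U) y = (SUP i. U i y)" for y by (simp add: image_image)
  have "(\<integral>\<^sup>+y. Sup (range U) y \<partial>lf_nu E K \<gamma> m 1) = (SUP i. \<integral>\<^sup>+y. U i y \<partial>lf_nu E K \<gamma> m 1)"
    unfolding sup using seq(1,3) by (intro nn_integral_monotone_convergence_SUP) auto
  also have "\<dots> = (SUP i. nu_sum (U i))" using seq by simp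
  also have "\<dots> = nu_sum (Sup (range U))"
  proof -
    have mu_SUP: "(\<integral>\<^sup>+y. Sup (range U) y \<partial>mu n) = (SUP i. \<integral>\<^sup>+y. U i y \<partial>mu n)" for n
      unfolding sup using seq(1,3) by (intro nn_integral_monotone_convergence_SUP) auto
    have inc: "incseq (\<lambda>i n. \<integral>\<^sup>+y. U i y \<partial>mu n)"
      using seq(3) by (auto simp: incseq_def le_fun_def intro!: nn_integral_mono)
    have "(\<integral>\<^sup>+n. (SUP i. \<integral>\<^sup>+y. U i y \<partial>mu n) \<partial>count_space UNIV) =
        (SUP i. \<integral>\<^sup>+n. (\<integral>\<^sup>+y. U i y \<partial>mu n) \<partial>count_space UNIV)"
      by (rule nn_integral_monotone_convergence_SUP[OF inc]) simp
    then show ?thesis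
      unfolding nu_sum_def mu_SUP by (simp only: SUP_mult_left_ennreal)
  qed
  finally show ?case by (simp only: seq(4))
qed

text \<open>For nonnegative functions everything follows from one identity between extended
  nonnegative numbers, solved for the series by the factor (1 + m) / m. A general \<open>w\<close>
  is split into positive and negative parts. The summability of the absolute integrals later
  provides the dominating series for the forcing.\<close>

lemma integrable_nu:
  fixes w :: "'a \<Rightarrow> real"
  assumes w: "integrable (lf_nu E K \<gamma> m 1) w"
  shows "integrable (mu n) w" and "summable (\<lambda>n. \<integral>y. \<bar>w y\<bar> \<partial>mu n)"
    and "(\<lambda>n. \<integral>y. w y \<partial>mu n) sums ((1 + m) / m * (\<integral>y. w y \<partial>lf_nu E K \<gamma> m 1))"
proof -
  have [measurable]: "w \<in> borel_measurable E"
    using borel_measurable_integrable[OF w] by (simp cong: measurable_cong_sets)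
  have nonneg: "integrable (mu n) \<phi> \<and> (\<lambda>n. \<integral>y. \<phi> y \<partial>mu n) sums ((1 + m) / m * (\<integral>y. \<phi> y \<partial>lf_nu E K \<gamma> m 1))"
    if int: "integrable (lf_nu E K \<gamma> m 1) \<phi>" and pos: "\<And>y. 0 \<le> \<phi> y" for \<phi> n
  proof -
    have [measurable]: "\<phi> \<in> borel_measurable E"
      using borel_measurable_integrable[OF int] by (simp cong: measurable_cong_sets)
    define I where "I = (\<integral>y. \<phi> y \<partial>lf_nu E K \<gamma> m 1)"
    have I: "0 \<le> I" unfolding I_def by (simp add: pos)
    have "ennreal I = nu_sum (\<lambda>y. ennreal (\<phi> y))"
      unfolding I_def using nn_integral_eq_integral[OF int] pos by (subst nn_integral_nu[symmetric]) auto
    then have "ennreal I = ennreal (m / (1 + m)) * (\<Sum>n. \<integral>\<^sup>+y. ennreal (\<phi> y) \<partial>mu n)"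
      by (simp add: nu_sum_def nn_integral_count_space_nat)
    then have "ennreal ((1 + m) / m) * ennreal I =
        (ennreal ((1 + m) / m) * ennreal (m / (1 + m))) * (\<Sum>n. \<integral>\<^sup>+y. ennreal (\<phi> y) \<partial>mu n)"
      by (simp add: mult.assoc)
    also have "ennreal ((1 + m) / m) * ennreal (m / (1 + m)) = 1"
      using m_pos by (simp add: ennreal_mult[symmetric])
    finally have sum: "(\<Sum>n. \<integral>\<^sup>+y. ennreal (\<phi> y) \<partial>mu n) = ennreal ((1 + m) / m * I)"
      using m_pos I ennreal_mult[of "(1 + m) / m" I] by simp
    have fin: "(\<integral>\<^sup>+y. ennreal (\<phi> y) \<partial>mu n) < \<infinity>" for n
    proof -
      have "(\<integral>\<^sup>+y. ennreal (\<phi> y) \<partial>mu n) \<le> (\<Sum>n. \<integral>\<^sup>+y. ennreal (\<phi> y) \<partial>mu n)"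
        using sum_le_suminf[of "\<lambda>n. \<integral>\<^sup>+y. ennreal (\<phi> y) \<partial>mu n" "{n}"] by simp
      also have "\<dots> < \<infinity>" by (simp add: sum)
      finally show ?thesis .
    qed
    have int_mu: "integrable (mu n) \<phi>" for n
      using fin[of n] pos by (intro integrableI_nonneg) auto
    have "(\<Sum>n. ennreal (\<integral>y. \<phi> y \<partial>mu n)) = ennreal ((1 + m) / m * I)"
      unfolding sum[symmetric] using int_mu pos by (simp add: nn_integral_eq_integral)
    then have "(\<lambda>n. \<integral>y. \<phi> y \<partial>mu n) sums ((1 + m) / m * I)"
      using m_pos I pos by (intro sums_of_suminf_ennreal) auto
    with int_mu show ?thesis unfolding I_def by blast
  qed
  have pos_part: "integrable (lf_nu E K \<gamma> m 1) (\<lambda>y. max 0 (w y))"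
    and neg_part: "integrable (lf_nu E K \<gamma> m 1) (\<lambda>y. max 0 (- w y))"
    using w by (auto intro!: Bochner_Integration.integrable_bound[OF w])
  have split: "w y = max 0 (w y) - max 0 (- w y)" for y by auto
  have A: "integrable (mu n) (\<lambda>y. max 0 (w y))" "integrable (mu n) (\<lambda>y. max 0 (- w y))" for n
    using nonneg[OF pos_part] nonneg[OF neg_part] by auto
  show "integrable (mu n) w"
    using Bochner_Integration.integrable_diff[OF A] by (simp flip: split)
  show "summable (\<lambda>n. \<integral>y. \<bar>w y\<bar> \<partial>mu n)"
    using nonneg[of "\<lambda>y. \<bar>w y\<bar>"] w by (auto simp: sums_iff)
  have "(\<lambda>n. (\<integral>y. max 0 (w y) \<partial>mu n) - (\<integral>y. max 0 (- w y) \<partial>mu n)) sums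
      ((1 + m) / m * (\<integral>y. max 0 (w y) \<partial>lf_nu E K \<gamma> m 1) - (1 + m) / m * (\<integral>y. max 0 (- w y) \<partial>lf_nu E K \<gamma> m 1))"
    using nonneg[OF pos_part] nonneg[OF neg_part] by (intro sums_diff) auto
  moreover have "(\<integral>y. max 0 (w y) \<partial>mu n) - (\<integral>y. max 0 (- w y) \<partial>mu n) = (\<integral>y. w y \<partial>mu n)" for n
    using Bochner_Integration.integral_diff[OF A] by (simp flip: split)
  moreover have "(\<integral>y. max 0 (w y) \<partial>lf_nu E K \<gamma> m 1) - (\<integral>y. max 0 (- w y) \<partial>lf_nu E K \<gamma> m 1) = (\<integral>y. w y \<partial>lf_nu E K \<gamma> m 1)"
    using Bochner_Integration.integral_diff[OF pos_part neg_part] by (simp flip: split)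
  ultimately show "(\<lambda>n. \<integral>y. w y \<partial>mu n) sums ((1 + m) / m * (\<integral>y. w y \<partial>lf_nu E K \<gamma> m 1))"
    by (simp only: right_diff_distrib[symmetric])
qed

end

section \<open>Survival probability and conditional limit law\<close>

lemma pop_measure_integral:
  fixes w :: "'a \<Rightarrow> real"
  assumes "w \<in> borel_measurable E" "zs \<in> lists (space E)"
  shows "(\<integral>y. w y \<partial>pop_measure E zs) = sum_list (map w zs)"
proof -
  have "(\<lambda>i. zs ! i) \<in> count_space {..<length zs} \<rightarrow>\<^sub>M E"
    using assms(2) by (auto simp: in_lists_conv_set)
  then have "(\<integral>y. w y \<partial>pop_measure E zs) = (\<integral>i. w (zs ! i) \<partial>count_space {..<length zs})"
    unfolding pop_measure_def using assms(1) by (rule integral_distr)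
  also have "\<dots> = (\<Sum>i<length zs. w (zs ! i))"
    by (simp add: lebesgue_integral_count_space_finite)
  finally show ?thesis by (simp add: sum_list_sum_nth atLeast0LessThan)
qed

lemma pop_measure_pos_iff:
  assumes "zs \<in> lists (space E)"
  shows "0 < measure (pop_measure E zs) (space E) \<longleftrightarrow> zs \<noteq> []"
proof -
  have "(\<lambda>i. zs ! i) \<in> count_space {..<length zs} \<rightarrow>\<^sub>M E"
    using assms by (auto simp: in_lists_conv_set)
  moreover from this have "(\<lambda>i. zs ! i) -` space E \<inter> {..<length zs} = {..<length zs}"
    using assms by (auto simp: in_lists_conv_set)
  ultimately have "measure (pop_measure E zs) (space E) = real (length zs)"
    unfolding pop_measure_def by (simp add: measure_distr measure_count_space)
  then show ?thesis by simp
qed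

text \<open>The fundamental theorem with antiderivative -exp(-z x) / z, for complex
  \<open>z\<close>. Integrability comes from the exponential density with the positive rate
  \<open>Re z\<close>, which is also what makes the antiderivative vanish at infinity.\<close>

lemma integral_exp_halfline:
  fixes z :: complex
  assumes z: "0 < Re z"
  shows "(\<integral>x. indicator {0<..} x *\<^sub>R exp (- (z * of_real x)) \<partial>lborel) = 1 / z"
proof -
  let ?f = "\<lambda>x::real. exp (- (z * of_real x))"
  let ?F = "\<lambda>x::real. - exp (- (z * of_real x)) / z"
  have z0: "z \<noteq> 0" using z by auto
  have norm_f: "norm (?f x) = exp (- (Re z * x))" for x by (simp add: norm_exp_eq_Re)
  have density: "integrable lborel (exponential_density (Re z))"
  proof (rule integrableI_nonneg)
    show "(\<integral>\<^sup>+x. ennreal (exponential_density (Re z) x) \<partial>lborel) < \<infinity>"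
      using nn_integral_erlang_ith_moment[OF z, of 0 0] by simp
  qed (use z in \<open>auto simp: exponential_density_def\<close>)
  have int: "set_integrable lborel {0<..} ?f"
    unfolding set_integrable_def
  proof (rule Bochner_Integration.integrable_bound)
    show "integrable lborel (\<lambda>x. exponential_density (Re z) x / Re z)"
      using density by simp
    show "AE x in lborel. norm (indicator {0<..} x *\<^sub>R ?f x) \<le> norm (exponential_density (Re z) x / Re z)"
      using z by (intro AE_I2) (auto simp: norm_f exponential_density_def indicator_def mult.commute)
  qed measurable
  have "(LBINT x=0..\<infinity>. ?f x) = 0 - (- 1 / z)"
  proof (rule interval_integral_FTC_integrable[where F = ?F])
    show "(?F has_vector_derivative ?f x) (at x)" for x
    proof -
      have "((\<lambda>u. - exp (- (z * u)) / z) has_field_derivative exp (- (z * of_real x))) (at (of_real x))"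
        using z0 by (auto intro!: derivative_eq_intros)
      then show ?thesis by (rule has_vector_derivative_real_field)
    qed
    show "set_integrable lborel (einterval 0 \<infinity>) ?f" using int by (simp add: zero_ereal_def)
    show "isCont ?f x" for x by (intro continuous_intros)
    have "(?F \<longlongrightarrow> - exp (- (z * of_real 0)) / z) (at_right 0)"
      using z0 by (intro tendsto_intros)
    then show "((?F \<circ> real_of_ereal) \<longlongrightarrow> - 1 / z) (at_right 0)"
      unfolding zero_ereal_def ereal_tendsto_simps by simp
    have "((\<lambda>x. exp (- (Re z * x))) \<longlongrightarrow> 0) at_top"
      by (intro filterlim_compose[OF exp_at_bot] filterlim_compose[OF filterlim_uminus_at_bot_at_top]
          filterlim_tendsto_pos_mult_at_top[OF tendsto_const z filterlim_ident])
    then have "(?f \<longlongrightarrow> 0) at_top"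
      by (rule tendsto_norm_zero_cancel[OF tendsto_cong[THEN iffD1, rotated]]) (simp add: norm_f)
    then have "(?F \<longlongrightarrow> - 0 / z) at_top"
      using z0 by (intro tendsto_intros)
    then show "((?F \<circ> real_of_ereal) \<longlongrightarrow> 0) (at_left \<infinity>)"
      unfolding ereal_tendsto_simps by simp
  qed simp
  then show ?thesis
    by (simp add: interval_lebesgue_integral_0_infty set_lebesgue_integral_def)
qed

lemma char_scaled_exponential:
  assumes l: "0 < l"
  shows "char (distr (density lborel (exponential_density l)) borel (\<lambda>X. X * c)) \<theta> = 1 / (1 - \<i> * \<theta> * c / l)"
proof -
  \<comment> \<open>The density and the phase combine into one exponential with complex rate
    \<open>z\<close>, whose real part is \<open>l\<close>.\<close>
  define z where "z = of_real l - \<i> * \<theta> * c"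
  have z: "0 < Re z" using l by (simp add: z_def)
  have "char (distr (density lborel (exponential_density l)) borel (\<lambda>X. X * c)) \<theta> =
      (\<integral>x. iexp (\<theta> * (x * c)) \<partial>density lborel (exponential_density l))"
    unfolding char_def by (subst integral_distr) auto
  also have "\<dots> = (\<integral>x. exponential_density l x *\<^sub>R iexp (\<theta> * (x * c)) \<partial>lborel)"
    using l by (subst integral_density) (auto simp: exponential_density_def)
  also have "\<dots> = (\<integral>x. l *\<^sub>R (indicator {0<..} x *\<^sub>R exp (- (z * of_real x))) \<partial>lborel)"
  proof (rule integral_cong_AE)
    \<comment> \<open>Equality holds only almost everywhere: the density is positive at 0, while the
      half-line is open.\<close>
    show "AE x in lborel. exponential_density l x *\<^sub>R iexp (\<theta> * (x * c)) =
        l *\<^sub>R (indicator {0<..} x *\<^sub>R exp (- (z * of_real x)))"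
      using AE_lborel_singleton[of "0 :: real"]
    proof eventually_elim
      case (elim x)
      have "exp (- (z * of_real x)) = of_real (exp (- x * l)) * iexp (\<theta> * (x * c))"
        by (simp add: z_def exp_of_real[symmetric] exp_add[symmetric] algebra_simps)
      with elim show ?case by (simp add: exponential_density_def scaleR_conv_of_real indicator_def)
    qed
  qed measurable
  also have "\<dots> = l *\<^sub>R (1 / z)"
    by (subst integral_scaleR_right) (simp only: integral_exp_halfline[OF z])
  also have "\<dots> = l / z" by (simp add: scaleR_conv_of_real)
  also have "\<dots> = 1 / (1 - \<i> * \<theta> * c / l)"
    using l by (simp add: z_def field_simps)
  finally show ?thesis .
qed

lemma norm_iexp_minus_one_le: "norm (1 - iexp t) \<le> \<bar>t\<bar>"
  using iexp_approx1[of t 0] by (simp add: norm_minus_commute)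

text \<open>The second-order Taylor error at a/n is at most (a/n)^2 / 2, which is still of order 1/n
  after multiplication by \<open>n\<close>.\<close>

lemma scaled_iexp_tendsto: "(\<lambda>n. of_nat n * (1 - iexp (a / real n))) \<longlonglongrightarrow> - \<i> * of_real a"
proof -
  have "(\<lambda>n. of_nat n * (1 - iexp (a / real n)) + \<i> * of_real a) \<longlonglongrightarrow> 0"
  proof (rule Lim_null_comparison)
    show "(\<lambda>n. a\<^sup>2 / 2 * (1 / real n)) \<longlonglongrightarrow> 0"
      using tendsto_mult_left[OF lim_1_over_n, of "a\<^sup>2 / 2"] by simp
    show "\<forall>\<^sub>F n in sequentially. norm (of_nat n * (1 - iexp (a / real n)) + \<i> * of_real a) \<le> a\<^sup>2 / 2 * (1 / real n)"
      using eventually_gt_at_top[of 0]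
    proof eventually_elim
      case (elim n)
      define t where "t = a / real n"
      have a: "of_real a = of_nat n * complex_of_real t" using elim by (simp add: t_def)
      have "of_nat n * (1 - iexp t) + \<i> * of_real a = - of_nat n * (iexp t - (1 + \<i> * t))"
        unfolding a by (simp add: algebra_simps)
      then have "norm (of_nat n * (1 - iexp t) + \<i> * of_real a) = real n * norm (iexp t - (1 + \<i> * t))"
        by (simp add: norm_mult)
      also have "\<dots> \<le> real n * (t\<^sup>2 / 2)"
        using iexp_approx1[of t 1] by (intro mult_left_mono) (simp_all add: power2_eq_square abs_mult_self_eq)
      also have "\<dots> = a\<^sup>2 / 2 * (1 / real n)"
        using elim by (simp add: t_def power2_eq_square)
      finally show ?case by (simp add: t_def)
    qed
  qed
  from tendsto_add[OF this tendsto_const[of "- \<i> * of_real a"]] show ?thesis by simp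
qed

section \<open>Survival probability\<close>

locale lf_critical_process = lf_critical +
  fixes P :: "'w measure" and Z :: "nat \<Rightarrow> 'w \<Rightarrow> 'a list"
  assumes proc: "lf_process E K \<gamma> m x P Z"
begin

sublocale P: prob_space P using proc by (simp add: lf_process_def)

lemma measurable_Z [measurable]: "Z n \<in> P \<rightarrow>\<^sub>M list_space E"
  using proc by (simp add: lf_process_def)

lemma Z_lists: "\<omega> \<in> space P \<Longrightarrow> Z n \<omega> \<in> lists (space E)"
  using measurable_space[OF measurable_Z] by (simp add: space_list_space)

definition alive :: "nat \<Rightarrow> 'w set" where "alive n = {\<omega> \<in> space P. Z n \<omega> \<noteq> []}"

lemma alive_eq: "{\<omega> \<in> space P. measure (pop_measure E (Z n \<omega>)) (space E) > 0} = alive n"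
  using Z_lists by (auto simp: alive_def pop_measure_pos_iff)

lemma alive_sets [measurable]: "alive n \<in> sets P"
proof -
  have "alive n = {\<omega> \<in> space P. length (Z n \<omega>) \<noteq> 0}" by (auto simp: alive_def)
  also have "\<dots> \<in> sets P" by measurable
  finally show ?thesis .
qed

abbreviation "surv n \<equiv> measure P (alive n)"

lemma expectation_prod:
  assumes "h \<in> borel_measurable E" "\<And>y. y \<in> space E \<Longrightarrow> norm (h y) \<le> 1"
  shows "(\<integral>\<omega>. prod_list (map h (Z n \<omega>)) \<partial>P) = 1 - lf_a (\<lambda>y. 1 - h y) n x / lf_b (\<lambda>y. 1 - h y) n"
  using expectation_generation[OF proc x_in assms] offspring_gf_pow_eq[OF assms] x_in by simp

text \<open>A product of zeros is 1 over an empty generation and 0 otherwise, so its mean is the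
  extinction probability.\<close>

lemma surv_eq: "of_real (surv n) = lf_a (\<lambda>_. 1) n x / lf_b (\<lambda>_. 1) n"
proof -
  have prod: "prod_list (map (\<lambda>_. 0 :: complex) zs) = (if zs = [] then 1 else 0)" for zs :: "'a list"
    by (cases zs) auto
  have "(\<integral>\<omega>. prod_list (map (\<lambda>_. 0) (Z n \<omega>)) \<partial>P) = (\<integral>\<omega>. of_real (1 - indicator (alive n) \<omega>) \<partial>P :: complex)"
    by (rule Bochner_Integration.integral_cong) (auto simp: prod alive_def)
  also have "\<dots> = of_real (\<integral>\<omega>. 1 - indicator (alive n) \<omega> \<partial>P)"
    by (rule integral_complex_of_real)
  also have "(\<integral>\<omega>. 1 - indicator (alive n) \<omega> \<partial>P) = 1 - surv n"
    using sets.sets_into_space[OF alive_sets[of n]] P.prob_space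
    by (subst Bochner_Integration.integral_diff) (auto simp: Int_absorb1 P.emeasure_eq_measure)
  finally show ?thesis using expectation_prod[of "\<lambda>_. 0" n] by simp
qed

lemma lf_e_1: "lf_e (\<lambda>_. 1) i = of_real (d i)"
proof -
  have "(kop K ^^ i) (\<lambda>_. 1) y = of_real (kmass i y)" if "y \<in> space E" for y
    using that
  proof (induction i arbitrary: y)
    case 0
    then show ?case by (simp add: kmass_0)
  next
    case (Suc i)
    have "(kop K ^^ Suc i) (\<lambda>_. 1) y = kop K (\<lambda>z. of_real (kmass i z)) y"
      unfolding funpow.simps o_apply kop_def[of K "(kop K ^^ i) (\<lambda>_. 1)"] kop_def[of K "\<lambda>z. of_real (kmass i z)"]
      using Suc by (intro Bochner_Integration.integral_cong) auto
    then show ?case by (simp add: kop_kmass[OF Suc.prems])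
  qed
  then have "lf_e (\<lambda>_. 1) i = (\<integral>y. of_real (kmass i y) \<partial>\<gamma>)"
    unfolding lf_e_def by (intro Bochner_Integration.integral_cong) auto
  then show ?thesis by (simp add: d_def)
qed

text \<open>With g = 1 the forcing is \<open>d\<close>, of sum (1 + m) / m. Hence
  \<open>lf_b / n\<close> tends to c = (1 + m) / \<beta> and \<open>lf_a\<close> at the starting
  type to c S; in the quotient \<open>c\<close>, and \<beta> with it, cancels.\<close>

lemma n_surv_tendsto: "(\<lambda>n. real n * surv n) \<longlonglongrightarrow> S"
proof -
  define c where "c = (1 + m) / \<beta>"
  have c: "0 < c" using m_pos mean_pos by (simp add: c_def)
  have sumL: "suminf (\<lambda>i. complex_of_real (d i)) = of_real (1 + 1 / m)"
    by (rule sums_unique[symmetric]) (intro sums_of_real d_sums)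
  have c_eq: "of_real m * suminf (\<lambda>i. complex_of_real (d i)) / of_real \<beta> = of_real c"
  proof -
    have "m * (1 + 1 / m) = 1 + m" using m_pos by (simp add: distrib_left)
    then have "m * (1 + 1 / m) / \<beta> = c" by (simp add: c_def)
    then show ?thesis unfolding sumL by (simp only: of_real_mult[symmetric] of_real_divide[symmetric])
  qed
  have b0: "(\<lambda>n. of_real 1 * (lf_b (\<lambda>_. 1) n - 1) / of_nat n) \<longlonglongrightarrow> of_real c"
    unfolding c_eq[symmetric]
    by (rule lf_a_lf_b_tendsto(1)[where g = "\<lambda>_ _. 1" and \<sigma> = "\<lambda>_. 1" and D = d])
       (use d_sums d_nonneg in \<open>auto simp: lf_e_1 sums_iff\<close>)
  have a0: "(\<lambda>n. of_real 1 * lf_a (\<lambda>_. 1) n x) \<longlonglongrightarrow> of_real c * of_real S"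
    unfolding c_eq[symmetric]
    by (rule lf_a_lf_b_tendsto(2)[where g = "\<lambda>_ _. 1" and \<sigma> = "\<lambda>_. 1" and D = d])
       (use d_sums d_nonneg in \<open>auto simp: lf_e_1 sums_iff\<close>)
  have "(\<lambda>n. (lf_b (\<lambda>_. 1) n - 1) / of_nat n + 1 / of_nat n) \<longlonglongrightarrow> of_real c + 0"
    by (rule tendsto_add[OF _ lim_1_over_n]) (use b0 in simp)
  then have b: "(\<lambda>n. lf_b (\<lambda>_. 1) n / of_nat n) \<longlonglongrightarrow> of_real c"
    by (simp add: diff_divide_distrib)
  have a: "(\<lambda>n. lf_a (\<lambda>_. 1) n x) \<longlonglongrightarrow> of_real c * of_real S"
    using a0 by simp
  have "(\<lambda>n. lf_a (\<lambda>_. 1) n x / (lf_b (\<lambda>_. 1) n / of_nat n)) \<longlonglongrightarrow> of_real c * of_real S / of_real c"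
    using c by (intro tendsto_divide a b) simp
  then have "(\<lambda>n. complex_of_real (real n * surv n)) \<longlonglongrightarrow> of_real S"
    using c by (simp add: surv_eq mult.commute)
  then show ?thesis by (simp only: tendsto_of_real_iff)
qed

lemma S_nonneg: "0 \<le> S"
  unfolding S_def using S_sums by (intro suminf_nonneg) (auto simp: sums_iff kmass_nonneg)

text \<open>The degenerate case: if \<open>S\<close> vanishes, so does every positive power of the
  kernel at the starting type, and the first particle almost surely has no children.\<close>

lemma surv_eq_0:
  assumes "S = 0" "0 < n"
  shows "surv n = 0"
proof -
  have "kmass (Suc k) x = 0" for k
    using S_sums assms(1) suminf_eq_zero_iff[of "\<lambda>n. kmass (Suc n) x"] by (auto simp: sums_iff kmass_nonneg)
  then have k: "kmass k x = 0" if "0 < k" for k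
    using that by (cases k) auto
  have "norm ((kop K ^^ n) (\<lambda>_. 1) x) \<le> 1 * kmass n x"
    using norm_kop_pow_le[of "\<lambda>_. 1" 1 n] x_in by simp
  then have "lf_a (\<lambda>_. 1) n x = 0" using assms(2) by (simp add: lf_a_def k)
  then show ?thesis using surv_eq[of n] by simp
qed

abbreviation "nu \<equiv> lf_nu E K \<gamma> m 1"

section \<open>Conditional law of the score\<close>

context
  fixes w :: "'a \<Rightarrow> real"
  assumes w: "integrable nu w"
begin

lemma w_meas [measurable]: "w \<in> borel_measurable E"
  using borel_measurable_integrable[OF w] by (simp cong: measurable_cong_sets)

text \<open>\<open>M\<close> is the mean of the limit variable. Since the test function is of order
  1/n, the denominator converges without normalisation, to 1 - i \<theta> M, and only the numerator
  has to be scaled by \<open>n\<close>.\<close>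

lemma iexp_gf_tendsto:
  fixes \<theta> :: real
  defines "M \<equiv> (1 + m) / \<beta> * (\<integral>y. w y \<partial>nu)"
    and "g \<equiv> \<lambda>(n :: nat) y. 1 - iexp (\<theta> * w y / real n)"
  shows "(\<lambda>n. of_nat n * (lf_a (g n) n x / lf_b (g n) n)) \<longlonglongrightarrow> - \<i> * \<theta> * M * S / (1 - \<i> * \<theta> * M)"
proof -
  have g_meas[measurable]: "g n \<in> borel_measurable E" for n unfolding g_def by measurable
  have g_le: "norm (g n y) \<le> 2" for n y
    unfolding g_def using norm_triangle_ineq4[of 1 "iexp (\<theta> * w y / real n)"] by simp
  have ng_le: "norm (of_nat n * g n y) \<le> \<bar>\<theta>\<bar> * \<bar>w y\<bar>" for n y
  proof (cases "n = 0")
    case False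
    have "norm (of_nat n * g n y) = real n * norm (1 - iexp (\<theta> * w y / real n))"
      by (simp only: norm_mult norm_of_nat g_def)
    also have "\<dots> \<le> real n * \<bar>\<theta> * w y / real n\<bar>"
      by (intro mult_left_mono norm_iexp_minus_one_le) simp
    also have "\<dots> = \<bar>\<theta>\<bar> * \<bar>w y\<bar>" using False by (simp add: abs_mult)
    finally show ?thesis .
  qed simp
  have int_w: "integrable (mu i) w" for i by (rule integrable_nu(1)[OF w])
  have int_b: "integrable (mu i) (\<lambda>y. \<bar>\<theta>\<bar> * \<bar>w y\<bar>)" for i using int_w[of i] by simp
  have e_eq: "of_real (real n) * lf_e (g n) i = (\<integral>y. of_nat n * g n y \<partial>mu i)" for n i
    using lf_e_eq[OF g_meas g_le] by simp
  define L where "L i = - \<i> * \<theta> * of_real (\<integral>y. w y \<partial>mu i)" for i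
  \<comment> \<open>The bound |\<theta>| |w| on n (1 - exp(i \<theta> w / n)) is uniform in
    \<open>n\<close>, so its integrals dominate the scaled forcing; they are summable because
    \<open>w\<close> is \<nu>-integrable.\<close>
  define D where "D i = \<bar>\<theta>\<bar> * (\<integral>y. \<bar>w y\<bar> \<partial>mu i)" for i
  have D: "summable D" unfolding D_def by (intro summable_mult integrable_nu(2)[OF w])
  have e_le: "norm (of_real (real n) * lf_e (g n) i) \<le> D i" for n i
  proof -
    have "integrable (mu i) (\<lambda>y. of_nat n * g n y)"
      by (rule Bochner_Integration.integrable_bound[OF int_b]) (use ng_le in \<open>auto intro!: AE_I2\<close>)
    then have "norm (\<integral>y. of_nat n * g n y \<partial>mu i) \<le> (\<integral>y. \<bar>\<theta>\<bar> * \<bar>w y\<bar> \<partial>mu i)"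
      by (intro order_trans[OF integral_norm_bound] integral_mono integrable_norm int_b ng_le)
    then show ?thesis unfolding e_eq D_def by simp
  qed
  have e_lim: "(\<lambda>n. of_real (real n) * lf_e (g n) i) \<longlonglongrightarrow> L i" for i
  proof -
    have "(\<lambda>n. \<integral>y. of_nat n * g n y \<partial>mu i) \<longlonglongrightarrow> (\<integral>y. - \<i> * of_real (\<theta> * w y) \<partial>mu i)"
    proof (rule integral_dominated_convergence[OF _ _ int_b])
      show "AE y in mu i. (\<lambda>n. of_nat n * g n y) \<longlonglongrightarrow> - \<i> * of_real (\<theta> * w y)"
        unfolding g_def by (intro AE_I2 scaled_iexp_tendsto)
      show "AE y in mu i. norm (of_nat n * g n y) \<le> \<bar>\<theta>\<bar> * \<bar>w y\<bar>" for n
        by (intro AE_I2 ng_le)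
    qed measurable
    also have "(\<integral>y. - \<i> * of_real (\<theta> * w y) \<partial>mu i) = L i"
      unfolding L_def using int_w[of i] by simp
    finally show ?thesis unfolding e_eq .
  qed
  have "L sums (- \<i> * \<theta> * of_real ((1 + m) / m * (\<integral>y. w y \<partial>nu)))"
    unfolding L_def by (intro sums_mult sums_of_real integrable_nu(3)[OF w])
  then have sumL: "suminf L = - \<i> * \<theta> * of_real ((1 + m) / m * (\<integral>y. w y \<partial>nu))"
    by (rule sums_unique[symmetric])
  have "of_real m * suminf L / of_real \<beta> = - \<i> * \<theta> * of_real (m * ((1 + m) / m * (\<integral>y. w y \<partial>nu)) / \<beta>)"
    unfolding sumL by simp
  also have "m * ((1 + m) / m * (\<integral>y. w y \<partial>nu)) / \<beta> = M"
    using m_pos by (simp add: M_def)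
  finally have M_eq: "of_real m * suminf L / of_real \<beta> = - \<i> * \<theta> * of_real M" .
  have "(\<lambda>n. of_real (real n) * (lf_b (g n) n - 1) / of_nat n) \<longlonglongrightarrow> - \<i> * \<theta> * of_real M"
    unfolding M_eq[symmetric]
    by (rule lf_a_lf_b_tendsto(1)[OF g_meas g_le e_lim e_le D]) auto
  then have "(\<lambda>n. lf_b (g n) n - 1) \<longlonglongrightarrow> - \<i> * \<theta> * of_real M"
    by (rule Lim_transform_eventually) (use eventually_gt_at_top[of 0] in eventually_elim, simp)
  from tendsto_add[OF this tendsto_const[of 1]]
  have b: "(\<lambda>n. lf_b (g n) n) \<longlonglongrightarrow> 1 - \<i> * \<theta> * M" by simp
  have a: "(\<lambda>n. of_real (real n) * lf_a (g n) n x) \<longlonglongrightarrow> - \<i> * \<theta> * of_real M * S"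
    unfolding M_eq[symmetric]
    by (rule lf_a_lf_b_tendsto(2)[OF g_meas g_le e_lim e_le D]) auto
  have "Re (1 - \<i> * \<theta> * M) = 1" by simp
  then have "1 - \<i> * complex_of_real \<theta> * M \<noteq> 0" by (metis zero_complex.sel(1) zero_neq_one)
  from tendsto_divide[OF a b this] show ?thesis by simp
qed

definition score :: "nat \<Rightarrow> 'w \<Rightarrow> real" where
  "score n \<omega> = (\<integral>y. w y \<partial>pop_measure E (Z n \<omega>))"

lemma score_eq: "\<omega> \<in> space P \<Longrightarrow> score n \<omega> = sum_list (map w (Z n \<omega>))"
  unfolding score_def by (rule pop_measure_integral[OF w_meas Z_lists])

lemma measurable_score [measurable]: "score n \<in> borel_measurable P"
proof -
  have "(\<lambda>\<omega>. sum_list (map w (Z n \<omega>))) \<in> borel_measurable P" by measurable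
  then show ?thesis by (rule measurable_cong[THEN iffD1, rotated]) (simp add: score_eq)
qed

abbreviation "cond_law n \<equiv> distr (uniform_measure P (alive n)) borel (\<lambda>\<omega>. score n \<omega> / real n)"

lemma real_distribution_cond_law:
  assumes "0 < surv n"
  shows "real_distribution (cond_law n)"
proof -
  interpret U: prob_space "uniform_measure P (alive n)"
    by (rule prob_space_uniform_measure) (use assms in \<open>auto simp: P.emeasure_eq_measure\<close>)
  show ?thesis by (rule U.real_distribution_distr) measurable
qed

text \<open>On extinction the score is 0 and its exponential is 1. Restricting the unconditional
  characteristic function to survival therefore amounts to subtracting the extinction
  probability.\<close>

lemma char_cond_law:
  assumes surv: "0 < surv n"
  defines "g \<equiv> \<lambda>\<theta> y. 1 - iexp (\<theta> * w y / real n)"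
  shows "char (cond_law n) \<theta> = 1 - lf_a (g \<theta>) n x / lf_b (g \<theta>) n / surv n"
proof -
  let ?f = "\<lambda>\<omega>. iexp (\<theta> * (score n \<omega> / real n))"
  have um: "uniform_measure P (alive n) = density P (\<lambda>\<omega>. ennreal (indicator (alive n) \<omega> / surv n))"
    unfolding uniform_measure_def using surv divide_ennreal[of 1 "surv n"]
    by (intro density_cong) (auto simp: P.emeasure_eq_measure split: split_indicator)
  have "char (cond_law n) \<theta> = (\<integral>\<omega>. ?f \<omega> \<partial>uniform_measure P (alive n))"
    unfolding char_def by (subst integral_distr) measurable
  also have "\<dots> = (\<integral>\<omega>. (indicator (alive n) \<omega> / surv n) *\<^sub>R ?f \<omega> \<partial>P)"
    unfolding um using surv by (subst integral_density) auto
  also have "\<dots> = (\<integral>\<omega>. (?f \<omega> - of_real (1 - indicator (alive n) \<omega>)) / surv n \<partial>P)"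
    by (rule Bochner_Integration.integral_cong[OF refl])
       (auto simp: scaleR_conv_of_real score_eq alive_def split: split_indicator)
  also have "\<dots> = ((\<integral>\<omega>. ?f \<omega> \<partial>P) - (\<integral>\<omega>. of_real (1 - indicator (alive n) \<omega>) \<partial>P)) / surv n"
  proof -
    have "integrable P ?f" by (rule P.integrable_const_bound[of _ 1]) auto
    moreover have "integrable P (\<lambda>\<omega>. of_real (1 - indicator (alive n) \<omega>) :: complex)"
      by (rule P.integrable_const_bound[of _ 1]) (auto split: split_indicator)
    ultimately show ?thesis by (subst integral_divide_zero) (subst Bochner_Integration.integral_diff, auto)
  qed
  also have "(\<integral>\<omega>. of_real (1 - indicator (alive n) \<omega>) \<partial>P) = complex_of_real (1 - surv n)"
  proof -
    have "(\<integral>\<omega>. 1 - indicator (alive n) \<omega> \<partial>P) = 1 - surv n"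
      using sets.sets_into_space[OF alive_sets[of n]] P.prob_space
      by (subst Bochner_Integration.integral_diff) (auto simp: Int_absorb1 P.emeasure_eq_measure)
    then show ?thesis by (subst integral_complex_of_real) simp
  qed
  also have "(\<integral>\<omega>. ?f \<omega> \<partial>P) = 1 - lf_a (g \<theta>) n x / lf_b (g \<theta>) n"
  proof -
    have exp_sum: "iexp (\<theta> * (sum_list (map w zs) / real n)) = prod_list (map (\<lambda>y. iexp (\<theta> * w y / real n)) zs)" for zs
      by (induction zs) (simp_all add: exp_add distrib_left add_divide_distrib)
    have "(\<integral>\<omega>. ?f \<omega> \<partial>P) = (\<integral>\<omega>. prod_list (map (\<lambda>y. iexp (\<theta> * w y / real n)) (Z n \<omega>)) \<partial>P)"
      by (rule Bochner_Integration.integral_cong[OF refl]) (simp only: score_eq exp_sum)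
    also have "\<dots> = 1 - lf_a (g \<theta>) n x / lf_b (g \<theta>) n"
      unfolding g_def by (rule expectation_prod) auto
    finally show ?thesis .
  qed
  finally show ?thesis using surv by (simp add: diff_divide_distrib)
qed

lemma weak_conv_cond_law:
  assumes surv: "\<forall>\<^sub>F n in sequentially. 0 < surv n"
  shows "weak_conv_m cond_law
    (distr (density lborel (exponential_density (\<beta> / (1 + m)))) borel (\<lambda>X. X * (\<integral>y. w y \<partial>nu)))"
    (is "weak_conv_m _ ?lim")
proof -
  obtain N where N: "\<And>n. N \<le> n \<Longrightarrow> 0 < surv n" using surv by (auto simp: eventually_sequentially)
  have l: "0 < \<beta> / (1 + m)" using mean_pos m_pos by simp
  \<comment> \<open>Were \<open>S\<close> zero, survival would have probability 0 from the first
    generation on.\<close>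
  have S: "0 < S"
    using surv_eq_0[of "Suc N"] N[of "Suc N"] S_nonneg by fastforce
  define M where "M = (1 + m) / \<beta> * (\<integral>y. w y \<partial>nu)"
  \<comment> \<open>\<open>cond_law n\<close> is known to be a distribution only from
    \<open>N\<close> on, so Levy's theorem is applied to the shifted sequence and the shift is
    undone at the end.\<close>
  have "weak_conv_m (\<lambda>n. cond_law (n + N)) ?lim"
  proof (rule levy_continuity)
    show "real_distribution (cond_law (n + N))" for n
      by (rule real_distribution_cond_law) (simp add: N)
    interpret X: prob_space "density lborel (exponential_density (\<beta> / (1 + m)))"
      by (rule prob_space_exponential_density[OF l])
    show "real_distribution ?lim" by (rule X.real_distribution_distr) simp
    fix \<theta> :: real
    define F where "F n = lf_a (\<lambda>y. 1 - iexp (\<theta> * w y / real n)) n x / lf_b (\<lambda>y. 1 - iexp (\<theta> * w y / real n)) n" for n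
    have F: "(\<lambda>n. of_nat n * F n) \<longlonglongrightarrow> - \<i> * \<theta> * M * S / (1 - \<i> * \<theta> * M)"
      unfolding F_def M_def by (rule iexp_gf_tendsto)
    have "Re (1 - \<i> * \<theta> * M) = 1" by simp
    then have nz: "1 - \<i> * complex_of_real \<theta> * M \<noteq> 0" by (metis zero_complex.sel(1) zero_neq_one)
    \<comment> \<open>Expanding the quotient by \<open>n\<close> gives two convergent factors.
      \<open>S\<close> cancels, and 1 + i \<theta> M / (1 - i \<theta> M) is the characteristic
      function of the exponential law with mean \<open>M\<close>, so the limit no longer depends on
      the starting type.\<close>
    have "(\<lambda>n. 1 - of_nat n * F n / complex_of_real (real n * surv n)) \<longlonglongrightarrow>
        1 - (- \<i> * \<theta> * M * S / (1 - \<i> * \<theta> * M)) / complex_of_real S"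
      using S by (intro tendsto_intros F n_surv_tendsto) simp
    also have "1 - (- \<i> * \<theta> * M * S / (1 - \<i> * \<theta> * M)) / complex_of_real S = 1 / (1 - \<i> * \<theta> * M)"
      using S nz by (simp add: field_simps)
    also have "\<dots> = char ?lim \<theta>"
      unfolding char_scaled_exponential[OF l] M_def using m_pos mean_pos by (simp add: mult_ac)
    finally have lim: "(\<lambda>n. 1 - of_nat n * F n / complex_of_real (real n * surv n)) \<longlonglongrightarrow> char ?lim \<theta>" .
    have "(\<lambda>n. char (cond_law n) \<theta>) \<longlonglongrightarrow> char ?lim \<theta>"
      using lim
    proof (rule Lim_transform_eventually)
      show "\<forall>\<^sub>F n in sequentially. 1 - of_nat n * F n / complex_of_real (real n * surv n) = char (cond_law n) \<theta>"
        using eventually_ge_at_top[of "Suc N"]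
      proof eventually_elim
        case (elim n)
        then show ?case using char_cond_law[of n \<theta>] N[of n] by (simp add: F_def)
      qed
    qed
    then show "(\<lambda>n. char (cond_law (n + N)) \<theta>) \<longlonglongrightarrow> char ?lim \<theta>"
      by (rule LIMSEQ_ignore_initial_segment)
  qed
  then have "(\<lambda>n. cdf (cond_law (n + N)) r) \<longlonglongrightarrow> cdf ?lim r" if "isCont (cdf ?lim) r" for r
    using that unfolding weak_conv_m_def weak_conv_def by blast
  then show ?thesis
    unfolding weak_conv_m_def weak_conv_def by (blast intro: LIMSEQ_offset[where k = N])
qed

lemma tail_cond_law:
  assumes surv: "\<forall>\<^sub>F n in sequentially. 0 < surv n" and pos: "0 < (\<integral>y. w y \<partial>nu)" and t: "0 \<le> t"
  shows "(\<lambda>n. \<P>(\<omega> in P. score n \<omega> / (\<integral>y. w y \<partial>nu) > real n * t \<bar> measure (pop_measure E (Z n \<omega>)) (space E) > 0))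
    \<longlonglongrightarrow> exp (- t * \<beta> / (1 + m))"
proof -
  define c where "c = (\<integral>y. w y \<partial>nu)"
  define l where "l = \<beta> / (1 + m)"
  have c: "0 < c" using pos by (simp add: c_def)
  have l: "0 < l" using mean_pos m_pos by (simp add: l_def)
  let ?D = "density lborel (exponential_density l)"
  let ?lim = "distr ?D borel (\<lambda>X. X * c)"
  interpret X: prob_space ?D by (rule prob_space_exponential_density[OF l])
  interpret lim: real_distribution ?lim by (rule X.real_distribution_distr) simp
  have D: "distributed ?D lborel (\<lambda>X. X) (exponential_density l)"
    by (auto simp: distributed_def intro!: distr_id2)
  have "measure ?lim {..c * t} = measure ?D {X \<in> space ?D. X \<le> t}"
    using c by (subst measure_distr) (auto intro!: arg_cong[where f = "measure ?D"] simp: mult.commute)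
  also have "\<dots> = 1 - exp (- t * l)" by (rule X.exponential_distributedD_le[OF D t l])
  finally have cdf: "cdf ?lim (c * t) = 1 - exp (- t * l)" by (simp add: cdf_def)
  \<comment> \<open>The limit law has no atom at \<open>c * t\<close>, so weak convergence gives
    convergence of the distribution functions there, also for t = 0.\<close>
  have "emeasure ?D {t} = 0" by (simp add: emeasure_density nn_integral_indicator_singleton)
  moreover have "emeasure ?lim {c * t} = emeasure ?D {t}"
    using c by (subst emeasure_distr) (auto intro!: arg_cong[where f = "emeasure ?D"])
  ultimately have "isCont (cdf ?lim) (c * t)"
    unfolding lim.isCont_cdf by (simp add: measure_def)
  with weak_conv_cond_law[OF surv] have "(\<lambda>n. cdf (cond_law n) (c * t)) \<longlonglongrightarrow> cdf ?lim (c * t)"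
    unfolding weak_conv_m_def weak_conv_def c_def l_def by blast
  from tendsto_diff[OF tendsto_const[of 1] this]
  have lim: "(\<lambda>n. 1 - cdf (cond_law n) (c * t)) \<longlonglongrightarrow> exp (- t * l)" by (simp add: cdf)
  have "\<forall>\<^sub>F n in sequentially. 1 - cdf (cond_law n) (c * t) =
      \<P>(\<omega> in P. score n \<omega> / c > real n * t \<bar> measure (pop_measure E (Z n \<omega>)) (space E) > 0)"
    using surv eventually_gt_at_top[of 0]
  proof eventually_elim
    case (elim n)
    let ?U = "uniform_measure P (alive n)"
    interpret U: prob_space ?U
      by (rule prob_space_uniform_measure) (use elim in \<open>auto simp: P.emeasure_eq_measure\<close>)
    have pred: "Measurable.pred P (\<lambda>\<omega>. measure (pop_measure E (Z n \<omega>)) (space E) > 0)"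
      unfolding pred_def alive_eq by (rule alive_sets)
    have "1 - cdf (cond_law n) (c * t) = 1 - measure ?U {\<omega> \<in> space P. score n \<omega> / real n \<le> c * t}"
      unfolding cdf_def by (subst measure_distr) (auto intro!: arg_cong[where f = "measure ?U"])
    also have "\<dots> = measure ?U (space ?U - {\<omega> \<in> space P. score n \<omega> / real n \<le> c * t})"
      by (subst U.prob_compl) auto
    \<comment> \<open>The complement of a closed half-line is the strict inequality of the claim;
      clearing denominators uses c > 0 and n > 0.\<close>
    also have "space ?U - {\<omega> \<in> space P. score n \<omega> / real n \<le> c * t} = {\<omega> \<in> space P. score n \<omega> / c > real n * t}"
      using c elim by (auto simp: field_simps not_le)
    also have "measure ?U \<dots> = \<P>(\<omega> in ?U. score n \<omega> / c > real n * t)" by simp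
    also have "\<dots> = \<P>(\<omega> in P. score n \<omega> / c > real n * t \<bar> measure (pop_measure E (Z n \<omega>)) (space E) > 0)"
      unfolding alive_eq[symmetric] by (rule P.measure_uniform_measure_eq_cond_prob[OF _ pred]) measurable
    finally show ?case .
  qed
  from Lim_transform_eventually[OF lim this] show ?thesis by (simp add: c_def l_def)
qed

end

text \<open>If \<open>S\<close> is nonzero, the quotient of the two sides tends to 1. If it is 0,
  both sides vanish for n > 0, and eventually equal functions are asymptotically equivalent even
  when they are 0.\<close>

lemma surv_asymp_equiv: "surv \<sim>[sequentially] (\<lambda>n. inverse (real n) * inverse (1 + m) * lf_u E K m 1 x)"
proof -
  have eq: "inverse (real n) * inverse (1 + m) * lf_u E K m 1 x = S / real n" for n
  proof -
    have u: "inverse (1 + m) * lf_u E K m 1 x = S" using m_pos by (simp add: lf_u_eq)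
    show ?thesis unfolding mult.assoc u by (simp add: divide_inverse mult.commute)
  qed
  show ?thesis
  proof (cases "S = 0")
    case True
    show ?thesis unfolding eq
      by (rule asymp_equiv_refl_ev)
         (use eventually_gt_at_top[of 0] in eventually_elim, simp add: True surv_eq_0)
  next
    case False
    have "(\<lambda>n. real n * surv n / S) \<longlonglongrightarrow> S / S"
      using False by (intro tendsto_intros n_surv_tendsto)
    then show ?thesis unfolding eq using False
      by (intro asymp_equivI') (simp add: mult.commute)
  qed
qed

end

text \<open>The first asymptotics is free of \<beta> because \<open>lf_u\<close> is not normalised:
  its \<nu>-integral is \<beta>. Weak convergence of the random measures is expressed through their
  integrals of \<nu>-integrable \<open>w\<close>, with an exponential variable of rate \<beta> / (1
  + m), hence of mean (1 + m) / \<beta>. Eventual positivity of survival guards the conditioning; it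
  fails exactly when \<open>K x\<close> has mass 0.\<close>

theorem proposition8:
  fixes E :: "'a measure" and K :: "'a \<Rightarrow> 'a measure" and \<gamma> :: "'a measure"
    and m R \<rho> \<beta> :: real and x :: 'a
    and P :: "'w measure" and Z :: "nat \<Rightarrow> 'w \<Rightarrow> 'a list"
  assumes "lf_triplet E K \<gamma> m"
    and "lf_process E K \<gamma> m x P Z"
    and "lf_f E K \<gamma> (lf_Rstar E K \<gamma>) \<ge> ennreal (1 / m)"
    and "0 < R" and "ennreal m * lf_f E K \<gamma> (ennreal R) = 1"
    and "x \<in> kernel_fin E K (ennreal R)"
    and "lf_f' E K \<gamma> (ennreal R) < \<infinity>"
    and "\<rho> = inverse R"
    and "\<beta> = m * R * enn2real (lf_f' E K \<gamma> (ennreal R))"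
    and "\<rho> = 1"
  shows "((\<lambda>n. \<P>(\<omega> in P. measure (pop_measure E (Z n \<omega>)) (space E) > 0))
           \<sim>[sequentially] (\<lambda>n. inverse (real n) * inverse (1 + m) * lf_u E K m R x)) \<and>
         ((\<forall>\<^sub>F n in sequentially. \<P>(\<omega> in P. measure (pop_measure E (Z n \<omega>)) (space E) > 0) > 0) \<longrightarrow>
         (\<forall>w :: 'a \<Rightarrow> real. w \<in> borel_measurable E \<longrightarrow> integrable (lf_nu E K \<gamma> m R) w \<longrightarrow>
            (\<integral>y. w y \<partial>lf_nu E K \<gamma> m R) > 0 \<longrightarrow>
            (\<forall>t\<ge>0. (\<lambda>n. \<P>(\<omega> in P.
                 (\<integral>y. w y \<partial>pop_measure E (Z n \<omega>)) / (\<integral>y. w y \<partial>lf_nu E K \<gamma> m R) > real n * t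
                 \<bar> measure (pop_measure E (Z n \<omega>)) (space E) > 0))
               \<longlonglongrightarrow> exp (- t * \<beta> / (1 + m)))) \<and>
         (\<forall>w :: 'a \<Rightarrow> real. w \<in> borel_measurable E \<longrightarrow> integrable (lf_nu E K \<gamma> m R) w \<longrightarrow>
            weak_conv_m
              (\<lambda>n. distr
                 (uniform_measure P {\<omega> \<in> space P. measure (pop_measure E (Z n \<omega>)) (space E) > 0})
                 borel (\<lambda>\<omega>. (\<integral>y. w y \<partial>pop_measure E (Z n \<omega>)) / real n))
              (distr (density lborel (exponential_density (\<beta> / (1 + m)))) borel
                 (\<lambda>X. X * (\<integral>y. w y \<partial>lf_nu E K \<gamma> m R)))))"
proof -
  have R: "R = 1" using assms(8,10) by (simp add: inverse_eq_1_iff)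
  interpret lf_critical_process E K \<gamma> m \<beta> x P Z
    using assms by unfold_locales (simp_all add: R)
  show ?thesis
    unfolding R alive_eq
  proof (intro conjI impI allI)
    show "surv \<sim>[sequentially] (\<lambda>n. inverse (real n) * inverse (1 + m) * lf_u E K m 1 x)"
      by (rule surv_asymp_equiv)
  next
    fix w :: "'a \<Rightarrow> real" and t :: real
    assume "\<forall>\<^sub>F n in sequentially. 0 < surv n" "integrable nu w" "0 < (\<integral>y. w y \<partial>nu)" "0 \<le> t"
    then show "(\<lambda>n. \<P>(\<omega> in P. (\<integral>y. w y \<partial>pop_measure E (Z n \<omega>)) / (\<integral>y. w y \<partial>nu) > real n * t
        \<bar> measure (pop_measure E (Z n \<omega>)) (space E) > 0)) \<longlonglongrightarrow> exp (- t * \<beta> / (1 + m))"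
      using tail_cond_law[of w t] by (simp only: score_def)
  next
    fix w :: "'a \<Rightarrow> real"
    assume "\<forall>\<^sub>F n in sequentially. 0 < surv n" "integrable nu w"
    then show "weak_conv_m
        (\<lambda>n. distr (uniform_measure P (alive n)) borel (\<lambda>\<omega>. (\<integral>y. w y \<partial>pop_measure E (Z n \<omega>)) / real n))
        (distr (density lborel (exponential_density (\<beta> / (1 + m)))) borel (\<lambda>X. X * (\<integral>y. w y \<partial>nu)))"
      using weak_conv_cond_law[of w] by (simp only: score_def)
  qed
qed

end
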